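(* Consider the game described in the context and suppose that: $\mathbf A$ is symmetric; $N_t^c|\mathcal N^c|\ge S$ and $N_t^a|\mathcal N^a|\ge S$; $\mathbf B^c(k)$ is i.i.d. over $k$ with $\Pr(\mathrm{rank}(\mathbf B^c(k))=S)=\delta$ and $\Pr(\mathbf B^c(k)=\mathbf 0)=1-\delta$; and the minimum non-zero singular value of $\mathbf B^c(k)$ is bounded away from $0$ with probability $1$. Then the game value exists if $\delta$ and $\mathbf R^a$ satisfy $$\delta>1-\rho^{-2}(\mathbf A),\qquad \mathbf R^a\succ\gamma_1\big(1-(1-\delta)\rho^2(\mathbf A)\big)^{-2}\mathbf I,$$ where $\gamma_1$ is some positive constant scalar (i.e. there is a positive constant $\gamma_1$ for which this implication holds).
   Context: Notation. $\mathbb S_+^{n}$ is the set of real symmetric positive definite $n\times n$ matrices; $\succ$ is the Loewner order; $\|\mathbf a\|_{\mathbf M}^2=\mathbf a^T\mathbf M\mathbf a$; $\rho$ is the spectral radius. Expectations appearing are presupposed to exist. System. $\mathcal N^c=\{1,\dots,|\mathcal N^c|\}$ indexes controllers and also actuators, $\mathcal N^a=\{1,\dots,|\mathcal N^a|\}$ indexes attackers. For $k=0,1,2,\dots$ the state $\mathbf x(k)\in\mathbb R^S$ satisfies $$\mathbf x(k+1)=\mathbf A\mathbf x(k)+\mathbf B^c(k)\mathbf u^c(k)+\mathbf B^a(k)\mathbf u^a(k)+\sum_{i\in\mathcal N^c}\mathbf B_i\mathbf v_i(k)+\mathbf w(k),$$ with $\mathbf x(0)$ constant, $\mathbf A\in\mathbb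 R^{S\times S}$, $\mathbf B_i\in\mathbb R^{S\times N_r}$, and horizontally concatenated matrices $\mathbf B^c(k)=[\sum_{i}\mathbf B_i\mathbf H^c_{j,i}(k)]_{j\in\mathcal N^c}\in\mathbb R^{S\times N_t^c|\mathcal N^c|}$, $\mathbf B^a(k)=[\sum_{i}\mathbf B_i\mathbf H^a_{l,i}(k)]_{l\in\mathcal N^a}\in\mathbb R^{S\times N_t^a|\mathcal N^a|}$, where $\mathbf H^c_{j,i}(k)\in\mathbb R^{N_r\times N_t^c}$, $\mathbf H^a_{l,i}(k)\in\mathbb R^{N_r\times N_t^a}$ are random. $\mathbf u^c(k)$, $\mathbf u^a(k)$ stack the individual actions $\mathbf u^c_j(k)\in\mathbb R^{N_t^c}$, $\mathbf u^a_l(k)\in\mathbb R^{N_t^a}$. Randomness. $\mathbf w(k)$ is i.i.d. in $k$, zero mean, finite covariance $\mathbf W$; $\mathbf v_i(k)$ is i.i.d. in $k$ and $i$, zero mean, finite covariance $\mathbf V$; $(\mathbf H^c_{j,i}(k))_{j,i}$ is i.i.d. in $k$; $(\mathbf H^a_{l,i}(k))_{l,i}$ is i.i.d. in $k$; these four processes are mutually independent. Policies. The information at time $k$ is $\mathcal I(k)=\{\mathbf x(\tilde k),\mathbf B^c(\tilde k)\}_{0\le\tilde k\le k}$. Control and attack policies are sequences of Borel measurable maps $\mathbf u^c_j(k)=\boldsymbol\mu^c_j(\mathcal I(k),k)$, $\mathbf u^a_l(k)=\boldsymbol\mu^a_l(\mathcal I(k),k)$; $\mathcal U^c,\mathcal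 U^a$ are the sets of all such policies. Cost and value. With $\mathbf Q\in\mathbb S_+^S$, $\mathbf R^c=\mathrm{diag}(\mathbf R^c_j)_{j\in\mathcal N^c}$, $\mathbf R^c_j\in\mathbb S_+^{N_t^c}$, $\mathbf R^a=\mathrm{diag}(\mathbf R^a_l)_{l\in\mathcal N^a}$, $\mathbf R^a_l\in\mathbb S_+^{N_t^a}$, $$J=\lim_{K\to\infty}\frac1K\sum_{k=0}^{K-1}\mathbb E\big[\|\mathbf x(k+1)\|_{\mathbf Q}^2+\|\mathbf u^c(k)\|^2_{\mathbf R^c}-\|\mathbf u^a(k)\|^2_{\mathbf R^a}\big].$$ The value exists iff $\inf_{\{\boldsymbol\mu^c_j\}\in(\mathcal U^c)^{|\mathcal N^c|}}\sup_{\{\boldsymbol\mu^a_l\}\in(\mathcal U^a)^{|\mathcal N^a|}}J=\sup_{\{\boldsymbol\mu^a_l\}}\inf_{\{\boldsymbol\mu^c_j\}}J$, and is then this common number. *)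

theory Defs
  imports "HOL-Probability.Probability"
begin

section \<open>Matrices\<close>

definition pos_def :: "real^'n^'n \<Rightarrow> bool" where
  "pos_def M \<longleftrightarrow> transpose M = M \<and> (\<forall>a. a \<noteq> 0 \<longrightarrow> 0 < a \<bullet> (M *v a))"

definition loewner_greater :: "real^'n^'n \<Rightarrow> real^'n^'n \<Rightarrow> bool" (infix "\<succ>\<^sub>L" 50) where
  "M \<succ>\<^sub>L N \<longleftrightarrow> pos_def (M - N)"

definition wnorm2 :: "real^'n^'n \<Rightarrow> real^'n \<Rightarrow> real" where
  "wnorm2 M a = a \<bullet> (M *v a)"

definition spectral_radius :: "real^'n^'n \<Rightarrow> real" where
  "spectral_radius A =
     Max {cmod e | e. \<exists>z :: complex^'n. z \<noteq> 0 \<and> (\<chi> i j. complex_of_real (A $ i $ j)) *v z = e *s z}"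

definition singular_values :: "real^'n^'m \<Rightarrow> real set" where
  "singular_values M = {s. 0 \<le> s \<and> (\<exists>a. a \<noteq> 0 \<and> (transpose M ** M) *v a = s\<^sup>2 *s a)}"

text \<open>
  Stacked vectors and concatenated matrices are indexed by pairs (agent, component).
\<close>

definition stack :: "('j::finite \<Rightarrow> real^'t::finite) \<Rightarrow> real^('j \<times> 't)" where
  "stack u = (\<chi> p. u (fst p) $ snd p)"

definition hconcat :: "('j::finite \<Rightarrow> real^'t::finite^'s) \<Rightarrow> real^('j \<times> 't)^'s" where
  "hconcat F = (\<chi> s p. F (fst p) $ s $ snd p)"

definition block_diag :: "('j::finite \<Rightarrow> real^'t::finite^'t) \<Rightarrow> real^('j \<times> 't)^('j \<times> 't)" where
  "block_diag R = (\<chi> p q. if fst p = fst q then R (fst p) $ snd p $ snd q else 0)"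

text \<open>
  In \<open>H $ j $ i\<close> the index \<open>j\<close> is the transmitting agent and \<open>i\<close> the receiving actuator.
\<close>

definition input_matrix ::
    "('c::finite \<Rightarrow> real^'r^'s) \<Rightarrow> real^'t::finite^'r^'c^'j::finite \<Rightarrow> real^('j \<times> 't)^'s" where
  "input_matrix B H = hconcat (\<lambda>j. \<Sum>i\<in>UNIV. B i ** (H $ j $ i))"


section \<open>Randomness\<close>

definition iid :: "'w measure \<Rightarrow> ('i \<Rightarrow> 'w \<Rightarrow> 'b::topological_space) \<Rightarrow> bool" where
  "iid M X \<longleftrightarrow> prob_space.indep_vars M (\<lambda>_. borel) X UNIV \<and>
     (\<forall>i j. distr M borel (X i) = distr M borel (X j))"

definition zero_mean_cov :: "'w measure \<Rightarrow> ('w \<Rightarrow> real^'n) \<Rightarrow> real^'n^'n \<Rightarrow> bool" where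
  "zero_mean_cov M X C \<longleftrightarrow>
     (\<forall>a. integrable M (\<lambda>\<omega>. X \<omega> $ a) \<and> (\<integral>\<omega>. X \<omega> $ a \<partial>M) = 0) \<and>
     (\<forall>a b. integrable M (\<lambda>\<omega>. X \<omega> $ a * X \<omega> $ b) \<and> (\<integral>\<omega>. X \<omega> $ a * X \<omega> $ b \<partial>M) = C $ a $ b)"

definition generated_events :: "'w measure \<Rightarrow> ('i \<Rightarrow> 'w \<Rightarrow> 'b::topological_space) \<Rightarrow> 'w set set" where
  "generated_events M X = sigma_sets (space M) {X i -` E \<inter> space M | i E. E \<in> sets borel}"

text \<open>
  The law \<open>N\<close> of the attack channel is a parameter, so that it can be kept fixed
  while the law of the control channel varies.
\<close>

definition game_randomness ::
    "'w measure \<Rightarrow> real^'s^'s \<Rightarrow> real^'r^'r \<Rightarrow> (real^'ta^'r^'c^'l) measure \<Rightarrow>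
     (nat \<Rightarrow> 'w \<Rightarrow> real^'s) \<Rightarrow> (nat \<Rightarrow> 'c \<Rightarrow> 'w \<Rightarrow> real^'r) \<Rightarrow>
     (nat \<Rightarrow> 'w \<Rightarrow> real^'tc^'r^'c^'c) \<Rightarrow> (nat \<Rightarrow> 'w \<Rightarrow> real^'ta^'r^'c^'l) \<Rightarrow> bool" where
  "game_randomness M W V N w v Hc Ha \<longleftrightarrow>
     prob_space M \<and>
     iid M w \<and> (\<forall>k. zero_mean_cov M (w k) W) \<and>
     iid M (\<lambda>(k, i). v k i) \<and> (\<forall>k i. zero_mean_cov M (v k i) V) \<and>
     iid M Hc \<and>
     iid M Ha \<and> (\<forall>k. distr M borel (Ha k) = N) \<and>
     prob_space.indep_sets M
       ((!) [generated_events M w, generated_events M (\<lambda>(k, i). v k i),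
             generated_events M Hc, generated_events M Ha]) {..<4}"


section \<open>Policies and closed loop\<close>

text \<open>
  \<open>'m\<close> indexes the columns of the control input matrix, \<open>'t\<close> the components of the action.
\<close>

type_synonym ('s, 'm) info = "nat \<Rightarrow> (real^'s) \<times> (real^'m^'s)"
type_synonym ('s, 'm, 't) policy = "nat \<Rightarrow> ('s, 'm) info \<Rightarrow> real^'t"

definition policies :: "('s::finite, 'm::finite, 't::finite) policy set" where
  "policies = {\<mu>. \<forall>k. \<mu> k \<in> Pi\<^sub>M {..k} (\<lambda>_. borel) \<rightarrow>\<^sub>M borel}"

definition profiles :: "('j \<Rightarrow> ('s::finite, 'm::finite, 't::finite) policy) set" where
  "profiles = {\<mu>. \<forall>j. \<mu> j \<in> policies}"

definition information ::
    "(nat \<Rightarrow> real^'s) \<Rightarrow> (nat \<Rightarrow> real^'m^'s) \<Rightarrow> nat \<Rightarrow> ('s::finite, 'm::finite) info" where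
  "information x bc k = restrict (\<lambda>n. (x n, bc n)) {..k}"

definition actions ::
    "('j::finite \<Rightarrow> ('s::finite, 'm::finite, 't::finite) policy) \<Rightarrow> nat \<Rightarrow> ('s, 'm) info \<Rightarrow>
     real^('j \<times> 't)" where
  "actions \<mu> k I = stack (\<lambda>j. \<mu> j k I)"

text \<open>
  Pathwise closed loop for realised input matrices \<open>bc\<close>, \<open>ba\<close> and disturbance \<open>d\<close>;
  \<open>traj \<dots> k\<close> is meaningful only at times up to \<open>k\<close>.
\<close>

primrec traj ::
    "real^'s^'s \<Rightarrow> (nat \<Rightarrow> real^('c \<times> 'tc)^'s) \<Rightarrow> (nat \<Rightarrow> real^('l \<times> 'ta)^'s) \<Rightarrow> (nat \<Rightarrow> real^'s) \<Rightarrow>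
     real^'s \<Rightarrow> ('c::finite \<Rightarrow> ('s::finite, 'c \<times> 'tc, 'tc::finite) policy) \<Rightarrow>
     ('l::finite \<Rightarrow> ('s, 'c \<times> 'tc, 'ta::finite) policy) \<Rightarrow> nat \<Rightarrow> nat \<Rightarrow> real^'s" where
  "traj A bc ba d x0 \<mu>c \<mu>a 0 = (\<lambda>_. x0)"
| "traj A bc ba d x0 \<mu>c \<mu>a (Suc k) =
     (let x = traj A bc ba d x0 \<mu>c \<mu>a k; I = information x bc k
      in x(Suc k := A *v x k + bc k *v actions \<mu>c k I + ba k *v actions \<mu>a k I + d k))"

definition state ::
    "real^'s^'s \<Rightarrow> (nat \<Rightarrow> real^('c \<times> 'tc)^'s) \<Rightarrow> (nat \<Rightarrow> real^('l \<times> 'ta)^'s) \<Rightarrow> (nat \<Rightarrow> real^'s) \<Rightarrow>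
     real^'s \<Rightarrow> ('c::finite \<Rightarrow> ('s::finite, 'c \<times> 'tc, 'tc::finite) policy) \<Rightarrow>
     ('l::finite \<Rightarrow> ('s, 'c \<times> 'tc, 'ta::finite) policy) \<Rightarrow> nat \<Rightarrow> real^'s" where
  "state A bc ba d x0 \<mu>c \<mu>a k = traj A bc ba d x0 \<mu>c \<mu>a k k"

definition stage_cost ::
    "real^'s^'s \<Rightarrow> ('c \<Rightarrow> real^'tc^'tc) \<Rightarrow> ('l \<Rightarrow> real^'ta^'ta) \<Rightarrow>
     real^'s^'s \<Rightarrow> (nat \<Rightarrow> real^('c \<times> 'tc)^'s) \<Rightarrow> (nat \<Rightarrow> real^('l \<times> 'ta)^'s) \<Rightarrow> (nat \<Rightarrow> real^'s) \<Rightarrow>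
     real^'s \<Rightarrow> ('c::finite \<Rightarrow> ('s::finite, 'c \<times> 'tc, 'tc::finite) policy) \<Rightarrow>
     ('l::finite \<Rightarrow> ('s, 'c \<times> 'tc, 'ta::finite) policy) \<Rightarrow> nat \<Rightarrow> real" where
  "stage_cost Q Rc Ra A bc ba d x0 \<mu>c \<mu>a k =
     (let x = state A bc ba d x0 \<mu>c \<mu>a; I = information x bc k
      in wnorm2 Q (x (Suc k)) + wnorm2 (block_diag Rc) (actions \<mu>c k I)
           - wnorm2 (block_diag Ra) (actions \<mu>a k I))"


section \<open>Cost and value\<close>

text \<open>
  All Borel policies are allowed, so a stage cost need not be integrable.  In that case the
  expectation is \<open>E f\<^sup>+ - E f\<^sup>-\<close>, and the undefined \<open>\<infinity> - \<infinity>\<close>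
  is charged to the maximising attacker.
\<close>

definition ext_expectation :: "'w measure \<Rightarrow> ('w \<Rightarrow> real) \<Rightarrow> ereal" where
  "ext_expectation M f =
     (if (\<integral>\<^sup>+\<omega>. ennreal (- f \<omega>) \<partial>M) = \<infinity> then - \<infinity>
      else enn2ereal (\<integral>\<^sup>+\<omega>. ennreal (f \<omega>) \<partial>M) - enn2ereal (\<integral>\<^sup>+\<omega>. ennreal (- f \<omega>) \<partial>M))"

lemma ext_expectation_integrable:
  assumes "integrable M f"
  shows "ext_expectation M f = ereal (\<integral>\<omega>. f \<omega> \<partial>M)"
proof -
  have p: "(\<integral>\<^sup>+\<omega>. ennreal (f \<omega>) \<partial>M) \<noteq> \<infinity>" and n: "(\<integral>\<^sup>+\<omega>. ennreal (- f \<omega>) \<partial>M) \<noteq> \<infinity>"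
    using assms by (auto simp: real_integrable_def)
  obtain a where a: "0 \<le> a" "(\<integral>\<^sup>+\<omega>. ennreal (f \<omega>) \<partial>M) = ennreal a"
    using p by (cases "\<integral>\<^sup>+\<omega>. ennreal (f \<omega>) \<partial>M") auto
  obtain b where b: "0 \<le> b" "(\<integral>\<^sup>+\<omega>. ennreal (- f \<omega>) \<partial>M) = ennreal b"
    using n by (cases "\<integral>\<^sup>+\<omega>. ennreal (- f \<omega>) \<partial>M") auto
  from a b show ?thesis
    by (simp add: ext_expectation_def real_lebesgue_integral_def[OF assms] enn2ereal_ennreal)
qed

text \<open>
  Partial sums in which the first infinite term is absorbing: a player who makes some stage cost
  infinitely unfavourable to itself cannot compensate for this at a later stage.
\<close>

primrec running_total :: "(nat \<Rightarrow> ereal) \<Rightarrow> nat \<Rightarrow> ereal" where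
  "running_total c 0 = 0"
| "running_total c (Suc K) =
     (if \<bar>running_total c K\<bar> = \<infinity> then running_total c K else running_total c K + c K)"

lemma running_total_finite:
  assumes "\<And>k. k < K \<Longrightarrow> \<bar>c k\<bar> \<noteq> \<infinity>"
  shows "running_total c K = (\<Sum>k<K. c k)"
  using assms
proof (induction K)
  case (Suc K)
  then have "\<bar>\<Sum>k<K. c k\<bar> \<noteq> \<infinity>"
    by (simp add: sum_Inf)
  with Suc show ?case by simp
qed simp

text \<open>
  The limit of the averages is read as a limit superior, which is defined for every policy pair.
\<close>

definition average_cost ::
    "'w measure \<Rightarrow> real^'s^'s \<Rightarrow> ('c::finite \<Rightarrow> real^'r^'s) \<Rightarrow>
     real^'s^'s \<Rightarrow> ('c \<Rightarrow> real^'tc^'tc) \<Rightarrow> ('l \<Rightarrow> real^'ta^'ta) \<Rightarrow> real^'s \<Rightarrow>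
     (nat \<Rightarrow> 'w \<Rightarrow> real^'s) \<Rightarrow> (nat \<Rightarrow> 'c \<Rightarrow> 'w \<Rightarrow> real^'r) \<Rightarrow>
     (nat \<Rightarrow> 'w \<Rightarrow> real^'tc^'r^'c^'c) \<Rightarrow> (nat \<Rightarrow> 'w \<Rightarrow> real^'ta^'r^'c^'l) \<Rightarrow>
     ('c \<Rightarrow> ('s::finite, 'c \<times> 'tc, 'tc::finite) policy) \<Rightarrow>
     ('l::finite \<Rightarrow> ('s, 'c \<times> 'tc, 'ta::finite) policy) \<Rightarrow> ereal" where
  "average_cost M A B Q Rc Ra x0 w v Hc Ha \<mu>c \<mu>a =
     limsup (\<lambda>K. running_total
       (\<lambda>k. ext_expectation M (\<lambda>\<omega>. stage_cost Q Rc Ra A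
          (\<lambda>n. input_matrix B (Hc n \<omega>)) (\<lambda>n. input_matrix B (Ha n \<omega>))
          (\<lambda>n. (\<Sum>i\<in>UNIV. B i *v v n i \<omega>) + w n \<omega>) x0 \<mu>c \<mu>a k)) K / ereal (real K))"

definition has_game_value ::
    "(('c \<Rightarrow> ('s::finite, 'm::finite, 'tc::finite) policy) \<Rightarrow>
      ('l \<Rightarrow> ('s, 'm, 'ta::finite) policy) \<Rightarrow> ereal) \<Rightarrow> real \<Rightarrow> bool" where
  "has_game_value J val \<longleftrightarrow>
     (INF \<mu>c\<in>profiles. SUP \<mu>a\<in>profiles. J \<mu>c \<mu>a) = ereal val \<and>
     (SUP \<mu>a\<in>profiles. INF \<mu>c\<in>profiles. J \<mu>c \<mu>a) = ereal val"

end

(*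
  Write Z for the cost matrix of the next state. The stage game, averaged over the attack channel, is
  strictly convex in the control and, as long as Ra exceeds the second moment of the attack channel
  weighted by Z, strictly concave in the attack. Its saddle point solves a linear system and its value
  is a quadratic form in the state; averaging over the control channel gives the Riccati map.
  Iterated from Q, the map increases and stays below a multiple z of the identity: a control channel of
  full rank cancels the drift at bounded cost, and the zero channel inflates z by at most
  (1 - delta) rho^2 (1 + eps/2), where eps = 1 - (1 - delta) rho^2. This requires Ra of order z / eps
  with z of order 1 / eps, hence the exponent -2.
  The saddle control of the limit bounds the cost from above by a telescoping argument. An attacker
  who restarts a finite-horizon optimal attack in blocks of length T secures the average of the
  first T finite-horizon costs, without any stability of the closed loop. Both bounds tend
  to the same number.
*)
theory Submission
  imports Defs
begin

section \<open>Linear algebra\<close>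

text \<open>Policies are arbitrary Borel maps, so no stage cost is known to be integrable and every
  expectation has to be secured before it can be telescoped. Against the saddle control, an attack
  outside L2 costs -infinity; against a linear attack, a control or next state outside L2 costs
  +infinity. Infinite terms are absorbing in \<open>running_total\<close>, so up to the first of
  them all states are square integrable. The control matrix has no bound from above either. Still,
  the saddle gains, and even \<open>b\<close> times the control gain, are bounded uniformly in
  \<open>b\<close>, by comparison with zero control. The attacker does not use the limit Z: the
  telescoped sum would keep the terminal term in Z - Q, whose sign then forbids dropping it. A
  finite-horizon attack ends with terminal weight zero, and the value of the next block is
  nonnegative, so a restart loses nothing. In the upper bound the terminal term has the favourable
  sign, and there Z need only be a supersolution of the Riccati equation.\<close>

lemma inner_matrix_adjoint:
  fixes M :: "real^'n^'m"
  shows "x \<bullet> (M *v y) = (transpose M *v x) \<bullet> y"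
  by (simp add: dot_lmul_matrix)

lemma inner_symmetric_matrix:
  fixes M :: "real^'n^'n"
  assumes "transpose M = M"
  shows "x \<bullet> (M *v y) = y \<bullet> (M *v x)"
  by (metis assms inner_commute inner_matrix_adjoint)

lemma norm_matrix_vector_mult_le:
  fixes M :: "real^'n^'m"
  shows "norm (M *v x) \<le> norm M * norm x"
proof -
  have "(norm (M *v x))\<^sup>2 = (\<Sum>i\<in>UNIV. ((M$i) \<bullet> x)\<^sup>2)"
    by (simp add: norm_vec_def L2_set_def sum_nonneg matrix_vector_mul_component)
  also have "\<dots> \<le> (\<Sum>i\<in>UNIV. (norm (M$i))\<^sup>2 * (norm x)\<^sup>2)"
    by (intro sum_mono) (metis Cauchy_Schwarz_ineq power2_norm_eq_inner)
  also have "\<dots> = (norm M * norm x)\<^sup>2"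
    unfolding power_mult_distrib sum_distrib_right[symmetric]
    by (simp add: norm_vec_def[of M] L2_set_def sum_nonneg)
  finally show ?thesis
    by (rule power2_le_imp_le) simp
qed

lemma wnorm2_le_norm:
  fixes M :: "real^'n^'n"
  shows "\<bar>wnorm2 M x\<bar> \<le> norm M * (norm x)\<^sup>2"
proof -
  have "\<bar>wnorm2 M x\<bar> \<le> norm x * norm (M *v x)"
    unfolding wnorm2_def by (rule Cauchy_Schwarz_ineq2)
  also have "\<dots> \<le> norm x * (norm M * norm x)"
    by (intro mult_left_mono norm_matrix_vector_mult_le) auto
  finally show ?thesis by (simp add: power2_eq_square algebra_simps)
qed

lemma wnorm2_add:
  fixes M :: "real^'n^'n"
  assumes "transpose M = M"
  shows "wnorm2 M (x + y) = wnorm2 M x + 2 * (x \<bullet> (M *v y)) + wnorm2 M y"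
  unfolding wnorm2_def
  by (simp add: matrix_vector_right_distrib inner_add_left inner_add_right inner_symmetric_matrix[OF assms, of y x])

lemma wnorm2_scaleR: "wnorm2 M (c *\<^sub>R x) = c\<^sup>2 * wnorm2 M x"
  by (simp add: wnorm2_def matrix_vector_mult_scaleR power2_eq_square)

lemma wnorm2_zero [simp]: "wnorm2 M 0 = 0"
  by (simp add: wnorm2_def)

text \<open>Moving from \<open>x\<close> along \<open>y = M *v x\<close> changes the form at first
  order by 2 t |y|^2. Since the form is minimal at \<open>x\<close>, this slope vanishes.\<close>

lemma psd_kernel:
  fixes M :: "real^'n^'n"
  assumes sym: "transpose M = M" and psd: "\<And>y. 0 \<le> wnorm2 M y" and z: "wnorm2 M x = 0"
  shows "M *v x = 0"
proof -
  define y where "y = M *v x"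
  define c where "c = wnorm2 M y"
  have ineq: "0 \<le> 2 * t * (y \<bullet> y) + t\<^sup>2 * c" for t
  proof -
    have "0 \<le> wnorm2 M (x + t *\<^sub>R y)" by (rule psd)
    also have "\<dots> = 2 * t * (y \<bullet> y) + t\<^sup>2 * c"
      unfolding wnorm2_add[OF sym] wnorm2_scaleR z c_def
      using inner_symmetric_matrix[OF sym, of x y]
      by (simp add: matrix_vector_mult_scaleR y_def)
    finally show ?thesis .
  qed
  have c0: "0 \<le> c" unfolding c_def by (rule psd)
  have "y \<bullet> y = 0"
  proof (rule ccontr)
    assume "y \<bullet> y \<noteq> 0"
    then have yp: "y \<bullet> y > 0" by simp
    \<comment> \<open>Almost the vertex of the parabola; \<open>c + 1\<close> instead of
      \<open>c\<close> keeps the quotient defined when \<open>c\<close> is 0.\<close>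
    define t where "t = - (y \<bullet> y) / (c + 1)"
    have "t\<^sup>2 * c \<le> t\<^sup>2 * (c + 1)" by (simp add: mult_left_mono)
    also have "\<dots> = t * (t * (c + 1))" by (simp add: power2_eq_square)
    also have "t * (c + 1) = - (y \<bullet> y)" using c0 by (simp add: t_def)
    finally have "t\<^sup>2 * c \<le> - t * (y \<bullet> y)" by simp
    then have "0 \<le> t * (y \<bullet> y)" using ineq[of t] by linarith
    moreover have "t < 0" using yp c0 by (simp add: t_def divide_neg_pos)
    ultimately show False using yp by (simp add: zero_le_mult_iff)
  qed
  then show ?thesis by (simp add: y_def)
qed

text \<open>Take a minimiser of the form on the compact unit sphere and let \<open>l\<close> be its
  value. Then M - l I is positive semidefinite and its form vanishes at \<open>x\<close>, so
  \<open>x\<close> lies in its kernel.\<close>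

lemma symmetric_min_eigenvector:
  fixes M :: "real^'n^'n"
  assumes sym: "transpose M = M"
  obtains x l where "norm x = 1" "M *v x = l *\<^sub>R x" "\<And>y. l * (norm y)\<^sup>2 \<le> wnorm2 M y"
proof -
  let ?S = "sphere (0::real^'n) 1"
  have "?S \<noteq> {}" by (simp add: sphere_eq_empty)
  moreover have "continuous_on ?S (wnorm2 M)"
    unfolding wnorm2_def by (intro continuous_intros matrix_vector_mult_linear_continuous_on)
  ultimately obtain x where x: "x \<in> ?S" "\<And>y. y \<in> ?S \<Longrightarrow> wnorm2 M x \<le> wnorm2 M y"
    using continuous_attains_inf[of ?S "wnorm2 M"] by auto
  define l where "l = wnorm2 M x"
  have nx: "norm x = 1" using x(1) by simp
  have min: "l * (norm y)\<^sup>2 \<le> wnorm2 M y" for y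
  proof (cases "y = 0")
    case False
    then have "l \<le> wnorm2 M ((1 / norm y) *\<^sub>R y)"
      unfolding l_def by (intro x(2)) simp
    then show ?thesis using False by (simp add: wnorm2_scaleR power_divide field_simps)
  qed simp
  define M' where "M' = M - l *\<^sub>R mat 1"
  have M'v: "M' *v y = M *v y - l *\<^sub>R y" for y
    unfolding M'_def by (simp add: matrix_vector_mult_diff_rdistrib scaleR_matrix_vector_assoc[symmetric])
  have M'w: "wnorm2 M' y = wnorm2 M y - l * (norm y)\<^sup>2" for y
    unfolding wnorm2_def M'v by (simp add: inner_diff_right power2_norm_eq_inner)
  have "transpose M' = M'"
    using sym by (simp add: M'_def transpose_def vec_eq_iff mat_def) 
  then have "M' *v x = 0"
    by (rule psd_kernel) (use min nx in \<open>auto simp: M'w l_def\<close>)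
  then have "M *v x = l *\<^sub>R x" by (simp add: M'v)
  with nx min show thesis by (intro that)
qed

lemma pos_def_lower_bound:
  assumes "pos_def M"
  obtains m where "0 < m" "\<And>y. m * (norm y)\<^sup>2 \<le> wnorm2 M y"
proof -
  obtain x l where x: "norm x = 1" "M *v x = l *\<^sub>R x" and min: "\<And>y. l * (norm y)\<^sup>2 \<le> wnorm2 M y"
    using symmetric_min_eigenvector[of M] assms unfolding pos_def_def by metis
  have "x \<noteq> 0" using x(1) by auto
  then have "0 < x \<bullet> (M *v x)" using assms unfolding pos_def_def by auto
  then have "0 < l" using x by (simp add: norm_eq_1)
  with min that show thesis by blast
qed

lemma wnorm2_nonneg: "pos_def M \<Longrightarrow> 0 \<le> wnorm2 M x"
  unfolding pos_def_def wnorm2_def by (cases "x = 0") (auto intro: less_imp_le)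

text \<open>\<open>spectral_radius\<close> ranges over complex eigenvectors. For real part p and
  imaginary part q, symmetry of A in the pairing of p with q leaves Im e (|p|^2 + |q|^2) = 0;
  whichever of p and q is nonzero is then a real eigenvector.\<close>

lemma real_symmetric_eigenvalue:
  fixes A :: "real^'n^'n" and z :: "complex^'n"
  assumes sym: "transpose A = A" and z: "z \<noteq> 0"
    and e: "(\<chi> i j. complex_of_real (A $ i $ j)) *v z = e *s z"
  obtains x :: "real^'n" where "x \<noteq> 0" "A *v x = Re e *\<^sub>R x" "Im e = 0"
proof -
  define p q :: "real^'n" where "p = (\<chi> i. Re (z$i))" and "q = (\<chi> i. Im (z$i))"
  have ez: "(\<Sum>j\<in>UNIV. complex_of_real (A$i$j) * z$j) = e * z$i" for i
    using e by (simp add: vec_eq_iff matrix_vector_mult_def)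
  have Ap: "A *v p = Re e *\<^sub>R p - Im e *\<^sub>R q"
    using arg_cong[OF ez, of Re] by (simp add: vec_eq_iff matrix_vector_mult_def p_def q_def)
  have Aq: "A *v q = Re e *\<^sub>R q + Im e *\<^sub>R p"
    using arg_cong[OF ez, of Im] by (simp add: vec_eq_iff matrix_vector_mult_def p_def q_def)
  have nz: "p \<noteq> 0 \<or> q \<noteq> 0"
    using z by (auto simp: vec_eq_iff p_def q_def complex_eq_iff)
  have "q \<bullet> (A *v p) = p \<bullet> (A *v q)" by (rule inner_symmetric_matrix[OF sym])
  then have "Im e * (p \<bullet> p + q \<bullet> q) = 0"
    unfolding Ap Aq by (simp add: inner_diff_right inner_add_right inner_commute algebra_simps)
  moreover have "p \<bullet> p + q \<bullet> q > 0"
    using nz by (metis add_nonneg_pos add_pos_nonneg inner_ge_zero inner_gt_zero_iff)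
  ultimately have "Im e = 0" by auto
  with nz Ap Aq that show thesis by auto
qed

text \<open>\<open>spectral_radius\<close> is a \<open>Max\<close>, which is informative only over a
  finite set. Eigenvectors of distinct eigenvalues are orthogonal, hence independent, which limits
  their number.\<close>

lemma finite_symmetric_eigenvalues:
  fixes A :: "real^'n^'n"
  assumes sym: "transpose A = A"
  shows "finite {l. \<exists>x. x \<noteq> 0 \<and> A *v x = l *\<^sub>R x}" (is "finite ?L")
proof -
  have "\<forall>l\<in>?L. \<exists>x. x \<noteq> 0 \<and> A *v x = l *\<^sub>R x" by simp
  then obtain f where f: "\<And>l. l \<in> ?L \<Longrightarrow> f l \<noteq> 0 \<and> A *v f l = l *\<^sub>R f l"
    using bchoice[of ?L "\<lambda>l x. x \<noteq> 0 \<and> A *v x = l *\<^sub>R x"] by blast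
  have orth: "f l \<bullet> f m = 0" if "l \<in> ?L" "m \<in> ?L" "l \<noteq> m" for l m
  proof -
    have "f l \<bullet> (A *v f m) = f m \<bullet> (A *v f l)" by (rule inner_symmetric_matrix[OF sym])
    then have "(m - l) * (f l \<bullet> f m) = 0"
      using f[OF that(1)] f[OF that(2)] by (simp add: inner_commute algebra_simps)
    with that(3) show ?thesis by simp
  qed
  have inj: "inj_on f ?L"
  proof (rule inj_onI, rule ccontr)
    fix l m assume lm: "l \<in> ?L" "m \<in> ?L" "f l = f m" "l \<noteq> m"
    then have "f l \<bullet> f l = 0" using orth[of l m] by simp
    then show False using f[OF lm(1)] by simp
  qed
  have "pairwise orthogonal (f ` ?L)"
    using orth unfolding pairwise_def orthogonal_def by blast
  moreover have "0 \<notin> f ` ?L" using f by (metis (no_types, lifting) imageE)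
  ultimately have "independent (f ` ?L)" by (rule pairwise_orthogonal_independent)
  then have "finite (f ` ?L)" by (rule independent_imp_finite)
  with inj show ?thesis by (simp add: finite_image_iff)
qed

text \<open>The sharp constant is -m, where \<open>m\<close> is the least eigenvalue of -A^2,
  attained at \<open>y\<close>. With s = sqrt (-m) the factorisation (A - s)(A + s) y = 0 yields an
  eigenvector of A itself, for s or for -s.\<close>

lemma norm_le_spectral_radius:
  fixes A :: "real^'n^'n"
  assumes sym: "transpose A = A"
  shows "(norm (A *v x))\<^sup>2 \<le> (spectral_radius A)\<^sup>2 * (norm x)\<^sup>2"
proof -
  let ?E = "{cmod e | e. \<exists>z :: complex^'n. z \<noteq> 0 \<and> (\<chi> i j. complex_of_real (A $ i $ j)) *v z = e *s z}"
  have "?E \<subseteq> abs ` {l. \<exists>x. x \<noteq> 0 \<and> A *v x = l *\<^sub>R x}"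
  proof (rule subsetI)
    fix r assume "r \<in> ?E"
    then obtain e and z :: "complex^'n" where ez: "r = cmod e" "z \<noteq> 0"
      "(\<chi> i j. complex_of_real (A $ i $ j)) *v z = e *s z" by blast
    obtain y where y: "y \<noteq> 0" "A *v y = Re e *\<^sub>R y" "Im e = 0"
      by (rule real_symmetric_eigenvalue[OF sym ez(2,3)])
    have "r = \<bar>Re e\<bar>" using y(3) by (simp add: ez(1) cmod_def)
    with y show "r \<in> abs ` {l. \<exists>x. x \<noteq> 0 \<and> A *v x = l *\<^sub>R x}" by blast
  qed
  then have fin: "finite ?E"
    by (rule finite_subset) (intro finite_imageI finite_symmetric_eigenvalues sym)
  have le: "\<bar>l\<bar> \<le> spectral_radius A" if "y \<noteq> 0" "A *v y = l *\<^sub>R y" for l y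
  proof -
    define z :: "complex^'n" where "z = (\<chi> i. complex_of_real (y$i))"
    have "z \<noteq> 0" using that(1) by (simp add: z_def vec_eq_iff)
    moreover have "(\<chi> i j. complex_of_real (A $ i $ j)) *v z = complex_of_real l *s z"
      using that(2) by (simp add: vec_eq_iff z_def matrix_vector_mult_def flip: of_real_mult of_real_sum)
    ultimately have "cmod (complex_of_real l) \<in> ?E" by blast
    then show ?thesis unfolding spectral_radius_def using Max_ge[OF fin] by simp
  qed
  have symA2: "transpose (- (A ** A)) = - (A ** A)"
    using arg_cong[OF matrix_transpose_mul[of A A], of uminus] sym by (simp add: transpose_def vec_eq_iff)
  obtain y m where y: "norm y = 1" "(- (A ** A)) *v y = m *\<^sub>R y"
    and min: "\<And>x. m * (norm x)\<^sup>2 \<le> wnorm2 (- (A ** A)) x"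
    using symmetric_min_eigenvector[OF symA2] by metis
  have neg: "(- (A ** A)) *v x = - (A *v (A *v x))" for x
    unfolding matrix_vector_mul_assoc by (simp add: matrix_vector_mult_def vec_eq_iff sum_negf)
  have w: "wnorm2 (- (A ** A)) x = - (norm (A *v x))\<^sup>2" for x
    unfolding wnorm2_def neg
    by (simp add: power2_norm_eq_inner inner_matrix_adjoint[of x A] sym del: transpose_matrix_vector)
  have bound: "(norm (A *v x))\<^sup>2 \<le> - m * (norm x)\<^sup>2" for x
    using min[of x] by (simp add: w)
  have m: "- m \<ge> 0" using bound[of y] y(1) by (smt (verit) one_power2 mult_cancel_left1 zero_le_power2)
  define s where "s = sqrt (- m)"
  have s2: "s * s = - m" using m by (simp add: s_def)
  have AA: "A *v (A *v y) = (s * s) *\<^sub>R y" using y(2) unfolding neg s2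
    by (metis add.inverse_inverse scaleR_minus_left)
  have "s \<le> spectral_radius A"
  proof (cases "A *v y = - s *\<^sub>R y")
    case True
    have "y \<noteq> 0" using y(1) by auto
    from le[OF this True] show ?thesis by simp
  next
    case False
    define u where "u = A *v y + s *\<^sub>R y"
    have "u \<noteq> 0" using False by (simp add: u_def eq_neg_iff_add_eq_0)
    moreover have "A *v u = s *\<^sub>R u"
      by (simp add: u_def matrix_vector_right_distrib AA matrix_vector_mult_scaleR algebra_simps)
    ultimately show ?thesis using le by fastforce
  qed
  moreover have "0 \<le> s" using m by (simp add: s_def)
  ultimately have "s\<^sup>2 \<le> (spectral_radius A)\<^sup>2" by (simp add: power_mono)
  then have "- m \<le> (spectral_radius A)\<^sup>2" using s2 by (simp add: power2_eq_square)
  with bound[of x] show ?thesis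
    by (meson mult_right_mono order_trans zero_le_power2)
qed

lemma wnorm2_gram: "wnorm2 (b ** transpose b) x = (norm (transpose b *v x))\<^sup>2"
  for b :: "real^'m^'s"
  unfolding wnorm2_def matrix_vector_mul_assoc[symmetric]
  by (simp add: power2_norm_eq_inner inner_matrix_adjoint del: transpose_matrix_vector)

text \<open>If \<open>x\<close> is an eigenvector of b b^T for its least eigenvalue
  \<open>l\<close>, then b^T x is one of b^T b for the same \<open>l\<close>, and full row rank
  keeps it nonzero. So sqrt l is a nonzero singular value, although \<open>singular_values\<close>
  also contains 0 when b has more columns than rows.\<close>

lemma full_rank_lower_bound:
  fixes b :: "real^'m^'s"
  assumes rank: "rank b = CARD('s)" and \<sigma>: "0 < \<sigma>"
    and sv: "\<forall>s\<in>singular_values b. s \<noteq> 0 \<longrightarrow> \<sigma> \<le> s"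
  shows "\<sigma>\<^sup>2 * (norm z)\<^sup>2 \<le> (norm (transpose b *v z))\<^sup>2"
proof -
  let ?G = "b ** transpose b"
  have "transpose ?G = ?G" by (simp add: matrix_transpose_mul)
  then obtain x l where x: "norm x = 1" "?G *v x = l *\<^sub>R x"
    and min: "\<And>y. l * (norm y)\<^sup>2 \<le> wnorm2 ?G y"
    using symmetric_min_eigenvector by metis
  define a where "a = transpose b *v x"
  have "rank (transpose b) = CARD('s)" using rank by (simp add: rank_transpose)
  then have "inj ((*v) (transpose b))" by (simp only: full_rank_injective)
  then have a0: "a \<noteq> 0"
    using x(1) unfolding a_def
    by (metis inj_eq matrix_vector_mult_0_right norm_zero zero_neq_one)
  have l: "l = (norm a)\<^sup>2"
  proof -
    have "wnorm2 ?G x = l" unfolding wnorm2_def x(2) using x(1) by (simp add: norm_eq_1)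
    then show ?thesis by (simp add: wnorm2_gram a_def del: transpose_matrix_vector)
  qed
  have l0: "0 < l" using a0 by (simp add: l)
  have "(transpose b ** b) *v a = transpose b *v (?G *v x)"
    unfolding a_def by (simp add: matrix_vector_mul_assoc matrix_mul_assoc del: transpose_matrix_vector)
  also have "\<dots> = (sqrt l)\<^sup>2 *s a"
    unfolding x(2) a_def using l0 by (simp add: matrix_vector_mult_scaleR scalar_mult_eq_scaleR del: transpose_matrix_vector)
  finally have "sqrt l \<in> singular_values b"
    unfolding singular_values_def using a0 l0 by auto
  with sv l0 have "\<sigma> \<le> sqrt l" by auto
  then have "\<sigma>\<^sup>2 \<le> (sqrt l)\<^sup>2" using \<sigma> by (intro power_mono) auto
  then have \<sigma>l: "\<sigma>\<^sup>2 \<le> l" using l0 by simp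
  show ?thesis
    using mult_right_mono[OF \<sigma>l, of "(norm z)\<^sup>2"] min[of z]
    by (simp add: wnorm2_gram del: transpose_matrix_vector)
qed

text \<open>The least-norm solution u = b^T z with b b^T z = y: |u|^2 = z . y is at most |z| |y|,
  and the lower bound gives \<sigma> |z| \<le> |u|.\<close>

lemma small_preimage:
  fixes b :: "real^'m^'s"
  assumes \<sigma>: "0 < \<sigma>" and lower: "\<And>z. \<sigma>\<^sup>2 * (norm z)\<^sup>2 \<le> (norm (transpose b *v z))\<^sup>2"
  obtains u where "b *v u = y" "\<sigma>\<^sup>2 * (norm u)\<^sup>2 \<le> (norm y)\<^sup>2"
proof -
  let ?G = "b ** transpose b"
  have "inj ((*v) ?G)"
  proof (rule inj_matrix_vector_mult)
    have "z = 0" if "?G *v z = 0" for z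
    proof -
      have "wnorm2 ?G z = 0" using that by (simp add: wnorm2_def)
      then show "z = 0" using lower[of z] \<sigma>
        by (auto simp: wnorm2_gram mult_le_0_iff simp del: transpose_matrix_vector)
    qed
    then have "\<exists>H. H ** ?G = mat 1" by (simp add: matrix_left_invertible_ker)
    then show "invertible ?G" by (simp add: invertible_left_inverse)
  qed
  then have "surj ((*v) ?G)" using full_rank_injective full_rank_surjective by metis
  then obtain z where z: "?G *v z = y" by (metis surjD)
  define u where "u = transpose b *v z"
  have bu: "b *v u = y" using z by (simp add: u_def matrix_vector_mul_assoc del: transpose_matrix_vector)
  have "(norm u)\<^sup>2 = z \<bullet> y"
    unfolding z[symmetric] using wnorm2_gram[of b z] unfolding wnorm2_def u_def by simp
  then have "(norm u)\<^sup>2 \<le> norm z * norm y" by (metis norm_cauchy_schwarz)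
  then have "((norm u)\<^sup>2)\<^sup>2 \<le> (norm z * norm y)\<^sup>2" by (intro power_mono) auto
  also have "\<dots> = (norm z)\<^sup>2 * (norm y)\<^sup>2" by (simp add: power_mult_distrib)
  finally have 1: "((norm u)\<^sup>2)\<^sup>2 \<le> (norm z)\<^sup>2 * (norm y)\<^sup>2" .
  have "\<sigma>\<^sup>2 * ((norm u)\<^sup>2)\<^sup>2 \<le> (\<sigma>\<^sup>2 * (norm z)\<^sup>2) * (norm y)\<^sup>2"
    using mult_left_mono[OF 1, of "\<sigma>\<^sup>2"] by (simp add: algebra_simps)
  also have "\<dots> \<le> (norm u)\<^sup>2 * (norm y)\<^sup>2"
    unfolding u_def by (intro mult_right_mono lower) auto
  finally have "(norm u)\<^sup>2 * (\<sigma>\<^sup>2 * (norm u)\<^sup>2) \<le> (norm u)\<^sup>2 * (norm y)\<^sup>2"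
    by (simp add: power2_eq_square algebra_simps)
  then have "\<sigma>\<^sup>2 * (norm u)\<^sup>2 \<le> (norm y)\<^sup>2"
    by (cases "u = 0") auto
  with bu that show thesis by blast
qed

section \<open>Borel measurability of matrix operations and of solutions of linear systems\<close>

lemma measurable_vecI:
  fixes f :: "'a \<Rightarrow> real^'n"
  assumes "\<And>i. (\<lambda>x. f x $ i) \<in> borel_measurable M"
  shows "f \<in> borel_measurable M"
  unfolding borel_measurable_euclidean_space[of f]
  using assms by (auto simp: Basis_vec_def inner_axis)

lemma measurable_matI:
  fixes f :: "'a \<Rightarrow> real^'n^'m"
  assumes "\<And>i j. (\<lambda>x. f x $ i $ j) \<in> borel_measurable M"
  shows "f \<in> borel_measurable M"
  unfolding borel_measurable_euclidean_space[of f]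
  using assms by (auto simp: Basis_vec_def inner_axis)

lemma measurable_vec_nth [measurable]:
  fixes f :: "'a \<Rightarrow> 'b::topological_space^'n"
  assumes "f \<in> borel_measurable M"
  shows "(\<lambda>x. f x $ i) \<in> borel_measurable M"
  by (rule measurable_compose[OF assms borel_measurable_continuous_onI])
     (intro continuous_on_component continuous_on_id)

lemma measurable_matrix_vector_mult [measurable]:
  fixes f :: "'a \<Rightarrow> real^'n^'m"
  assumes [measurable]: "f \<in> borel_measurable M" "g \<in> borel_measurable M"
  shows "(\<lambda>x. f x *v g x) \<in> borel_measurable M"
  by (rule measurable_vecI) (simp add: matrix_vector_mult_def)

lemma measurable_matrix_mult [measurable]:
  fixes f :: "'a \<Rightarrow> real^'n^'m"
  assumes [measurable]: "f \<in> borel_measurable M" "g \<in> borel_measurable M"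
  shows "(\<lambda>x. f x ** g x) \<in> borel_measurable M"
  by (rule measurable_matI) (simp add: matrix_matrix_mult_def)

lemma measurable_transpose [measurable]:
  fixes f :: "'a \<Rightarrow> real^'n^'m"
  assumes [measurable]: "f \<in> borel_measurable M"
  shows "(\<lambda>x. transpose (f x)) \<in> borel_measurable M"
  by (rule measurable_matI) (simp add: transpose_def)

lemma measurable_wnorm2 [measurable]:
  assumes [measurable]: "f \<in> borel_measurable M"
  shows "(\<lambda>x. wnorm2 Z (f x)) \<in> borel_measurable M"
  unfolding wnorm2_def by measurable

lemma measurable_det [measurable]:
  fixes f :: "'a \<Rightarrow> real^'n^'n"
  assumes [measurable]: "f \<in> borel_measurable M"
  shows "(\<lambda>x. det (f x)) \<in> borel_measurable M"
  unfolding det_def by measurable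

text \<open>Cramer's rule writes each component as a quotient of two measurable determinants. This
  reaches solution maps that are given only through an abstract inverse, such as the saddle
  gains.\<close>

lemma measurable_solve_linear:
  fixes T :: "'a \<Rightarrow> real^'n^'n" and y f :: "'a \<Rightarrow> real^'n"
  assumes [measurable]: "T \<in> borel_measurable M" "y \<in> borel_measurable M"
    and inv: "\<And>w. invertible (T w)" and sol: "\<And>w. T w *v f w = y w"
  shows "f \<in> borel_measurable M"
proof (rule measurable_vecI)
  fix k
  have [measurable]: "(\<lambda>w. \<chi> i j. if j = k then y w $ i else T w $ i $ j) \<in> borel_measurable M"
    by (rule measurable_matI) simp
  have "f w $ k = det (\<chi> i j. if j = k then y w $ i else T w $ i $ j) / det (T w)" for w
    using cramer[of "T w" "f w" "y w"] inv[of w] sol[of w] by (simp add: invertible_det_nz)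
  then show "(\<lambda>w. f w $ k) \<in> borel_measurable M" by simp
qed

section \<open>The stage game\<close>

lemma inner_transpose_mult:
  fixes b :: "real^'n^'m"
  shows "h \<bullet> (transpose b *v q) = (b *v h) \<bullet> q"
  by (metis inner_matrix_adjoint transpose_transpose)

lemma wnorm2_diff_matrix: "wnorm2 (M - N) x = wnorm2 M x - wnorm2 N x"
  by (simp add: wnorm2_def matrix_vector_mult_diff_rdistrib inner_diff_right)

lemma wnorm2_add_matrix: "wnorm2 (M + N) x = wnorm2 M x + wnorm2 N x"
  by (simp add: wnorm2_def matrix_vector_mult_add_rdistrib inner_add_right)

lemma norm_add_square_le: "(norm (x + y))\<^sup>2 \<le> 2 * (norm x)\<^sup>2 + 2 * (norm (y::'a::real_inner))\<^sup>2"
proof -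
  have "0 \<le> (norm (x - y))\<^sup>2" by simp
  then show ?thesis
    by (simp add: power2_norm_eq_inner inner_add_left inner_add_right inner_diff_left inner_diff_right inner_commute)
qed

section \<open>Moments of a random input matrix\<close>

lemma norm_matrix_le_sum: "norm (M::real^'n^'m) \<le> (\<Sum>i\<in>UNIV. \<Sum>j\<in>UNIV. \<bar>M $ i $ j\<bar>)"
  unfolding norm_vec_def[of M]
  by (rule order_trans[OF L2_set_le_sum]) (auto intro!: sum_mono norm_le_l1_cart)

lemma integrable_matI:
  fixes f :: "'a \<Rightarrow> real^'n^'m"
  assumes "\<And>i j. integrable M (\<lambda>x. f x $ i $ j)"
  shows "integrable M f"
proof (rule Bochner_Integration.integrable_bound)
  show "integrable M (\<lambda>x. \<Sum>i\<in>UNIV. \<Sum>j\<in>UNIV. \<bar>f x $ i $ j\<bar>)"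
    using assms by (intro Bochner_Integration.integrable_sum integrable_abs)
  show "f \<in> borel_measurable M"
    by (rule measurable_matI) (use assms in auto)
  show "AE x in M. norm (f x) \<le> norm (\<Sum>i\<in>UNIV. \<Sum>j\<in>UNIV. \<bar>f x $ i $ j\<bar>)"
    unfolding real_norm_def by (intro AE_I2 order_trans[OF norm_matrix_le_sum abs_ge_self])
qed

lemma abs_matrix_component_le: "\<bar>(M::real^'n^'m) $ i $ j\<bar> \<le> norm M"
  using component_le_norm_cart[of "M $ i" j] Finite_Cartesian_Product.norm_nth_le[of M i] by simp

lemma abs_matrix_component_le_image: "\<bar>(M::real^'n^'m) $ i $ j\<bar> \<le> norm (M *v axis j 1)"
  using component_le_norm_cart[of "M *v axis j 1" i]
  by (simp add: matrix_vector_mul_component inner_axis)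

text \<open>\<open>F\<close> is the attack input matrix as a function of the attack channel. Its
  current realisation is hidden from both players, so the stage payoff sees it only through its mean
  and E F^T Z F; the latter is controlled by E |F|^2 in the Frobenius norm, which is the norm of
  this matrix type.\<close>

locale random_input = prob_space N for N :: "'h measure" +
  fixes F :: "'h \<Rightarrow> real^'n^'s"
  assumes meas_F [measurable]: "F \<in> borel_measurable N"
    and sq_F: "integrable N (\<lambda>h. (norm (F h))\<^sup>2)"
begin

definition mean :: "real^'n^'s" where "mean = (\<integral>h. F h \<partial>N)"

definition second :: "real^'s^'s \<Rightarrow> real^'n^'n" where
  "second Z = (\<integral>h. transpose (F h) ** (Z ** F h) \<partial>N)"

definition power :: real where "power = (\<integral>h. (norm (F h))\<^sup>2 \<partial>N)"

lemma power_nonneg: "0 \<le> power"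
  unfolding power_def by simp

lemma integrable_FF: "integrable N (\<lambda>h. F h $ i $ k * F h $ j $ l)"
proof (rule Bochner_Integration.integrable_bound[OF sq_F])
  have "\<bar>F h $ i $ k * F h $ j $ l\<bar> \<le> norm (F h) * norm (F h)" for h
    unfolding abs_mult by (intro mult_mono abs_matrix_component_le) auto
  then show "AE h in N. norm (F h $ i $ k * F h $ j $ l) \<le> norm ((norm (F h))\<^sup>2)"
    by (simp add: power2_eq_square)
qed measurable

lemma integrable_F: "integrable N F"
proof (rule Bochner_Integration.integrable_bound)
  show "integrable N (\<lambda>h. 1 + (norm (F h))\<^sup>2)"
    by (intro Bochner_Integration.integrable_add sq_F) simp
  have "x \<le> 1 + x\<^sup>2" for x :: real
    using sum_squares_bound[of x 1] zero_le_power2[of x] by (smt (verit) mult_cancel_left2 one_power2)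
  then show "AE h in N. norm (F h) \<le> norm (1 + (norm (F h))\<^sup>2)"
    by (intro AE_I2) (smt (verit) real_norm_def)
qed measurable

lemma integrable_second: "integrable N (\<lambda>h. transpose (F h) ** (Z ** F h))"
proof (rule integrable_matI)
  fix k l
  have "(transpose (F h) ** (Z ** F h)) $ k $ l = (\<Sum>i\<in>UNIV. \<Sum>j\<in>UNIV. Z $ i $ j * (F h $ i $ k * F h $ j $ l))" for h
    by (simp add: matrix_matrix_mult_def transpose_def sum_distrib_left algebra_simps)
  then show "integrable N (\<lambda>h. (transpose (F h) ** (Z ** F h)) $ k $ l)"
    by (simp add: integrable_FF)
qed

lemma integral_inner_F:
  "integrable N (\<lambda>h. y \<bullet> (F h *v a))" "(\<integral>h. y \<bullet> (F h *v a) \<partial>N) = y \<bullet> (mean *v a)"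
proof -
  have "linear (\<lambda>m::real^'n^'s. y \<bullet> (m *v a))"
    by (auto simp: linear_iff matrix_vector_mult_add_rdistrib inner_add_right scaleR_matrix_vector_assoc[symmetric])
  then have bl: "bounded_linear (\<lambda>m::real^'n^'s. y \<bullet> (m *v a))"
    by (simp add: linear_conv_bounded_linear)
  show "integrable N (\<lambda>h. y \<bullet> (F h *v a))"
    by (rule integrable_bounded_linear[OF bl integrable_F])
  show "(\<integral>h. y \<bullet> (F h *v a) \<partial>N) = y \<bullet> (mean *v a)"
    unfolding mean_def by (rule integral_bounded_linear[OF bl integrable_F])
qed

lemma integral_wnorm2_F:
  "integrable N (\<lambda>h. wnorm2 Z (F h *v a))" "(\<integral>h. wnorm2 Z (F h *v a) \<partial>N) = wnorm2 (second Z) a"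
proof -
  have "linear (\<lambda>m::real^'n^'n. a \<bullet> (m *v a))"
    by (auto simp: linear_iff matrix_vector_mult_add_rdistrib inner_add_right scaleR_matrix_vector_assoc[symmetric])
  then have bl: "bounded_linear (\<lambda>m::real^'n^'n. a \<bullet> (m *v a))"
    by (simp add: linear_conv_bounded_linear)
  have eq: "wnorm2 Z (F h *v a) = a \<bullet> ((transpose (F h) ** (Z ** F h)) *v a)" for h
    unfolding wnorm2_def matrix_vector_mul_assoc[symmetric] inner_transpose_mult ..
  show "integrable N (\<lambda>h. wnorm2 Z (F h *v a))"
    unfolding eq by (rule integrable_bounded_linear[OF bl integrable_second])
  show "(\<integral>h. wnorm2 Z (F h *v a) \<partial>N) = wnorm2 (second Z) a"
    unfolding eq second_def by (subst integral_bounded_linear[OF bl integrable_second]) (simp add: wnorm2_def)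
qed

lemma transpose_second:
  assumes "transpose Z = Z"
  shows "transpose (second Z) = second Z"
proof -
  have "linear (transpose :: real^'n^'n \<Rightarrow> _)"
    by (auto simp: linear_iff transpose_def vec_eq_iff)
  then have bl: "bounded_linear (transpose :: real^'n^'n \<Rightarrow> _)"
    by (simp add: linear_conv_bounded_linear)
  show ?thesis
    unfolding second_def integral_bounded_linear[OF bl integrable_second, symmetric]
    by (simp add: matrix_transpose_mul assms matrix_mul_assoc)
qed

lemma integral_expand:
  assumes sym: "transpose Z = Z"
  shows "integrable N (\<lambda>h. wnorm2 Z (y + F h *v a))"
    and "(\<integral>h. wnorm2 Z (y + F h *v a) \<partial>N) = wnorm2 Z y + 2 * (y \<bullet> (Z *v (mean *v a))) + wnorm2 (second Z) a"
proof -
  have eq: "wnorm2 Z (y + F h *v a) = wnorm2 Z y + 2 * ((Z *v y) \<bullet> (F h *v a)) + wnorm2 Z (F h *v a)" for h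
    using inner_matrix_adjoint[of y Z "F h *v a"] unfolding wnorm2_add[OF sym] sym by simp
  have i: "integrable N (\<lambda>h. 2 * ((Z *v y) \<bullet> (F h *v a)))"
    using integral_inner_F(1) by simp
  show "integrable N (\<lambda>h. wnorm2 Z (y + F h *v a))"
    unfolding eq using integral_wnorm2_F(1) i by simp
  have "y \<bullet> (Z *v (mean *v a)) = (Z *v y) \<bullet> (mean *v a)"
    by (simp only: inner_matrix_adjoint sym)
  then show "(\<integral>h. wnorm2 Z (y + F h *v a) \<partial>N) = wnorm2 Z y + 2 * (y \<bullet> (Z *v (mean *v a))) + wnorm2 (second Z) a"
    unfolding eq using integral_wnorm2_F i integral_inner_F by (simp add: prob_space)
qed

lemma wnorm2_second_le:
  assumes "\<And>x. wnorm2 Z x \<le> z * (norm x)\<^sup>2" "0 \<le> z"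
  shows "wnorm2 (second Z) a \<le> z * power * (norm a)\<^sup>2"
proof -
  have "wnorm2 (second Z) a \<le> (\<integral>h. z * (norm a)\<^sup>2 * (norm (F h))\<^sup>2 \<partial>N)"
    unfolding integral_wnorm2_F(2)[symmetric]
  proof (rule integral_mono)
    show "wnorm2 Z (F h *v a) \<le> z * (norm a)\<^sup>2 * (norm (F h))\<^sup>2" for h
    proof -
      have "(norm (F h *v a))\<^sup>2 \<le> (norm (F h) * norm a)\<^sup>2"
        by (intro power_mono norm_matrix_vector_mult_le) auto
      then have "z * (norm (F h *v a))\<^sup>2 \<le> z * (norm (F h) * norm a)\<^sup>2"
        using assms(2) by (rule mult_left_mono)
      with assms(1)[of "F h *v a"] show ?thesis by (simp add: power_mult_distrib algebra_simps)
    qed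
  qed (use integral_wnorm2_F(1) sq_F in auto)
  then show ?thesis by (simp add: power_def algebra_simps)
qed

end

text \<open>Control and attack are packed into one vector over the disjoint sum of their index
  types, so that the two first-order conditions become a single square system, open to injectivity
  and determinant arguments.\<close>

definition join :: "real^'m \<Rightarrow> real^'n \<Rightarrow> real^('m + 'n)" where
  "join u a = (\<chi> k. case k of Inl i \<Rightarrow> u $ i | Inr j \<Rightarrow> a $ j)"

definition left :: "real^('m::finite + 'n::finite) \<Rightarrow> real^'m" where "left w = (\<chi> i. w $ Inl i)"
definition right :: "real^('m::finite + 'n::finite) \<Rightarrow> real^'n" where "right w = (\<chi> j. w $ Inr j)"

lemma join_simps [simp]: "left (join u a) = u" "right (join u a) = a"
  by (simp_all add: left_def right_def join_def vec_eq_iff)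

lemma left_right_linear [simp]:
  "left (v + w) = left v + left w" "right (v + w) = right v + right w"
  "left (c *\<^sub>R w) = c *\<^sub>R left w" "right (c *\<^sub>R w) = c *\<^sub>R right w"
  by (simp_all add: left_def right_def vec_eq_iff)

lemma join_linear:
  "join u a + join u' a' = join (u + u') (a + a')" "c *\<^sub>R join u a = join (c *\<^sub>R u) (c *\<^sub>R a)"
  by (simp_all add: join_def vec_eq_iff split: sum.splits)

lemma join_inner: "w \<bullet> join u a = left w \<bullet> u + right w \<bullet> a"
proof -
  have "w \<bullet> join u a = (\<Sum>k\<in>UNIV <+> UNIV. w $ k * join u a $ k)"
    by (simp add: inner_vec_def)
  also have "\<dots> = left w \<bullet> u + right w \<bullet> a"
    by (subst sum.Plus) (auto simp: inner_vec_def left_def right_def join_def)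
  finally show ?thesis .
qed

lemma left_right_zero: "left w = 0 \<Longrightarrow> right w = 0 \<Longrightarrow> w = 0"
  unfolding left_def right_def vec_eq_iff by (metis sum.exhaust vec_lambda_beta zero_index)

lemma measurable_join [measurable]:
  fixes f :: "'a \<Rightarrow> real^'m" and g :: "'a \<Rightarrow> real^'n"
  assumes "f \<in> borel_measurable M" "g \<in> borel_measurable M"
  shows "(\<lambda>x. join (f x) (g x)) \<in> borel_measurable M"
proof (rule measurable_vecI)
  fix k show "(\<lambda>x. join (f x) (g x) $ k) \<in> borel_measurable M"
    using assms by (cases k) (auto simp: join_def)
qed

locale stage_game = random_input N F for N :: "'h measure" and F :: "'h \<Rightarrow> real^'n^'s" +
  fixes A :: "real^'s^'s" and R :: "real^'m^'m" and Ra :: "real^'n^'n"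
  assumes R: "pos_def R" and Ra: "pos_def Ra"
begin

definition payoff where
  "payoff Z b x u a = (\<integral>h. wnorm2 Z (A *v x + b *v u + F h *v a) \<partial>N) + wnorm2 R u - wnorm2 Ra a"

text \<open>Minus half the Hessian of the payoff in the attack; its positivity is strict
  concavity.\<close>

definition margin where "margin Z = Ra - second Z"

definition admissible where "admissible Z \<longleftrightarrow> pos_def Z \<and> pos_def (margin Z)"

lemma R_sym: "transpose R = R" and Ra_sym: "transpose Ra = Ra"
  using R Ra by (auto simp: pos_def_def)

lemma admissible_sym: "admissible Z \<Longrightarrow> transpose Z = Z"
  and margin_sym: "admissible Z \<Longrightarrow> transpose (margin Z) = margin Z"
  by (auto simp: admissible_def pos_def_def)

lemma payoff_eq:
  assumes "transpose Z = Z"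
  shows "payoff Z b x u a = wnorm2 Z (A *v x + b *v u) + 2 * ((A *v x + b *v u) \<bullet> (Z *v (mean *v a)))
    - wnorm2 (margin Z) a + wnorm2 R u"
  unfolding payoff_def margin_def integral_expand(2)[OF assms] wnorm2_diff_matrix by simp

lemma payoff_mono:
  assumes "transpose Z = Z" "transpose Z' = Z'" "\<And>x. wnorm2 Z x \<le> wnorm2 Z' x"
  shows "payoff Z b x u a \<le> payoff Z' b x u a"
  unfolding payoff_def using integral_mono[OF integral_expand(1) integral_expand(1)] assms by simp

text \<open>The first-order conditions of the stage game form a linear system. Its off-diagonal blocks are skew, so the
  associated quadratic form is positive.\<close>

definition foc where
  "foc Z b w = join (transpose b *v (Z *v (b *v left w + mean *v right w)) + R *v left w)
     (margin Z *v right w - transpose mean *v (Z *v (b *v left w)))"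

definition foc_rhs where
  "foc_rhs Z b x = join (- (transpose b *v (Z *v (A *v x)))) (transpose mean *v (Z *v (A *v x)))"

lemma linear_foc: "linear (foc Z b)"
  unfolding foc_def linear_iff
  by (simp add: join_linear matrix_vector_right_distrib matrix_vector_mult_scaleR algebra_simps del: transpose_matrix_vector)

lemma linear_foc_rhs: "linear (foc_rhs Z b)"
  unfolding foc_rhs_def linear_iff
  by (simp add: join_linear matrix_vector_right_distrib matrix_vector_mult_scaleR algebra_simps del: transpose_matrix_vector)

lemma inj_foc:
  assumes Z: "admissible Z"
  shows "inj (foc Z b)"
proof -
  have "w = 0" if "foc Z b w = 0" for w
  proof -
    have "w \<bullet> foc Z b w = wnorm2 Z (b *v left w) + wnorm2 R (left w) + wnorm2 (margin Z) (right w)"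
      unfolding foc_def join_inner inner_add_right inner_diff_right inner_transpose_mult wnorm2_def
      using inner_symmetric_matrix[OF admissible_sym[OF Z], of "b *v left w" "mean *v right w"]
      by (simp add: matrix_vector_right_distrib inner_add_right)
    then have s: "wnorm2 Z (b *v left w) + wnorm2 R (left w) + wnorm2 (margin Z) (right w) = 0"
      using that by simp
    have "0 \<le> wnorm2 Z (b *v left w)" "0 \<le> wnorm2 R (left w)" "0 \<le> wnorm2 (margin Z) (right w)"
      using Z R by (auto simp: admissible_def intro: wnorm2_nonneg)
    then have "wnorm2 R (left w) = 0" "wnorm2 (margin Z) (right w) = 0" using s by linarith+
    then show "w = 0"
      using R Z unfolding admissible_def pos_def_def wnorm2_def
      by (metis left_right_zero less_irrefl)
  qed
  then show ?thesis using linear_injective_0[OF linear_foc] by blast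
qed

definition gain where "gain Z b x = inv (foc Z b) (foc_rhs Z b x)"
definition Kc where "Kc Z b = matrix (\<lambda>x. left (gain Z b x))"
definition Ka where "Ka Z b = matrix (\<lambda>x. right (gain Z b x))"
text \<open>A matrix whose quadratic form is the stage value. It is affine in the gains, so it
  inherits their measurability and bounds. Symmetry is not established for it, which is why
  \<open>P\<close> symmetrises its mean; the form is unaffected.\<close>

definition G where "G Z b = transpose A ** (Z ** (A + b ** Kc Z b + mean ** Ka Z b))"

lemma foc_gain:
  assumes "admissible Z"
  shows "foc Z b (gain Z b x) = foc_rhs Z b x"
proof -
  have "surj (foc Z b)"
    using inj_foc[OF assms] linear_foc linear_injective_imp_surjective by blast
  then show ?thesis unfolding gain_def by (simp add: surj_f_inv_f)
qed

lemma linear_gain: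
  assumes "admissible Z"
  shows "linear (gain Z b)"
proof -
  note 1 = foc_gain[OF assms, of b] and inj = inj_foc[OF assms, of b]
  show ?thesis
  proof (rule linearI)
    fix x y
    have "foc Z b (gain Z b (x + y)) = foc Z b (gain Z b x + gain Z b y)"
      by (simp add: 1 linear_add[OF linear_foc] linear_add[OF linear_foc_rhs])
    then show "gain Z b (x + y) = gain Z b x + gain Z b y" using inj by (simp add: inj_eq)
  next
    fix c x
    have "foc Z b (gain Z b (c *\<^sub>R x)) = foc Z b (c *\<^sub>R gain Z b x)"
      by (simp add: 1 linear_scale[OF linear_foc] linear_scale[OF linear_foc_rhs])
    then show "gain Z b (c *\<^sub>R x) = c *\<^sub>R gain Z b x" using inj by (simp add: inj_eq)
  qed
qed

lemma gain_mult:
  assumes "admissible Z"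
  shows "Kc Z b *v x = left (gain Z b x)" "Ka Z b *v x = right (gain Z b x)"
proof -
  note l = linear_gain[OF assms, of b]
  have "linear (\<lambda>x. left (gain Z b x))" "linear (\<lambda>x. right (gain Z b x))"
    by (auto simp: linear_iff linear_add[OF l] linear_scale[OF l])
  then show "Kc Z b *v x = left (gain Z b x)" "Ka Z b *v x = right (gain Z b x)"
    unfolding Kc_def Ka_def by (simp_all add: matrix_works)
qed

lemma gain_foc:
  assumes "admissible Z"
  shows "transpose b *v (Z *v (A *v x + b *v (Kc Z b *v x) + mean *v (Ka Z b *v x))) + R *v (Kc Z b *v x) = 0"
    and "transpose mean *v (Z *v (A *v x + b *v (Kc Z b *v x))) = margin Z *v (Ka Z b *v x)"
  using arg_cong[OF foc_gain[OF assms, of b x], of left] arg_cong[OF foc_gain[OF assms, of b x], of right]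
  unfolding foc_def foc_rhs_def gain_mult[OF assms] join_simps
  by (simp_all add: matrix_vector_right_distrib algebra_simps eq_neg_iff_add_eq_0 del: transpose_matrix_vector)

text \<open>Tested against \<open>u\<close>, the first condition trades the pairing with
  \<open>b *v u\<close> for the control cost; tested against \<open>a\<close>, the second one
  equates the cross term of the attack with its margin cost. What remains is \<open>A *v x\<close>
  paired with the weighted mean next state.\<close>

lemma payoff_at_saddle:
  assumes Z: "admissible Z"
  shows "payoff Z b x (Kc Z b *v x) (Ka Z b *v x) = wnorm2 (G Z b) x"
proof -
  define u a where "u = Kc Z b *v x" and "a = Ka Z b *v x"
  define y d where "y = A *v x + b *v u" and "d = mean *v a"
  note sym = inner_symmetric_matrix[OF admissible_sym[OF Z]]
  have 1: "(b *v u) \<bullet> (Z *v (y + d)) + wnorm2 R u = 0"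
    using arg_cong[OF gain_foc(1)[OF Z, of b x], of "\<lambda>v. u \<bullet> v"]
    unfolding u_def[symmetric] a_def[symmetric] y_def[symmetric] d_def[symmetric] inner_add_right inner_transpose_mult
    by (simp add: wnorm2_def)
  have 2: "d \<bullet> (Z *v y) = wnorm2 (margin Z) a"
    using arg_cong[OF gain_foc(2)[OF Z, of x b], of "\<lambda>v. a \<bullet> v"]
    unfolding u_def[symmetric] a_def[symmetric] y_def[symmetric] inner_transpose_mult d_def[symmetric]
    by (simp add: wnorm2_def)
  have Ax: "A *v x = y - b *v u" by (simp add: y_def)
  have "G Z b *v x = transpose A *v (Z *v (y + d))"
    unfolding G_def y_def d_def u_def a_def
    by (simp only: matrix_vector_mul_assoc[symmetric] matrix_vector_mult_add_rdistrib)
  then have "wnorm2 (G Z b) x = (A *v x) \<bullet> (Z *v (y + d))"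
    unfolding wnorm2_def by (simp only: inner_transpose_mult)
  also have "\<dots> = y \<bullet> (Z *v (y + d)) + wnorm2 R u"
    unfolding Ax inner_diff_left using 1 by simp
  also have "\<dots> = wnorm2 Z y + y \<bullet> (Z *v d) + wnorm2 R u"
    by (simp add: wnorm2_def matrix_vector_right_distrib inner_add_right)
  also have "\<dots> = payoff Z b x u a"
    unfolding payoff_eq[OF admissible_sym[OF Z]] y_def[symmetric] d_def[symmetric]
    using 2 sym[of d y] by simp
  finally show ?thesis by (simp add: u_def a_def)
qed

text \<open>The payoff is quadratic in the control: around the saddle its linear part is the
  first-order condition, and its second-order part is the sum of the forms of \<open>Z\<close> at
  \<open>b *v h\<close> and of \<open>R\<close> at \<open>h\<close>.\<close>

lemma saddle_control:
  assumes Z: "admissible Z"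
  shows "wnorm2 (G Z b) x \<le> payoff Z b x u' (Ka Z b *v x)"
proof -
  define u a h where "u = Kc Z b *v x" and "a = Ka Z b *v x" and "h = u' - u"
  define y d where "y = A *v x + b *v u" and "d = mean *v a"
  have symZ: "transpose Z = Z" by (rule admissible_sym[OF Z])
  have 1: "(b *v h) \<bullet> (Z *v (y + d)) + h \<bullet> (R *v u) = 0"
    using arg_cong[OF gain_foc(1)[OF Z, of b x], of "\<lambda>v. h \<bullet> v"]
    unfolding u_def[symmetric] a_def[symmetric] y_def[symmetric] d_def[symmetric] inner_add_right inner_transpose_mult
    by simp
  have u': "u' = u + h" by (simp add: h_def)
  have y': "A *v x + b *v u' = y + b *v h"
    by (simp add: u' y_def matrix_vector_right_distrib)
  have "payoff Z b x u' a - payoff Z b x u a = wnorm2 Z (b *v h) + wnorm2 R h"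
    unfolding payoff_eq[OF symZ] y' y_def[symmetric] d_def[symmetric] unfolding u' wnorm2_add[OF symZ] wnorm2_add[OF R_sym]
    using 1 inner_symmetric_matrix[OF symZ, of y "b *v h"] inner_symmetric_matrix[OF R_sym, of u h]
    by (simp add: matrix_vector_right_distrib inner_add_right inner_add_left)
  moreover have "0 \<le> wnorm2 Z (b *v h)" "0 \<le> wnorm2 R h"
    using Z R by (auto simp: admissible_def intro: wnorm2_nonneg)
  ultimately show ?thesis
    unfolding payoff_at_saddle[OF Z, symmetric] u_def[symmetric] a_def[symmetric] by linarith
qed

text \<open>The same expansion in the attack, kept as an identity because its quadratic loss also
  makes the payoff coercive in the attack.\<close>

lemma payoff_attack:
  assumes Z: "admissible Z"
  shows "payoff Z b x (Kc Z b *v x) a' = wnorm2 (G Z b) x - wnorm2 (margin Z) (a' - Ka Z b *v x)"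
proof -
  define u a h where "u = Kc Z b *v x" and "a = Ka Z b *v x" and "h = a' - a"
  define y where "y = A *v x + b *v u"
  have symZ: "transpose Z = Z" by (rule admissible_sym[OF Z])
  have 2: "(mean *v h) \<bullet> (Z *v y) = h \<bullet> (margin Z *v a)"
    using arg_cong[OF gain_foc(2)[OF Z, of x b], of "\<lambda>v. h \<bullet> v"]
    unfolding u_def[symmetric] a_def[symmetric] y_def[symmetric] inner_transpose_mult .
  have a': "a' = a + h" by (simp add: h_def)
  have "payoff Z b x u a' - payoff Z b x u a = - wnorm2 (margin Z) h"
    unfolding payoff_eq[OF symZ] y_def[symmetric] a' wnorm2_add[OF margin_sym[OF Z]]
    using 2 inner_symmetric_matrix[OF symZ, of y "mean *v h"] inner_symmetric_matrix[OF margin_sym[OF Z], of a h]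
    by (simp add: matrix_vector_right_distrib inner_add_right)
  then show ?thesis
    unfolding payoff_at_saddle[OF Z, symmetric] u_def[symmetric] a_def[symmetric] h_def by linarith
qed

lemma saddle_attack:
  assumes Z: "admissible Z"
  shows "payoff Z b x (Kc Z b *v x) a' \<le> wnorm2 (G Z b) x"
  using payoff_attack[OF Z] Z by (simp add: admissible_def wnorm2_nonneg)

text \<open>The attacker may stay silent, and without an attack every term of the payoff is
  nonnegative.\<close>

lemma value_nonneg:
  assumes Z: "admissible Z"
  shows "0 \<le> wnorm2 (G Z b) x"
proof -
  have "0 \<le> payoff Z b x (Kc Z b *v x) 0"
    unfolding payoff_eq[OF admissible_sym[OF Z]] using Z R
    by (simp add: wnorm2_nonneg admissible_def)
  also have "\<dots> \<le> wnorm2 (G Z b) x" by (rule saddle_attack[OF Z])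
  finally show ?thesis .
qed

text \<open>Cross play: the control that is optimal for \<open>Z'\<close> meets the attack that is
  optimal for \<open>Z\<close>, so both saddle inequalities apply to the same pair.\<close>

lemma value_mono:
  assumes Z: "admissible Z" and Z': "admissible Z'" and le: "\<And>x. wnorm2 Z x \<le> wnorm2 Z' x"
  shows "wnorm2 (G Z b) x \<le> wnorm2 (G Z' b) x"
proof -
  have "wnorm2 (G Z b) x \<le> payoff Z b x (Kc Z' b *v x) (Ka Z b *v x)" by (rule saddle_control[OF Z])
  also have "\<dots> \<le> payoff Z' b x (Kc Z' b *v x) (Ka Z b *v x)"
    by (rule payoff_mono) (use Z Z' le admissible_sym in auto)
  also have "\<dots> \<le> wnorm2 (G Z' b) x" by (rule saddle_attack[OF Z'])
  finally show ?thesis .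
qed

text \<open>The constant must not depend on \<open>b\<close>, whose size is unrestricted. Zero
  control makes the payoff free of \<open>b\<close>, which bounds the value and the attack gain.
  Zero attack against the saddle control then bounds the control and the attack-free next state, and
  hence \<open>b\<close> times the control by difference.\<close>

lemma gains_bounded:
  assumes Z: "admissible Z"
  obtains c where "0 \<le> c" "\<And>b x. (norm (Ka Z b *v x))\<^sup>2 \<le> c * (norm x)\<^sup>2"
    "\<And>b x. (norm (Kc Z b *v x))\<^sup>2 \<le> c * (norm x)\<^sup>2"
    "\<And>b x. (norm (b *v (Kc Z b *v x)))\<^sup>2 \<le> c * (norm x)\<^sup>2"
proof -
  note symZ = admissible_sym[OF Z]
  obtain g where g: "0 < g" "\<And>a. g * (norm a)\<^sup>2 \<le> wnorm2 (margin Z) a"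
    using pos_def_lower_bound Z unfolding admissible_def by blast
  obtain q where q: "0 < q" "\<And>a. q * (norm a)\<^sup>2 \<le> wnorm2 Z a"
    using pos_def_lower_bound Z unfolding admissible_def by blast
  obtain r where r: "0 < r" "\<And>a. r * (norm a)\<^sup>2 \<le> wnorm2 R a"
    using pos_def_lower_bound R by blast
  define k where "k = norm Z * (norm A)\<^sup>2"
  define m where "m = norm A * norm Z * norm mean"
  have k: "wnorm2 Z (A *v x) \<le> k * (norm x)\<^sup>2" for x
  proof -
    have "(norm (A *v x))\<^sup>2 \<le> (norm A * norm x)\<^sup>2"
      by (intro power_mono norm_matrix_vector_mult_le) auto
    then have "norm Z * (norm (A *v x))\<^sup>2 \<le> norm Z * (norm A * norm x)\<^sup>2"
      by (intro mult_left_mono) auto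
    then show ?thesis using wnorm2_le_norm[of Z "A *v x"] by (simp add: k_def power_mult_distrib)
  qed
  have m: "(A *v x) \<bullet> (Z *v (mean *v a)) \<le> m * norm x * norm a" for x a
  proof -
    have "(A *v x) \<bullet> (Z *v (mean *v a)) \<le> norm (A *v x) * norm (Z *v (mean *v a))"
      by (rule norm_cauchy_schwarz)
    also have "\<dots> \<le> (norm A * norm x) * (norm Z * (norm mean * norm a))"
      by (intro mult_mono norm_matrix_vector_mult_le order_trans[OF norm_matrix_vector_mult_le] mult_left_mono) auto
    finally show ?thesis by (simp add: m_def algebra_simps)
  qed
  have k0: "0 \<le> k" "0 \<le> m" by (auto simp: k_def m_def)
  have payoff0: "payoff Z b x 0 a \<le> k * (norm x)\<^sup>2 + 2 * (m * norm x * norm a) - g * (norm a)\<^sup>2" for b x a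
    unfolding payoff_eq[OF symZ] using k[of x] m[of x a] g(2)[of a] by simp
  \<comment> \<open>Half of the concavity in \<open>a\<close> absorbs the cross term; the other half
    remains to bound the attack gain.\<close>
  have am: "2 * (m * norm x * norm a) \<le> g/2 * (norm a)\<^sup>2 + 2 * m\<^sup>2 / g * (norm x)\<^sup>2" for x a
  proof -
    have "0 \<le> g/2 * (norm a - 2 * m / g * norm x)\<^sup>2" using g(1) by simp
    also have "\<dots> = g/2 * (norm a)\<^sup>2 + 2 * m\<^sup>2 / g * (norm x)\<^sup>2 - 2 * (m * norm x * norm a)"
      using g(1) by (simp add: power2_diff power_mult_distrib field_simps power2_eq_square)
    finally show ?thesis by simp
  qed
  define c0 where "c0 = k + 2 * m\<^sup>2 / g"
  have c00: "0 \<le> c0" using k0 g(1) by (simp add: c0_def)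
  have payoff0': "payoff Z b x 0 a \<le> c0 * (norm x)\<^sup>2 - g/2 * (norm a)\<^sup>2" for b x a
    using payoff0[of b x a] am[of x a] by (simp add: c0_def algebra_simps)
  have v: "wnorm2 (G Z b) x \<le> c0 * (norm x)\<^sup>2 - g/2 * (norm (Ka Z b *v x))\<^sup>2" for b x
    using saddle_control[OF Z] payoff0' order_trans by blast
  have c1: "g/2 * (norm (Ka Z b *v x))\<^sup>2 \<le> c0 * (norm x)\<^sup>2" for b x
    using v[of b x] value_nonneg[OF Z, of b x] by simp
  have v0: "wnorm2 (G Z b) x \<le> c0 * (norm x)\<^sup>2" for b x
    using v[of b x] g(1) by (smt (verit) half_gt_zero mult_nonneg_nonneg zero_le_power2)
  have w: "q * (norm (A *v x + b *v (Kc Z b *v x)))\<^sup>2 + r * (norm (Kc Z b *v x))\<^sup>2 \<le> c0 * (norm x)\<^sup>2" for b x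
    using order_trans[OF saddle_attack[OF Z, of b x 0] v0] q(2)[of "A *v x + b *v (Kc Z b *v x)"] r(2)[of "Kc Z b *v x"]
    unfolding payoff_eq[OF symZ] by simp
  have c2: "r * (norm (Kc Z b *v x))\<^sup>2 \<le> c0 * (norm x)\<^sup>2" for b x
    using w[of x b] q(1) by (smt (verit) mult_nonneg_nonneg zero_le_power2)
  have c3: "q * (norm (A *v x + b *v (Kc Z b *v x)))\<^sup>2 \<le> c0 * (norm x)\<^sup>2" for b x
    using w[of x b] r(1) by (smt (verit) mult_nonneg_nonneg zero_le_power2)
  define c where "c = 2 * c0 / g + c0 / r + (2 * c0 / q + 2 * (norm A)\<^sup>2)"
  have nn: "0 \<le> 2 * c0 / g" "0 \<le> c0 / r" "0 \<le> 2 * c0 / q + 2 * (norm A)\<^sup>2" "0 \<le> 2 * c0 / q"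
    using c00 g q r by auto
  have up: "d * (norm x)\<^sup>2 \<le> c * (norm x)\<^sup>2"
    if "d = 2 * c0 / g \<or> d = c0 / r \<or> d = 2 * c0 / q + 2 * (norm A)\<^sup>2" for d and x :: "real^'s"
    by (intro mult_right_mono) (use that nn in \<open>auto simp: c_def\<close>)
  show thesis
  proof (rule that[of c])
    show "0 \<le> c" using nn by (simp add: c_def)
    show "(norm (Ka Z b *v x))\<^sup>2 \<le> c * (norm x)\<^sup>2" for b x
    proof -
      have "(norm (Ka Z b *v x))\<^sup>2 \<le> 2 * c0 / g * (norm x)\<^sup>2"
        using c1[of b x] g(1) by (simp add: field_simps)
      also have "\<dots> \<le> c * (norm x)\<^sup>2" by (rule up) simp
      finally show ?thesis .
    qed
    show "(norm (Kc Z b *v x))\<^sup>2 \<le> c * (norm x)\<^sup>2" for b x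
    proof -
      have "(norm (Kc Z b *v x))\<^sup>2 \<le> c0 / r * (norm x)\<^sup>2"
        using c2[of b x] r(1) by (simp add: field_simps)
      also have "\<dots> \<le> c * (norm x)\<^sup>2" by (rule up) simp
      finally show ?thesis .
    qed
    show "(norm (b *v (Kc Z b *v x)))\<^sup>2 \<le> c * (norm x)\<^sup>2" for b x
    proof -
      have 1: "(norm (A *v x + b *v (Kc Z b *v x)))\<^sup>2 \<le> c0 / q * (norm x)\<^sup>2"
        using c3[of x b] q(1) by (simp add: field_simps)
      have 2: "(norm (- (A *v x)))\<^sup>2 \<le> (norm A)\<^sup>2 * (norm x)\<^sup>2"
        unfolding norm_minus_cancel power_mult_distrib[symmetric]
        by (intro power_mono norm_matrix_vector_mult_le) auto
      have "(norm (b *v (Kc Z b *v x)))\<^sup>2 \<le> (2 * c0 / q + 2 * (norm A)\<^sup>2) * (norm x)\<^sup>2"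
      proof -
        have "(2 * c0 / q + 2 * (norm A)\<^sup>2) * (norm x)\<^sup>2 = 2 * (c0 / q * (norm x)\<^sup>2) + 2 * ((norm A)\<^sup>2 * (norm x)\<^sup>2)"
          by (simp add: algebra_simps)
        then show ?thesis
          using norm_add_square_le[of "A *v x + b *v (Kc Z b *v x)" "- (A *v x)"] 1 2 by simp
      qed
      also have "\<dots> \<le> c * (norm x)\<^sup>2" by (rule up) simp
      finally show ?thesis .
    qed
  qed
qed

lemma measurable_gain:
  assumes Z: "admissible Z"
  shows "(\<lambda>b. gain Z b x) \<in> borel_measurable borel"
proof (rule measurable_solve_linear)
  show "(\<lambda>b. matrix (foc Z b)) \<in> borel_measurable borel"
    unfolding matrix_def by (rule measurable_matI) (simp add: foc_def del: transpose_matrix_vector, measurable)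
  show "(\<lambda>b. foc_rhs Z b x) \<in> borel_measurable borel"
    unfolding foc_rhs_def by measurable
  fix b
  show "invertible (matrix (foc Z b))"
    using inj_foc[OF Z, of b] linear_foc[of Z b]
    by (simp add: invertible_left_inverse matrix_left_invertible_injective matrix_works)
  show "matrix (foc Z b) *v gain Z b x = foc_rhs Z b x"
    using foc_gain[OF Z] linear_foc[of Z b] by (simp add: matrix_works)
qed

lemma measurable_Kc:
  assumes Z: "admissible Z"
  shows "Kc Z \<in> borel_measurable borel"
  using measurable_gain[OF Z] unfolding Kc_def[abs_def] matrix_def left_def
  by (intro measurable_matI) simp

lemma measurable_Ka:
  assumes Z: "admissible Z"
  shows "Ka Z \<in> borel_measurable borel"
  using measurable_gain[OF Z] unfolding Ka_def[abs_def] matrix_def right_def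
  by (intro measurable_matI) simp

lemma measurable_G:
  assumes Z: "admissible Z"
  shows "G Z \<in> borel_measurable borel"
  unfolding G_def[abs_def] using measurable_Ka[OF Z] measurable_Kc[OF Z]
  by measurable

text \<open>Uniformity in \<open>b\<close> makes \<open>G Z\<close> integrable under every law of
  the control matrix. The bound is obtained column by column, from the gains applied to the unit
  vectors.\<close>

lemma G_bounded:
  assumes Z: "admissible Z"
  obtains c where "0 \<le> c" "\<And>b. norm (G Z b) \<le> c"
proof -
  obtain c where c: "0 \<le> c" "\<And>b x. (norm (Ka Z b *v x))\<^sup>2 \<le> c * (norm x)\<^sup>2"
    "\<And>b x. (norm (b *v (Kc Z b *v x)))\<^sup>2 \<le> c * (norm x)\<^sup>2"
    using gains_bounded[OF Z] by metis
  define s where "s = sqrt c"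
  have b1: "norm (Ka Z b *v axis j 1) \<le> s" for b j
    using c(2)[of b "axis j 1"] by (simp add: s_def real_le_rsqrt)
  have b2: "norm (b *v (Kc Z b *v axis j 1)) \<le> s" for b j
    using c(3)[of b "axis j 1"] by (simp add: s_def real_le_rsqrt)
  define d where "d = norm (transpose A) * (norm Z * (norm A + s + norm mean * s))"
  have "\<bar>G Z b $ i $ j\<bar> \<le> d" for b i j
  proof -
    have "\<bar>G Z b $ i $ j\<bar> \<le> norm (G Z b *v axis j 1)" by (rule abs_matrix_component_le_image)
    also have "G Z b *v axis j 1 = transpose A *v (Z *v (A *v axis j 1 + b *v (Kc Z b *v axis j 1) + mean *v (Ka Z b *v axis j 1)))"
      unfolding G_def by (simp only: matrix_vector_mul_assoc[symmetric] matrix_vector_mult_add_rdistrib)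
    also have "norm \<dots> \<le> norm (transpose A) * (norm Z * norm (A *v axis j 1 + b *v (Kc Z b *v axis j 1) + mean *v (Ka Z b *v axis j 1)))"
      by (intro order_trans[OF norm_matrix_vector_mult_le] mult_left_mono norm_matrix_vector_mult_le) auto
    also have "\<dots> \<le> d"
      unfolding d_def
    proof (intro mult_left_mono)
      have "norm (A *v axis j 1) \<le> norm A" using norm_matrix_vector_mult_le[of A "axis j 1"] by simp
      moreover have "norm (mean *v (Ka Z b *v axis j 1)) \<le> norm mean * s"
        by (intro order_trans[OF norm_matrix_vector_mult_le] mult_left_mono b1) auto
      ultimately show "norm (A *v axis j 1 + b *v (Kc Z b *v axis j 1) + mean *v (Ka Z b *v axis j 1)) \<le> norm A + s + norm mean * s"
        by (intro norm_triangle_le add_mono b2)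
    qed auto
    finally show ?thesis .
  qed
  then have "norm (G Z b) \<le> (\<Sum>i\<in>(UNIV::'s set). \<Sum>j\<in>(UNIV::'s set). d)" for b
    by (intro order_trans[OF norm_matrix_le_sum] sum_mono) auto
  moreover have "0 \<le> d" using c(1) by (simp add: d_def s_def)
  ultimately show thesis using that[of "\<Sum>i\<in>(UNIV::'s set). \<Sum>j\<in>(UNIV::'s set). d"] by (simp add: sum_nonneg)
qed

text \<open>The concave parabola of \<open>payoff_attack\<close> is recentred from the saddle attack
  to 0, at the price of half its curvature. The decay in the attack is uniform in \<open>b\<close>;
  it is what exposes attacks with infinite second moment.\<close>

lemma payoff_attack_coercive:
  assumes Z: "admissible Z"
  obtains c g where "0 \<le> c" "0 < g"
    "\<And>b x a. payoff Z b x (Kc Z b *v x) a \<le> c * (norm x)\<^sup>2 - g * (norm a)\<^sup>2"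
proof -
  obtain c where c: "0 \<le> c" "\<And>b x. (norm (Ka Z b *v x))\<^sup>2 \<le> c * (norm x)\<^sup>2"
    using gains_bounded[OF Z] by metis
  obtain g where g: "0 < g" "\<And>a. g * (norm a)\<^sup>2 \<le> wnorm2 (margin Z) a"
    using pos_def_lower_bound Z unfolding admissible_def by blast
  obtain d where d: "0 \<le> d" "\<And>b. norm (G Z b) \<le> d" using G_bounded[OF Z] by metis
  have val: "wnorm2 (G Z b) x \<le> d * (norm x)\<^sup>2" for b x
    using wnorm2_le_norm[of "G Z b" x] mult_right_mono[OF d(2)[of b], of "(norm x)\<^sup>2"] by simp
  show thesis
  proof (rule that[of "d + g * c" "g/2"])
    fix b x a
    define a' where "a' = Ka Z b *v x"
    have "(norm a)\<^sup>2 \<le> 2 * (norm (a - a'))\<^sup>2 + 2 * (norm a')\<^sup>2"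
      using norm_add_square_le[of "a - a'" a'] by simp
    then have "g/2 * (norm a)\<^sup>2 \<le> g/2 * (2 * (norm (a - a'))\<^sup>2 + 2 * (norm a')\<^sup>2)"
      using g(1) by (intro mult_left_mono) auto
    then have "g/2 * (norm a)\<^sup>2 \<le> g * (norm (a - a'))\<^sup>2 + g * (norm a')\<^sup>2" by (simp add: algebra_simps)
    moreover have "g * (norm a')\<^sup>2 \<le> g * (c * (norm x)\<^sup>2)"
      unfolding a'_def using g(1) by (intro mult_left_mono c(2)) auto
    ultimately show "payoff Z b x (Kc Z b *v x) a \<le> (d + g * c) * (norm x)\<^sup>2 - g/2 * (norm a)\<^sup>2"
      using val[of b x] g(2)[of "a - a'"] unfolding payoff_attack[OF Z] a'_def by (simp add: algebra_simps)
  qed (use c d g in auto)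
qed


end

section \<open>The Riccati iteration\<close>

lemma symmetric_entry_wnorm2:
  fixes M :: "real^'n^'n"
  assumes "transpose M = M"
  shows "M $ i $ j = (wnorm2 M (axis i 1 + axis j 1) - wnorm2 M (axis i 1) - wnorm2 M (axis j 1)) / 2"
proof -
  have "axis i 1 \<bullet> (M *v axis j 1) = M $ i $ j"
    by (simp add: inner_axis' matrix_vector_mul_component inner_axis)
  then show ?thesis unfolding wnorm2_add[OF assms] by simp
qed

lemma tendsto_wnorm2:
  fixes M :: "'a \<Rightarrow> real^'n^'n"
  assumes "(M \<longlongrightarrow> L) net"
  shows "((\<lambda>n. wnorm2 (M n) x) \<longlongrightarrow> wnorm2 L x) net"
  unfolding wnorm2_def inner_vec_def matrix_vector_mult_def
  by (auto intro!: tendsto_intros tendsto_vec_nth assms)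

text \<open>By polarisation the entries of a symmetric matrix are combinations of values of its
  form, and each such value is increasing and bounded along the sequence.\<close>

lemma symmetric_monotone_limit:
  fixes M :: "nat \<Rightarrow> real^'n^'n"
  assumes sym: "\<And>n. transpose (M n) = M n"
    and mono: "\<And>n x. wnorm2 (M n) x \<le> wnorm2 (M (Suc n)) x"
    and bound: "\<And>n x. wnorm2 (M n) x \<le> z * (norm x)\<^sup>2"
  obtains L where "M \<longlonglongrightarrow> L" "transpose L = L" "\<And>n x. wnorm2 (M n) x \<le> wnorm2 L x"
proof -
  define l where "l x = lim (\<lambda>n. wnorm2 (M n) x)" for x
  have inc: "incseq (\<lambda>n. wnorm2 (M n) x)" for x by (intro incseq_SucI mono)
  have l: "(\<lambda>n. wnorm2 (M n) x) \<longlonglongrightarrow> l x" for x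
    using incseq_convergent[OF inc, of x "z * (norm x)\<^sup>2"] bound unfolding l_def by (metis limI)
  define L where "L = (\<chi> i j. (l (axis i 1 + axis j 1) - l (axis i 1) - l (axis j 1)) / 2)"
  have lim: "M \<longlonglongrightarrow> L"
  proof (intro vec_tendstoI)
    fix i j
    have "(\<lambda>n. (wnorm2 (M n) (axis i 1 + axis j 1) - wnorm2 (M n) (axis i 1) - wnorm2 (M n) (axis j 1)) / 2)
      \<longlonglongrightarrow> (l (axis i 1 + axis j 1) - l (axis i 1) - l (axis j 1)) / 2"
      by (intro tendsto_intros l) simp
    then show "(\<lambda>n. M n $ i $ j) \<longlonglongrightarrow> L $ i $ j"
      by (simp add: L_def symmetric_entry_wnorm2[OF sym])
  qed
  have "l x = wnorm2 L x" for x
    using LIMSEQ_unique[OF l tendsto_wnorm2[OF lim]] .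
  then have "wnorm2 (M n) x \<le> wnorm2 L x" for n x
    using incseq_le[OF inc l] by metis
  moreover have "transpose L = L"
    by (simp add: L_def transpose_def vec_eq_iff add.commute)
  ultimately show thesis using lim that by blast
qed

locale riccati = stage_game N F A R Ra + law: prob_space law
  for N :: "'h measure" and F :: "'h \<Rightarrow> real^'n^'s" and A :: "real^'s^'s" and R :: "real^'m^'m"
    and Ra :: "real^'n^'n" and law :: "(real^'m^'s) measure" +
  fixes Q :: "real^'s^'s"
  assumes law_sets [measurable_cong]: "sets law = sets borel" and Q: "pos_def Q"
begin

definition P where
  "P Z = (1/2) *\<^sub>R ((\<integral>b. G Z b \<partial>law) + transpose (\<integral>b. G Z b \<partial>law))"

definition "step Z = Q + P Z"

text \<open>Value iteration. The weight of the next state includes its immediate charge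
  \<open>Q\<close>, so \<open>iter n - Q\<close> is the value matrix of the game with
  \<open>n\<close> stages, apart from the constant that the noise contributes.\<close>

definition "iter n = (step ^^ n) Q"

lemma Q_sym: "transpose Q = Q"
  using Q by (simp add: pos_def_def)

lemma P_sym: "transpose (P Z) = P Z"
  by (simp add: P_def transpose_def vec_eq_iff add.commute)

lemma step_sym: "transpose (step Z) = step Z"
  using P_sym[of Z] Q_sym by (simp add: step_def transpose_def vec_eq_iff)

lemma iter_simps: "iter 0 = Q" "iter (Suc n) = step (iter n)"
  by (simp_all add: iter_def)

lemma iter_sym: "transpose (iter n) = iter n"
  by (cases n) (simp_all add: iter_simps Q_sym step_sym)

lemma measurable_law_G:
  assumes "admissible Z"
  shows "G Z \<in> borel_measurable law"
  using measurable_G[OF assms] by measurable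

lemma integrable_G:
  assumes Z: "admissible Z"
  shows "integrable law (G Z)"
proof -
  obtain c where c: "0 \<le> c" "\<And>b. norm (G Z b) \<le> c" using G_bounded[OF Z] by metis
  note [measurable] = measurable_law_G[OF Z]
  show ?thesis
    by (rule law.integrable_const_bound[where B = c]) (use c in auto)
qed

lemma wnorm2_P_mean: "wnorm2 (P Z) x = wnorm2 (\<integral>b. G Z b \<partial>law) x"
proof -
  define E where "E = (\<integral>b. G Z b \<partial>law)"
  have "wnorm2 (transpose E) x = wnorm2 E x"
    unfolding wnorm2_def inner_transpose_mult by (rule inner_commute)
  moreover have "wnorm2 (P Z) x = (wnorm2 E x + wnorm2 (transpose E) x) / 2"
    unfolding P_def E_def[symmetric] wnorm2_def
    by (simp add: scaleR_matrix_vector_assoc[symmetric] matrix_vector_mult_add_rdistrib inner_add_right del: transpose_matrix_vector)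
  ultimately show ?thesis by (simp add: E_def)
qed

lemma wnorm2_P:
  assumes Z: "admissible Z"
  shows "integrable law (\<lambda>b. wnorm2 (G Z b) x)" "(\<integral>b. wnorm2 (G Z b) x \<partial>law) = wnorm2 (P Z) x"
proof -
  have "linear (\<lambda>m::real^'s^'s. wnorm2 m x)"
    by (auto simp: linear_iff wnorm2_def matrix_vector_mult_add_rdistrib inner_add_right scaleR_matrix_vector_assoc[symmetric])
  then have bl: "bounded_linear (\<lambda>m::real^'s^'s. wnorm2 m x)"
    by (simp add: linear_conv_bounded_linear)
  show "integrable law (\<lambda>b. wnorm2 (G Z b) x)"
    by (rule integrable_bounded_linear[OF bl integrable_G[OF Z]])
  have "(\<integral>b. wnorm2 (G Z b) x \<partial>law) = wnorm2 (\<integral>b. G Z b \<partial>law) x"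
    by (rule integral_bounded_linear[OF bl integrable_G[OF Z]])
  then show "(\<integral>b. wnorm2 (G Z b) x \<partial>law) = wnorm2 (P Z) x" by (simp add: wnorm2_P_mean)
qed

lemma P_nonneg: "admissible Z \<Longrightarrow> 0 \<le> wnorm2 (P Z) x"
  unfolding wnorm2_P(2)[symmetric] by (simp add: value_nonneg)

lemma P_mono:
  assumes "admissible Z" "admissible Z'" "\<And>x. wnorm2 Z x \<le> wnorm2 Z' x"
  shows "wnorm2 (P Z) x \<le> wnorm2 (P Z') x"
  unfolding wnorm2_P(2)[OF assms(1), symmetric] wnorm2_P(2)[OF assms(2), symmetric]
  by (intro integral_mono wnorm2_P(1) value_mono assms)

lemma wnorm2_step: "wnorm2 (step Z) x = wnorm2 Q x + wnorm2 (P Z) x"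
  by (simp add: step_def wnorm2_add_matrix)

text \<open>With a silent control channel, Young's inequality separates the state from the attack.\<close>

lemma value_at_zero:
  assumes Z: "admissible Z" and le: "\<And>x. wnorm2 Z x \<le> z * (norm x)\<^sup>2" and z: "0 \<le> z" and e: "0 < e"
    and r: "\<And>a. z * (1 + 1/e) * power * (norm a)\<^sup>2 \<le> wnorm2 Ra a"
  shows "wnorm2 (G Z 0) x \<le> z * (1 + e) * (norm (A *v x))\<^sup>2"
proof -
  define a where "a = Ka Z 0 *v x"
  have young: "(norm (y + v))\<^sup>2 \<le> (1 + e) * (norm y)\<^sup>2 + (1 + 1/e) * (norm v)\<^sup>2" for y v :: "real^'s"
  proof -
    have "0 \<le> (norm (sqrt e *\<^sub>R y - (1 / sqrt e) *\<^sub>R v))\<^sup>2" by simp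
    also have "\<dots> = e * (y \<bullet> y) + 1/e * (v \<bullet> v) - 2 * (y \<bullet> v)"
    proof -
      have "sqrt e * sqrt e = e" "sqrt e > 0" using e by auto
      then show ?thesis using e
        by (simp add: power2_norm_eq_inner inner_diff_left inner_diff_right inner_commute field_simps)
    qed
    finally show ?thesis
      by (simp add: power2_norm_eq_inner inner_add_left inner_add_right inner_commute algebra_simps)
  qed
  have "wnorm2 (G Z 0) x \<le> payoff Z 0 x 0 a" unfolding a_def by (rule saddle_control[OF Z])
  also have "\<dots> \<le> z * (1 + e) * (norm (A *v x))\<^sup>2 + z * (1 + 1/e) * power * (norm a)\<^sup>2 - wnorm2 Ra a"
  proof -
    have "(\<integral>h. wnorm2 Z (A *v x + F h *v a) \<partial>N)
      \<le> (\<integral>h. z * (1 + e) * (norm (A *v x))\<^sup>2 + z * (1 + 1/e) * (norm a)\<^sup>2 * (norm (F h))\<^sup>2 \<partial>N)"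
    proof (rule integral_mono)
      fix h
      have fa: "(norm (F h *v a))\<^sup>2 \<le> (norm (F h) * norm a)\<^sup>2"
        by (intro power_mono norm_matrix_vector_mult_le) auto
      have "wnorm2 Z (A *v x + F h *v a) \<le> z * (norm (A *v x + F h *v a))\<^sup>2" by (rule le)
      also have "\<dots> \<le> z * ((1 + e) * (norm (A *v x))\<^sup>2 + (1 + 1/e) * (norm (F h) * norm a)\<^sup>2)"
        using e z by (intro mult_left_mono order_trans[OF young] add_left_mono fa) auto
      finally show "wnorm2 Z (A *v x + F h *v a) \<le> z * (1 + e) * (norm (A *v x))\<^sup>2 + z * (1 + 1/e) * (norm a)\<^sup>2 * (norm (F h))\<^sup>2"
        by (simp add: power_mult_distrib algebra_simps)
    qed (use integral_expand(1)[OF admissible_sym[OF Z]] sq_F in auto)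
    then show ?thesis
      using sq_F by (simp add: payoff_def prob_space power_def algebra_simps)
  qed
  also have "\<dots> \<le> z * (1 + e) * (norm (A *v x))\<^sup>2" using r[of a] by simp
  finally show ?thesis .
qed

text \<open>A control of full rank can cancel the drift.\<close>

lemma value_full_rank:
  assumes Z: "admissible Z" and le: "\<And>x. wnorm2 Z x \<le> z * (norm x)\<^sup>2" and z: "0 \<le> z"
    and r: "\<And>a. z * power * (norm a)\<^sup>2 \<le> wnorm2 Ra a"
    and u: "b *v u = - (A *v x)" "\<sigma>\<^sup>2 * (norm u)\<^sup>2 \<le> (norm (A *v x))\<^sup>2" and \<sigma>: "0 < \<sigma>"
  shows "wnorm2 (G Z b) x \<le> norm R / \<sigma>\<^sup>2 * (norm (A *v x))\<^sup>2"
proof -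
  define a where "a = Ka Z b *v x"
  have "wnorm2 (G Z b) x \<le> payoff Z b x u a" unfolding a_def by (rule saddle_control[OF Z])
  also have "\<dots> = wnorm2 (second Z) a - wnorm2 Ra a + wnorm2 R u"
    by (simp add: payoff_def u(1) integral_wnorm2_F)
  also have "\<dots> \<le> wnorm2 R u"
    using wnorm2_second_le[OF le z, of a] r[of a] by simp
  also have "\<dots> \<le> norm R * (norm u)\<^sup>2" using wnorm2_le_norm[of R u] by simp
  also have "\<dots> \<le> norm R * ((norm (A *v x))\<^sup>2 / \<sigma>\<^sup>2)"
    using u(2) \<sigma> by (intro mult_left_mono) (auto simp: field_simps)
  finally show ?thesis by simp
qed

end

text \<open>In the following locale \<open>C\<close>, \<open>\<epsilon>\<close> and \<open>z\<close> are chosen so that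
  \<open>C + (1 - \<epsilon>) (1 + \<epsilon>/2) z \<le> z\<close>, which makes \<open>z\<close> an invariant bound of the iteration.\<close>

locale bounded_riccati = riccati N F A R Ra law Q
  for N :: "'h measure" and F :: "'h \<Rightarrow> real^'n^'s" and A :: "real^'s^'s" and R :: "real^'m^'m"
    and Ra :: "real^'n^'n" and law :: "(real^'m^'s) measure" and Q :: "real^'s^'s" +
  fixes \<rho> \<sigma> \<epsilon> C z
  assumes A_bound: "\<And>x. (norm (A *v x))\<^sup>2 \<le> \<rho>\<^sup>2 * (norm x)\<^sup>2"
    and eps: "0 < \<epsilon>" "\<epsilon> \<le> 1" and sigma: "0 < \<sigma>"
    and zero_prob: "measure law {0} * \<rho>\<^sup>2 = 1 - \<epsilon>"
    and full: "AE b in law. b \<noteq> 0 \<longrightarrow> (\<forall>y. \<sigma>\<^sup>2 * (norm y)\<^sup>2 \<le> (norm (transpose b *v y))\<^sup>2)"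
    and C: "norm Q + norm R / \<sigma>\<^sup>2 * \<rho>\<^sup>2 + 1 \<le> C"
    and z: "z = 2 * C / \<epsilon>"
    and Ra_bound: "\<And>a. a \<noteq> 0 \<Longrightarrow> (6 * C * power + 1) / \<epsilon>\<^sup>2 * (norm a)\<^sup>2 < wnorm2 Ra a"
begin

lemma C_pos: "0 < C"
proof -
  have "0 \<le> norm Q + norm R / \<sigma>\<^sup>2 * \<rho>\<^sup>2" by simp
  with C show ?thesis by linarith
qed

lemma z_pos: "0 < z" using C_pos eps by (simp add: z)

text \<open>The Young parameter is \<epsilon>/2: its factor 1 + 2/\<epsilon> is at most 3/\<epsilon>
  because \<epsilon> \<le> 1, and with z = 2 C / \<epsilon> the product is 6 C / \<epsilon>^2 times
  \<open>power\<close>. This is the origin of the 6.\<close>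

lemma Ra_bound':
  "z * (1 + 1 / (\<epsilon>/2)) * power * (norm a)\<^sup>2 \<le> wnorm2 Ra a"
  "a \<noteq> 0 \<Longrightarrow> z * power * (norm a)\<^sup>2 < wnorm2 Ra a"
proof -
  have "z * (1 + 1 / (\<epsilon>/2)) * power \<le> z * (3 / \<epsilon>) * power"
    using eps z_pos power_nonneg by (intro mult_right_mono mult_left_mono) (auto simp: field_simps)
  also have "\<dots> = 6 * C * power / \<epsilon>\<^sup>2" by (simp add: z power2_eq_square)
  also have "\<dots> \<le> (6 * C * power + 1) / \<epsilon>\<^sup>2" using eps by (intro divide_right_mono) auto
  finally have 1: "z * (1 + 1 / (\<epsilon>/2)) * power \<le> (6 * C * power + 1) / \<epsilon>\<^sup>2" .
  have 2: "z * power \<le> z * (1 + 1 / (\<epsilon>/2)) * power"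
    using eps z_pos power_nonneg by (intro mult_right_mono) auto
  show s: "z * (1 + 1 / (\<epsilon>/2)) * power * (norm a)\<^sup>2 \<le> wnorm2 Ra a"
    using Ra_bound[of a] mult_right_mono[OF 1, of "(norm a)\<^sup>2"] by (cases "a = 0") auto
  show "z * power * (norm a)\<^sup>2 < wnorm2 Ra a" if "a \<noteq> 0"
    using Ra_bound[OF that] mult_right_mono[OF order_trans[OF 2 1], of "(norm a)\<^sup>2"] by simp
qed

text \<open>The bound by \<open>z\<close> alone secures a positive margin. Keeping the iterates
  below \<open>z\<close> thus keeps every stage game solvable.\<close>

lemma admissibleI:
  assumes "pos_def Z" "\<And>x. wnorm2 Z x \<le> z * (norm x)\<^sup>2"
  shows "admissible Z"
proof -
  have "0 < wnorm2 (margin Z) a" if "a \<noteq> 0" for a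
    using wnorm2_second_le[OF assms(2), of a] z_pos Ra_bound'(2)[OF that]
    by (simp add: margin_def wnorm2_diff_matrix)
  moreover have "transpose (margin Z) = margin Z"
    using Ra_sym transpose_second[of Z] assms(1)
    by (simp add: margin_def transpose_def vec_eq_iff pos_def_def)
  ultimately show ?thesis
    using assms(1) by (simp add: admissible_def pos_def_def wnorm2_def)
qed

lemma step_bound:
  assumes Z: "pos_def Z" and le: "\<And>x. wnorm2 Z x \<le> z * (norm x)\<^sup>2"
  shows "wnorm2 (step Z) x \<le> z * (norm x)\<^sup>2"
proof -
  have aZ: "admissible Z" by (rule admissibleI[OF Z le])
  define c0 c1 where "c0 = z * (1 + \<epsilon>/2) * (norm (A *v x))\<^sup>2" and "c1 = norm R / \<sigma>\<^sup>2 * (norm (A *v x))\<^sup>2"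
  have c1: "0 \<le> c1" by (simp add: c1_def)
  \<comment> \<open>The silent channel gives \<open>c0\<close> and the other realisations give
    \<open>c1\<close>. As \<open>c1\<close> is nonnegative it may be added everywhere, which leaves
    one indicator to integrate.\<close>
  have "AE b in law. wnorm2 (G Z b) x \<le> indicator {0} b * c0 + c1"
    using full
  proof eventually_elim
    case (elim b)
    show ?case
    proof (cases "b = 0")
      case True
      then show ?thesis
        using value_at_zero[OF aZ le _ _ Ra_bound'(1), of x] z_pos eps c1 by (simp add: c0_def)
    next
      case False
      with elim obtain u where "b *v u = - (A *v x)" "\<sigma>\<^sup>2 * (norm u)\<^sup>2 \<le> (norm (- (A *v x)))\<^sup>2"
        using small_preimage[OF sigma] by metis
      moreover have "z * power * (norm a)\<^sup>2 \<le> wnorm2 Ra a" for a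
        using Ra_bound'(2)[of a] by (cases "a = 0") auto
      ultimately show ?thesis
        using value_full_rank[OF aZ le, of b _ x \<sigma>] z_pos sigma False by (simp add: c1_def)
    qed
  qed
  moreover have s0: "{0} \<in> sets law" by (simp add: law_sets)
  then have i0: "integrable law (indicator {0} :: _ \<Rightarrow> real)"
    by (simp add: integrable_indicator_iff law.emeasure_finite less_top[symmetric])
  ultimately have "wnorm2 (P Z) x \<le> (\<integral>b. indicator {0} b * c0 + c1 \<partial>law)"
    unfolding wnorm2_P(2)[OF aZ, symmetric]
    by (intro integral_mono_AE wnorm2_P(1)[OF aZ]) (use i0 in auto)
  also have "\<dots> = measure law {0} * c0 + c1"
    using s0 i0 by (simp add: law.prob_space Int_absorb2[OF sets.sets_into_space])
  also have "\<dots> \<le> (z * (1 + \<epsilon>/2) * (measure law {0} * \<rho>\<^sup>2) + norm R / \<sigma>\<^sup>2 * \<rho>\<^sup>2) * (norm x)\<^sup>2"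
  proof -
    have "measure law {0} * c0 \<le> measure law {0} * (z * (1 + \<epsilon>/2) * (\<rho>\<^sup>2 * (norm x)\<^sup>2))"
      unfolding c0_def using z_pos eps by (intro mult_left_mono A_bound) auto
    moreover have "c1 \<le> norm R / \<sigma>\<^sup>2 * (\<rho>\<^sup>2 * (norm x)\<^sup>2)"
      unfolding c1_def by (intro mult_left_mono A_bound) auto
    ultimately show ?thesis by (simp add: algebra_simps)
  qed
  finally have "wnorm2 (step Z) x \<le> (norm Q + z * (1 + \<epsilon>/2) * (1 - \<epsilon>) + norm R / \<sigma>\<^sup>2 * \<rho>\<^sup>2) * (norm x)\<^sup>2"
    using wnorm2_le_norm[of Q x] unfolding wnorm2_step zero_prob by (simp add: algebra_simps)
  also have "\<dots> \<le> z * (norm x)\<^sup>2"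
  proof (intro mult_right_mono)
    \<comment> \<open>The zero channel saves \<open>z * \<epsilon>\<close>; Young's factor spends
      half of it, and the other half is exactly \<open>C\<close>.\<close>
    have "z * \<epsilon> = 2 * C" using eps by (simp add: z)
    moreover have "0 \<le> z * \<epsilon>\<^sup>2" using z_pos by simp
    moreover have "z * (1 + \<epsilon>/2) * (1 - \<epsilon>) = z - z * \<epsilon> / 2 - z * \<epsilon>\<^sup>2 / 2"
      by (simp add: power2_eq_square field_simps)
    ultimately show "norm Q + z * (1 + \<epsilon>/2) * (1 - \<epsilon>) + norm R / \<sigma>\<^sup>2 * \<rho>\<^sup>2 \<le> z"
      using C by linarith
  qed simp
  finally show ?thesis .
qed

lemma iter_bounds: "pos_def (iter n) \<and> (\<forall>x. wnorm2 (iter n) x \<le> z * (norm x)\<^sup>2)"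
proof (induction n)
  case 0
  have "norm Q \<le> z"
  proof -
    have "0 \<le> norm R / \<sigma>\<^sup>2 * \<rho>\<^sup>2" by simp
    then have "norm Q \<le> C" using C by linarith
    also have "C \<le> z" using C_pos eps by (simp add: z field_simps)
    finally show ?thesis .
  qed
  then have "norm Q * (norm x)\<^sup>2 \<le> z * (norm x)\<^sup>2" for x :: "real^'s"
    by (rule mult_right_mono) simp
  then have "wnorm2 Q x \<le> z * (norm x)\<^sup>2" for x
    using wnorm2_le_norm[of Q x] by (meson abs_le_D1 order_trans)
  then show ?case using Q by (simp add: iter_simps)
next
  case (Suc n)
  then have a: "admissible (iter n)" by (intro admissibleI) auto
  have "0 < wnorm2 (step (iter n)) x" if "x \<noteq> 0" for x
    using P_nonneg[OF a, of x] Q that unfolding wnorm2_step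
    by (smt (verit) pos_def_def wnorm2_def)
  then have "pos_def (iter (Suc n))"
    using step_sym by (simp add: pos_def_def iter_simps wnorm2_def)
  with Suc show ?case using step_bound[of "iter n"] by (simp add: iter_simps)
qed

lemma iter_admissible: "admissible (iter n)"
  using iter_bounds by (intro admissibleI) auto

lemma iter_mono: "wnorm2 (iter n) x \<le> wnorm2 (iter (Suc n)) x"
proof (induction n arbitrary: x)
  case 0
  show ?case using P_nonneg[OF iter_admissible[of 0]] by (simp add: iter_simps wnorm2_step)
next
  case (Suc n)
  show ?case
    using P_mono[OF iter_admissible[of n] iter_admissible[of "Suc n"] Suc] by (simp add: iter_simps wnorm2_step)
qed

text \<open>Since \<open>Z \<le> (1 + e) iter n\<close> for large \<open>n\<close>, playing the attack of the limit against the control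
  of \<open>iter n\<close> bounds the value of the limit, without continuity of the Riccati map.\<close>

lemma limit_supersolution:
  assumes lim: "iter \<longlonglongrightarrow> Z" and sym: "transpose Z = Z" and ge: "\<And>n x. wnorm2 (iter n) x \<le> wnorm2 Z x"
  shows "admissible Z" "wnorm2 (P Z) x \<le> wnorm2 (Z - Q) x"
proof -
  have "wnorm2 Z y \<le> z * (norm y)\<^sup>2" for y
    using iter_bounds by (intro LIMSEQ_le_const2[OF tendsto_wnorm2[OF lim]]) auto
  moreover have pd: "pos_def Z"
    unfolding pos_def_def using sym Q ge[of 0]
    by (auto simp: wnorm2_def iter_simps pos_def_def intro: less_le_trans)
  ultimately show aZ: "admissible Z" by (intro admissibleI)
  obtain q where q: "0 < q" "\<And>y. q * (norm y)\<^sup>2 \<le> wnorm2 Q y" using pos_def_lower_bound[OF Q] by blast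
  obtain c where c: "0 \<le> c" "\<And>b x. (norm (Ka Z b *v x))\<^sup>2 \<le> c * (norm x)\<^sup>2" using gains_bounded[OF aZ] by metis
  define k where "k = norm Ra * c * (norm x)\<^sup>2"
  have main: "wnorm2 (P Z) x \<le> (1 + e) * wnorm2 (Z - Q) x + e * k" if e: "0 < e" for e
  proof -
    \<comment> \<open>\<open>q\<close> bounds \<open>Q\<close>, and hence every iterate, from below.
      Closeness within \<open>e * q\<close> in norm therefore becomes closeness relative to
      \<open>iter n\<close>.\<close>
    have "(\<lambda>n. norm (Z - iter n)) \<longlonglongrightarrow> norm (Z - Z)" by (intro tendsto_intros lim)
    then have "\<forall>\<^sub>F n in sequentially. norm (Z - iter n) < e * q"
      using e q(1) by (intro order_tendstoD(2)[where y = "norm (Z - Z)"]) auto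
    then obtain n where n: "norm (Z - iter n) < e * q" by (auto simp: eventually_sequentially)
    have close: "wnorm2 Z y \<le> (1 + e) * wnorm2 (iter n) y" for y
    proof -
      have "wnorm2 (Z - iter n) y \<le> norm (Z - iter n) * (norm y)\<^sup>2" using wnorm2_le_norm[of "Z - iter n" y] by simp
      also have "\<dots> \<le> e * q * (norm y)\<^sup>2" using n by (intro mult_right_mono) auto
      also have "\<dots> \<le> e * wnorm2 Q y" using q(2)[of y] e by (simp add: mult.assoc)
      also have "\<dots> \<le> e * wnorm2 (iter n) y"
        using e iter_admissible[of n] P_nonneg[OF iter_admissible] by (cases n) (auto simp: iter_simps wnorm2_step)
      finally show ?thesis by (simp add: wnorm2_diff_matrix algebra_simps)
    qed
    have pw: "wnorm2 (G Z b) x \<le> (1 + e) * wnorm2 (G (iter n) b) x + e * k" for b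
    proof -
      define u a where "u = Kc (iter n) b *v x" and "a = Ka Z b *v x"
      have "wnorm2 (G Z b) x \<le> payoff Z b x u a" unfolding a_def by (rule saddle_control[OF aZ])
      \<comment> \<open>Scaling the payoff by 1 + e also scales the attack cost subtracted in it;
        the surplus is paid back by the last term, which is bounded uniformly in \<open>b\<close>
        and vanishes with \<open>e\<close>.\<close>
      also have "\<dots> \<le> (1 + e) * payoff (iter n) b x u a + e * wnorm2 Ra a"
      proof -
        have "(\<integral>h. wnorm2 Z (A *v x + b *v u + F h *v a) \<partial>N)
           \<le> (\<integral>h. (1 + e) * wnorm2 (iter n) (A *v x + b *v u + F h *v a) \<partial>N)"
          using integral_expand(1)[OF sym] integral_expand(1)[OF iter_sym]
          by (intro integral_mono close) auto
        then have "(\<integral>h. wnorm2 Z (A *v x + b *v u + F h *v a) \<partial>N)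
           \<le> (1 + e) * (\<integral>h. wnorm2 (iter n) (A *v x + b *v u + F h *v a) \<partial>N)"
          by simp
        moreover have "0 \<le> e * wnorm2 R u" using e R by (simp add: wnorm2_nonneg)
        ultimately show ?thesis by (simp add: payoff_def algebra_simps)
      qed
      also have "\<dots> \<le> (1 + e) * wnorm2 (G (iter n) b) x + e * k"
      proof (intro add_mono mult_left_mono)
        show "payoff (iter n) b x u a \<le> wnorm2 (G (iter n) b) x"
          unfolding u_def by (rule saddle_attack[OF iter_admissible])
        have "wnorm2 Ra a \<le> norm Ra * (norm a)\<^sup>2" using wnorm2_le_norm[of Ra a] by simp
        also have "\<dots> \<le> norm Ra * (c * (norm x)\<^sup>2)" unfolding a_def by (intro mult_left_mono c(2)) simp
        finally show "wnorm2 Ra a \<le> k" by (simp add: k_def)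
      qed (use e in auto)
      finally show ?thesis .
    qed
    have "wnorm2 (P Z) x \<le> (\<integral>b. (1 + e) * wnorm2 (G (iter n) b) x + e * k \<partial>law)"
      unfolding wnorm2_P(2)[OF aZ, symmetric]
      using wnorm2_P(1)[OF aZ] wnorm2_P(1)[OF iter_admissible[of n]] by (intro integral_mono pw) auto
    also have "\<dots> = (1 + e) * wnorm2 (P (iter n)) x + e * k"
      using wnorm2_P[OF iter_admissible[of n]] by (simp add: law.prob_space)
    also have "wnorm2 (P (iter n)) x \<le> wnorm2 (Z - Q) x"
      using ge[of "Suc n" x] by (simp add: iter_simps wnorm2_step wnorm2_diff_matrix)
    finally show ?thesis using e by simp
  qed
  have "((\<lambda>e. (1 + e) * wnorm2 (Z - Q) x + e * k) \<longlongrightarrow> (1 + 0) * wnorm2 (Z - Q) x + 0 * k) (at_right 0)"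
    by (intro tendsto_intros)
  then have "wnorm2 (P Z) x \<le> (1 + 0) * wnorm2 (Z - Q) x + 0 * k"
    using main by (intro tendsto_lowerbound[where F = "at_right 0"]) (auto simp: eventually_at_filter)
  then show "wnorm2 (P Z) x \<le> wnorm2 (Z - Q) x" by simp
qed

lemma riccati_limit:
  obtains Z where "iter \<longlonglongrightarrow> Z" "admissible Z" "\<And>x. wnorm2 (P Z) x \<le> wnorm2 (Z - Q) x"
    "\<And>n x. wnorm2 (iter n) x \<le> wnorm2 Z x"
  using symmetric_monotone_limit[of iter z] iter_sym iter_mono iter_bounds limit_supersolution by metis

end

section \<open>Square integrability and independence\<close>

definition sq_integrable :: "'w measure \<Rightarrow> ('w \<Rightarrow> 'a::euclidean_space) \<Rightarrow> bool" where
  "sq_integrable M f \<longleftrightarrow> f \<in> borel_measurable M \<and> integrable M (\<lambda>\<omega>. (norm (f \<omega>))\<^sup>2)"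

lemma sq_integrable_measurable: "sq_integrable M f \<Longrightarrow> f \<in> borel_measurable M"
  by (simp add: sq_integrable_def)

lemma sq_integrable_bound:
  assumes "sq_integrable M g" "f \<in> borel_measurable M" "\<And>\<omega>. (norm (f \<omega>))\<^sup>2 \<le> c * (norm (g \<omega>))\<^sup>2"
  shows "sq_integrable M f"
  unfolding sq_integrable_def
proof
  show "integrable M (\<lambda>\<omega>. (norm (f \<omega>))\<^sup>2)"
  proof (rule Bochner_Integration.integrable_bound)
    show "integrable M (\<lambda>\<omega>. c * (norm (g \<omega>))\<^sup>2)" using assms(1) by (simp add: sq_integrable_def)
    show "AE \<omega> in M. norm ((norm (f \<omega>))\<^sup>2) \<le> norm (c * (norm (g \<omega>))\<^sup>2)"
      using order_trans[OF assms(3) abs_ge_self] by (intro AE_I2) simp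
  qed (use assms(2) in measurable)
qed (fact assms(2))

lemma sq_integrable_add:
  assumes "sq_integrable M f" "sq_integrable M g"
  shows "sq_integrable M (\<lambda>\<omega>. f \<omega> + g \<omega>)"
  unfolding sq_integrable_def
proof
  show m: "(\<lambda>\<omega>. f \<omega> + g \<omega>) \<in> borel_measurable M"
    using assms by (auto simp: sq_integrable_def)
  show "integrable M (\<lambda>\<omega>. (norm (f \<omega> + g \<omega>))\<^sup>2)"
  proof (rule Bochner_Integration.integrable_bound)
    show "integrable M (\<lambda>\<omega>. 2 * (norm (f \<omega>))\<^sup>2 + 2 * (norm (g \<omega>))\<^sup>2)"
      using assms by (simp add: sq_integrable_def)
    show "AE \<omega> in M. norm ((norm (f \<omega> + g \<omega>))\<^sup>2) \<le> norm (2 * (norm (f \<omega>))\<^sup>2 + 2 * (norm (g \<omega>))\<^sup>2)"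
      using order_trans[OF norm_add_square_le abs_ge_self] by (intro AE_I2) simp
  qed (use m in measurable)
qed

lemma sq_integrable_matrix_mult:
  fixes f :: "'w \<Rightarrow> real^'n" and Z :: "real^'n^'m"
  assumes "sq_integrable M f"
  shows "sq_integrable M (\<lambda>\<omega>. Z *v f \<omega>)"
proof (rule sq_integrable_bound[OF assms])
  show "(\<lambda>\<omega>. Z *v f \<omega>) \<in> borel_measurable M"
    using sq_integrable_measurable[OF assms] by measurable
  show "(norm (Z *v f \<omega>))\<^sup>2 \<le> (norm Z)\<^sup>2 * (norm (f \<omega>))\<^sup>2" for \<omega>
    unfolding power_mult_distrib[symmetric] by (intro power_mono norm_matrix_vector_mult_le) auto
qed

lemma sq_integrable_minus:
  assumes "sq_integrable M f"
  shows "sq_integrable M (\<lambda>\<omega>. - f \<omega>)"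
  using assms by (simp add: sq_integrable_def)

lemma sq_integrable_sum:
  assumes "finite S" "\<And>i. i \<in> S \<Longrightarrow> sq_integrable M (f i)"
  shows "sq_integrable M (\<lambda>\<omega>. \<Sum>i\<in>S. f i \<omega>)"
  using assms
proof (induction S)
  case empty
  show ?case by (simp add: sq_integrable_def)
next
  case (insert i S)
  then show ?case by (simp add: sq_integrable_add)
qed

lemma sq_integrable_wnorm2:
  assumes "sq_integrable M f"
  shows "integrable M (\<lambda>\<omega>. wnorm2 Z (f \<omega>))"
proof (rule Bochner_Integration.integrable_bound)
  show "integrable M (\<lambda>\<omega>. norm Z * (norm (f \<omega>))\<^sup>2)" using assms by (simp add: sq_integrable_def)
  show "(\<lambda>\<omega>. wnorm2 Z (f \<omega>)) \<in> borel_measurable M"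
    using sq_integrable_measurable[OF assms] by measurable
  show "AE \<omega> in M. norm (wnorm2 Z (f \<omega>)) \<le> norm (norm Z * (norm (f \<omega>))\<^sup>2)"
    using wnorm2_le_norm by (intro AE_I2) simp
qed

lemma sq_integrable_prod:
  fixes f :: "'w \<Rightarrow> real^'n" and g :: "'w \<Rightarrow> real^'m"
  assumes f: "sq_integrable M f" and g: "sq_integrable M g"
  shows "integrable M (\<lambda>\<omega>. f \<omega> $ i * g \<omega> $ j)"
proof (rule Bochner_Integration.integrable_bound)
  show "integrable M (\<lambda>\<omega>. (norm (f \<omega>))\<^sup>2 + (norm (g \<omega>))\<^sup>2)"
    using f g by (simp add: sq_integrable_def)
  show "(\<lambda>\<omega>. f \<omega> $ i * g \<omega> $ j) \<in> borel_measurable M"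
    using sq_integrable_measurable[OF f] sq_integrable_measurable[OF g] by measurable
  have "\<bar>f \<omega> $ i * g \<omega> $ j\<bar> \<le> (norm (f \<omega>))\<^sup>2 + (norm (g \<omega>))\<^sup>2" for \<omega>
  proof -
    have "\<bar>f \<omega> $ i * g \<omega> $ j\<bar> \<le> norm (f \<omega>) * norm (g \<omega>)"
      unfolding abs_mult by (intro mult_mono component_le_norm_cart) auto
    also have "\<dots> \<le> (norm (f \<omega>))\<^sup>2 + (norm (g \<omega>))\<^sup>2"
      using sum_squares_bound[of "norm (f \<omega>)" "norm (g \<omega>)"]
        mult_nonneg_nonneg[OF norm_ge_zero[of "f \<omega>"] norm_ge_zero[of "g \<omega>"]]
      unfolding mult.assoc by linarith
    finally show ?thesis .
  qed
  then show "AE \<omega> in M. norm (f \<omega> $ i * g \<omega> $ j) \<le> norm ((norm (f \<omega>))\<^sup>2 + (norm (g \<omega>))\<^sup>2)"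
    by (intro AE_I2) (metis abs_ge_self order_trans real_norm_def)
qed

lemma (in finite_measure) sq_integrable_component:
  fixes f :: "'a \<Rightarrow> real^'n"
  assumes f: "sq_integrable M f"
  shows "integrable M (\<lambda>\<omega>. f \<omega> $ i)"
proof (rule Bochner_Integration.integrable_bound)
  show "integrable M (\<lambda>\<omega>. 1 + (norm (f \<omega>))\<^sup>2)"
    using f by (simp add: sq_integrable_def)
  show "(\<lambda>\<omega>. f \<omega> $ i) \<in> borel_measurable M"
    using sq_integrable_measurable[OF f] by measurable
  have "\<bar>f \<omega> $ i\<bar> \<le> 1 + (norm (f \<omega>))\<^sup>2" for \<omega>
    using component_le_norm_cart[of "f \<omega>" i] sum_squares_bound[of 1 "norm (f \<omega>)"]
      norm_ge_zero[of "f \<omega>"] by simp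
  then show "AE \<omega> in M. norm (f \<omega> $ i) \<le> norm (1 + (norm (f \<omega>))\<^sup>2)"
    by (intro AE_I2) (metis abs_ge_self order_trans real_norm_def)
qed

lemma (in finite_measure) sq_integrable_bounded:
  assumes "f \<in> borel_measurable M" "\<And>\<omega>. norm (f \<omega>) \<le> c"
  shows "sq_integrable M f"
  unfolding sq_integrable_def
proof
  show "integrable M (\<lambda>\<omega>. (norm (f \<omega>))\<^sup>2)"
  proof (rule integrable_const_bound[where B = "c\<^sup>2"])
    show "AE x in M. norm ((norm (f x))\<^sup>2) \<le> c\<^sup>2"
      using power_mono[OF assms(2) norm_ge_zero, where n = 2] by (intro AE_I2) simp
  qed (use assms(1) in measurable)
qed (fact assms(1))

text \<open>Sources are families of events rather than random variables, because the underlying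
  variables take values in different types. \<open>hist I\<close> is the sigma-algebra generated by
  the sources in \<open>I\<close>.\<close>

locale sources = prob_space M for M :: "'w measure" +
  fixes src :: "'i \<Rightarrow> 'w set set"
  assumes src_indep: "indep_sets src UNIV" and src_Int_stable: "\<And>i. Int_stable (src i)"
begin

definition hist :: "'i set \<Rightarrow> 'w measure" where
  "hist I = sigma (space M) (\<Union>i\<in>I. src i)"

lemma src_events: "src i \<subseteq> events"
  using src_indep by (auto simp: indep_sets_def)

lemma src_space: "(\<Union>i\<in>I. src i) \<subseteq> Pow (space M)"
  using src_events sets.space_closed by fastforce

lemma space_hist [simp]: "space (hist I) = space M"
  unfolding hist_def using src_space by (simp add: space_measure_of)

lemma sets_hist: "sets (hist I) = sigma_sets (space M) (\<Union>i\<in>I. src i)"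
  unfolding hist_def using src_space by (simp add: sets_measure_of)

lemma sets_hist_mono: "I \<subseteq> J \<Longrightarrow> sets (hist I) \<subseteq> sets (hist J)"
  unfolding sets_hist by (intro sigma_sets_mono') auto

lemma sets_hist_events: "sets (hist I) \<subseteq> events"
  unfolding sets_hist using src_events by (intro sets.sigma_sets_subset) auto

lemma hist_mono: "f \<in> hist I \<rightarrow>\<^sub>M X \<Longrightarrow> I \<subseteq> J \<Longrightarrow> f \<in> hist J \<rightarrow>\<^sub>M X"
  using sets_hist_mono[of I J] by (auto simp: measurable_def)

lemma hist_measurable: "f \<in> hist I \<rightarrow>\<^sub>M X \<Longrightarrow> f \<in> M \<rightarrow>\<^sub>M X"
  using sets_hist_events[of I] by (auto simp: measurable_def)

text \<open>Independent families that are stable under intersection remain independent after they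
  are grouped into disjoint blocks and each block is closed to a sigma-algebra.\<close>

lemma indep_hist:
  assumes "I \<inter> J = {}" and f: "f \<in> hist I \<rightarrow>\<^sub>M X" and g: "g \<in> hist J \<rightarrow>\<^sub>M Y"
  shows "indep_var X f Y g"
  unfolding indep_var_def indep_vars_def2
proof
  show "\<forall>i\<in>UNIV. random_variable (case i of True \<Rightarrow> X | False \<Rightarrow> Y) (case i of True \<Rightarrow> f | False \<Rightarrow> g)"
    using hist_measurable[OF f] hist_measurable[OF g] by (simp split: bool.split)
  have "indep_sets src (\<Union>j\<in>UNIV. case j of True \<Rightarrow> I | False \<Rightarrow> J)"
    using src_indep by (rule indep_sets_mono_index[rotated]) simp
  then have "indep_sets (\<lambda>j. sigma_sets (space M) (\<Union>i\<in>(case j of True \<Rightarrow> I | False \<Rightarrow> J). src i)) UNIV"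
    by (rule indep_sets_collect_sigma)
       (use src_Int_stable assms(1) in \<open>auto simp: disjoint_family_on_def split: bool.splits\<close>)
  then show "indep_sets (\<lambda>i. {(case i of True \<Rightarrow> f | False \<Rightarrow> g) -` A \<inter> space M |A.
      A \<in> sets (case i of True \<Rightarrow> X | False \<Rightarrow> Y)}) UNIV"
  proof (rule indep_sets_mono_sets)
    fix i :: bool
    show "{(case i of True \<Rightarrow> f | False \<Rightarrow> g) -` A \<inter> space M |A. A \<in> sets (case i of True \<Rightarrow> X | False \<Rightarrow> Y)}
      \<subseteq> sigma_sets (space M) (\<Union>i\<in>(case i of True \<Rightarrow> I | False \<Rightarrow> J). src i)"
      using measurable_sets[OF f] measurable_sets[OF g]
      by (auto simp: sets_hist[symmetric] split: bool.split)
  qed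
qed

lemma indep_hist_mult:
  fixes f g :: "'w \<Rightarrow> real"
  assumes "I \<inter> J = {}" "f \<in> borel_measurable (hist I)" "g \<in> borel_measurable (hist J)"
    "integrable M f" "integrable M g"
  shows "integrable M (\<lambda>\<omega>. f \<omega> * g \<omega>)"
    "(\<integral>\<omega>. f \<omega> * g \<omega> \<partial>M) = (\<integral>\<omega>. f \<omega> \<partial>M) * (\<integral>\<omega>. g \<omega> \<partial>M)"
  using indep_var_integrable[OF indep_hist[OF assms(1-3)] assms(4,5)]
    indep_var_lebesgue_integral[OF indep_hist[OF assms(1-3)] assms(4,5)] by simp_all

text \<open>Entry by entry this is the product rule for independent integrable variables: inside a
  bilinear form, a matrix independent of both vectors may be replaced by its mean. It serves for the
  attack channel, for its weighted Gram matrix, and for \<open>G\<close> at the control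
  matrix.\<close>

lemma indep_matrix_form:
  fixes m :: "'w \<Rightarrow> real^'n^'s" and u :: "'w \<Rightarrow> real^'s" and v :: "'w \<Rightarrow> real^'n"
  assumes IJ: "I \<inter> J = {}" and m: "m \<in> borel_measurable (hist I)" "integrable M m"
    and u: "u \<in> borel_measurable (hist J)" "sq_integrable M u"
    and v: "v \<in> borel_measurable (hist J)" "sq_integrable M v"
  shows "integrable M (\<lambda>\<omega>. u \<omega> \<bullet> (m \<omega> *v v \<omega>))"
    and "(\<integral>\<omega>. u \<omega> \<bullet> (m \<omega> *v v \<omega>) \<partial>M) = (\<integral>\<omega>. u \<omega> \<bullet> ((\<integral>\<omega>. m \<omega> \<partial>M) *v v \<omega>) \<partial>M)"
proof -
  have eq: "u \<omega> \<bullet> (K *v v \<omega>) = (\<Sum>i\<in>UNIV. \<Sum>j\<in>UNIV. K $ i $ j * (u \<omega> $ i * v \<omega> $ j))" for K \<omega>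
    by (simp add: inner_vec_def matrix_vector_mult_def sum_distrib_left algebra_simps)
  have bl: "bounded_linear (\<lambda>K::real^'n^'s. K $ i $ j)" for i j
    by (intro bounded_linear_vec_nth bounded_linear_compose[OF bounded_linear_vec_nth])
  note im = integrable_bounded_linear[OF bl m(2)] and em = integral_bounded_linear[OF bl m(2)]
  have mm: "(\<lambda>\<omega>. m \<omega> $ i $ j) \<in> borel_measurable (hist I)" for i j using m(1) by measurable
  have mu: "(\<lambda>\<omega>. u \<omega> $ i * v \<omega> $ j) \<in> borel_measurable (hist J)" for i j using u(1) v(1) by measurable
  note iu = sq_integrable_prod[OF u(2) v(2)]
  note p = indep_hist_mult[OF IJ mm mu im iu]
  show "integrable M (\<lambda>\<omega>. u \<omega> \<bullet> (m \<omega> *v v \<omega>))"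
    unfolding eq by (intro Bochner_Integration.integrable_sum p)
  have "(\<integral>\<omega>. u \<omega> \<bullet> (m \<omega> *v v \<omega>) \<partial>M) = (\<Sum>i\<in>UNIV. \<Sum>j\<in>UNIV. \<integral>\<omega>. m \<omega> $ i $ j * (u \<omega> $ i * v \<omega> $ j) \<partial>M)"
    unfolding eq using p(1)
    by (subst Bochner_Integration.integral_sum, (intro Bochner_Integration.integrable_sum p)[1], intro sum.cong refl)
       (subst Bochner_Integration.integral_sum, auto)
  also have "\<dots> = (\<Sum>i\<in>UNIV. \<Sum>j\<in>UNIV. \<integral>\<omega>. (\<integral>\<omega>. m \<omega> \<partial>M) $ i $ j * (u \<omega> $ i * v \<omega> $ j) \<partial>M)"
    unfolding p(2) em by simp
  also have "\<dots> = (\<integral>\<omega>. u \<omega> \<bullet> ((\<integral>\<omega>. m \<omega> \<partial>M) *v v \<omega>) \<partial>M)"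
    unfolding eq using iu
    by (subst Bochner_Integration.integral_sum, (intro Bochner_Integration.integrable_sum integrable_mult_right iu)[1], intro sum.cong refl)
       (subst Bochner_Integration.integral_sum, auto)
  finally show "(\<integral>\<omega>. u \<omega> \<bullet> (m \<omega> *v v \<omega>) \<partial>M) = (\<integral>\<omega>. u \<omega> \<bullet> ((\<integral>\<omega>. m \<omega> \<partial>M) *v v \<omega>) \<partial>M)" .
qed

lemma indep_centered:
  fixes u e :: "'w \<Rightarrow> real^'s"
  assumes IJ: "I \<inter> J = {}" and u: "u \<in> borel_measurable (hist I)" "\<And>i. integrable M (\<lambda>\<omega>. u \<omega> $ i)"
    and e: "e \<in> borel_measurable (hist J)" "\<And>i. integrable M (\<lambda>\<omega>. e \<omega> $ i)" "\<And>i. (\<integral>\<omega>. e \<omega> $ i \<partial>M) = 0"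
  shows "integrable M (\<lambda>\<omega>. u \<omega> \<bullet> e \<omega>)" "(\<integral>\<omega>. u \<omega> \<bullet> e \<omega> \<partial>M) = 0"
proof -
  have mu: "(\<lambda>\<omega>. u \<omega> $ i) \<in> borel_measurable (hist I)" for i using u(1) by measurable
  have me: "(\<lambda>\<omega>. e \<omega> $ i) \<in> borel_measurable (hist J)" for i using e(1) by measurable
  note p = indep_hist_mult[OF IJ mu me u(2) e(2)]
  show "integrable M (\<lambda>\<omega>. u \<omega> \<bullet> e \<omega>)" unfolding inner_vec_def using p by simp
  show "(\<integral>\<omega>. u \<omega> \<bullet> e \<omega> \<partial>M) = 0" unfolding inner_vec_def using p e(3) by simp
qed

end

text \<open>Independence within each group and independence between the groups combine into joint
  independence: a finite intersection is first regrouped by \<open>g\<close>, and each partial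
  intersection is an event of its group.\<close>

lemma (in prob_space) indep_sets_nested:
  assumes F: "indep_sets F J" and fin: "finite J"
    and E: "\<And>j. j \<in> J \<Longrightarrow> indep_sets E {i. g i = j}"
    and sub: "\<And>i. E i \<subseteq> F (g i)" and gJ: "\<And>i. g i \<in> J"
    and Int: "\<And>j. j \<in> J \<Longrightarrow> Int_stable (F j)"
  shows "indep_sets E UNIV"
proof (rule indep_setsI)
  show "E i \<subseteq> events" for i
    using F sub[of i] gJ[of i] unfolding indep_sets_def by blast
next
  fix A K assume K: "K \<noteq> {}" "finite K" and A: "\<forall>i\<in>K. A i \<in> E i"
  define T where "T = g ` K"
  have T: "finite T" "T \<noteq> {}" "T \<subseteq> J" using K gJ by (auto simp: T_def)
  have fib: "prob (\<Inter>i\<in>{i\<in>K. g i = j}. A i) = (\<Prod>i\<in>{i\<in>K. g i = j}. prob (A i))" if "j \<in> T" for j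
    using that T K A by (intro indep_setsD[OF E[of j]]) (auto simp: T_def)
  have mem: "(\<Inter>i\<in>{i\<in>K. g i = j}. A i) \<in> F j" if "j \<in> T" for j
  proof -
    have "finite S \<Longrightarrow> S \<noteq> {} \<Longrightarrow> S \<subseteq> {i\<in>K. g i = j} \<Longrightarrow> (\<Inter>i\<in>S. A i) \<in> F j" for S
    proof (induction S rule: finite_ne_induct)
      case (singleton i)
      then show ?case using A sub[of i] by auto
    next
      case (insert i S)
      then have "A i \<in> F j" using A sub[of i] by auto
      with insert show ?case using Int[of j] that T by (auto simp: Int_stable_def)
    qed
    from this[of "{i\<in>K. g i = j}"] show ?thesis using that K by (auto simp: T_def)
  qed
  have "prob (\<Inter>i\<in>K. A i) = prob (\<Inter>j\<in>T. \<Inter>i\<in>{i\<in>K. g i = j}. A i)"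
    by (rule arg_cong[where f = prob]) (auto simp: T_def)
  also have "\<dots> = (\<Prod>j\<in>T. prob (\<Inter>i\<in>{i\<in>K. g i = j}. A i))"
    using mem T by (intro indep_setsD[OF F]) auto
  also have "\<dots> = (\<Prod>j\<in>T. \<Prod>i\<in>{i\<in>K. g i = j}. prob (A i))"
    by (intro prod.cong refl fib)
  also have "\<dots> = (\<Prod>i\<in>K. prob (A i))"
    using K by (intro prod.group) (auto simp: T_def)
  finally show "prob (\<Inter>i\<in>K. A i) = (\<Prod>i\<in>K. prob (A i))" .
qed

section \<open>Noise sources and the closed loop\<close>

datatype 'i source = State_noise nat | Receiver_noise nat 'i | Control_channel nat | Attack_channel nat

primrec time :: "'i source \<Rightarrow> nat" where
  "time (State_noise k) = k"
| "time (Receiver_noise k i) = k"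
| "time (Control_channel k) = k"
| "time (Attack_channel k) = k"

primrec kind :: "'i source \<Rightarrow> nat" where
  "kind (State_noise k) = 0"
| "kind (Receiver_noise k i) = 1"
| "kind (Control_channel k) = 2"
| "kind (Attack_channel k) = 3"

text \<open>\<open>past k\<close> holds the randomness that determines the state at time k.
  \<open>present k\<close> adds the control channel of time k, which both players observe before
  acting, but neither the attack channel nor the disturbance of that time.\<close>

definition past :: "nat \<Rightarrow> 'i source set" where "past k = {s. time s < k}"
definition present :: "nat \<Rightarrow> 'i source set" where "present k = insert (Control_channel k) (past k)"
definition disturbances :: "nat \<Rightarrow> 'i source set" where
  "disturbances k = insert (State_noise k) (range (Receiver_noise k))"

lemma source_sets:
  "past k \<subseteq> present k" "present k \<subseteq> past (Suc k)" "disturbances k \<subseteq> past (Suc k)"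
  "Attack_channel k \<in> past (Suc k)" "Attack_channel k \<notin> present k"
  "Attack_channel k \<notin> disturbances k" "disturbances k \<inter> present k = {}"
  "Control_channel k \<notin> past k" "n \<le> k \<Longrightarrow> Control_channel n \<in> present k"
  by (auto simp: past_def present_def disturbances_def)

lemma (in prob_space) indep_sets_image:
  assumes "inj h" "indep_sets (\<lambda>k. E (h k)) UNIV"
  shows "indep_sets E (range h)"
  unfolding indep_sets_def
proof (intro conjI ballI allI impI)
  fix i assume "i \<in> range h"
  then show "E i \<subseteq> events" using assms(2) unfolding indep_sets_def by auto
next
  fix J A assume J: "J \<subseteq> range h" "J \<noteq> {}" "finite J" and A: "A \<in> Pi J E"
  define K where "K = h -` J"
  have JK: "J = h ` K" using J(1) by (auto simp: K_def)
  have K: "finite K" unfolding K_def by (rule finite_vimageI[OF J(3) assms(1)])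
  have K': "K \<noteq> {}" using J(2) JK by blast
  have "prob (\<Inter>k\<in>K. A (h k)) = (\<Prod>k\<in>K. prob (A (h k)))"
    using A JK by (intro indep_setsD[OF assms(2)] K K') auto
  then show "prob (\<Inter>j\<in>J. A j) = (\<Prod>j\<in>J. prob (A j))"
    unfolding JK using inj_on_subset[OF assms(1) subset_UNIV, of K] by (simp add: prod.reindex)
qed

locale game_noise =
  fixes M :: "'w measure" and W :: "real^'s^'s" and V :: "real^'r^'r" and N :: "(real^'ta^'r^'c^'l) measure"
    and w :: "nat \<Rightarrow> 'w \<Rightarrow> real^'s" and v :: "nat \<Rightarrow> 'c::finite \<Rightarrow> 'w \<Rightarrow> real^'r"
    and Hc :: "nat \<Rightarrow> 'w \<Rightarrow> real^'tc^'r^'c^'c" and Ha :: "nat \<Rightarrow> 'w \<Rightarrow> real^'ta^'r^'c^'l"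
  assumes game: "game_randomness M W V N w v Hc Ha"
begin

definition src :: "'c source \<Rightarrow> 'w set set" where
  "src s = (case s of State_noise k \<Rightarrow> {w k -` E \<inter> space M | E. E \<in> sets borel}
     | Receiver_noise k i \<Rightarrow> {v k i -` E \<inter> space M | E. E \<in> sets borel}
     | Control_channel k \<Rightarrow> {Hc k -` E \<inter> space M | E. E \<in> sets borel}
     | Attack_channel k \<Rightarrow> {Ha k -` E \<inter> space M | E. E \<in> sets borel})"

lemma game_facts:
  "prob_space M" "iid M w" "\<And>k. zero_mean_cov M (w k) W" "iid M (\<lambda>(k, i). v k i)"
  "\<And>k i. zero_mean_cov M (v k i) V" "iid M Hc" "iid M Ha" "\<And>k. distr M borel (Ha k) = N"
  "prob_space.indep_sets M ((!) [generated_events M w, generated_events M (\<lambda>(k, i). v k i),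
     generated_events M Hc, generated_events M Ha]) {..<4}"
  using game unfolding game_randomness_def by auto

text \<open>Each kind of source is an i.i.d. process, hence independent within itself; the four
  kinds are mutually independent by hypothesis. Nesting both statements makes all elementary sources
  jointly independent.\<close>

sublocale sources M src
proof -
  interpret prob_space M by (rule game_facts(1))
  let ?F = "(!) [generated_events M w, generated_events M (\<lambda>(k, i). v k i),
     generated_events M Hc, generated_events M Ha]"
  have gen: "Int_stable (generated_events M f)" for f :: "'x \<Rightarrow> 'w \<Rightarrow> 'y::topological_space"
  proof -
    have "sigma_algebra (space M) (generated_events M f)"
      unfolding generated_events_def by (rule sigma_algebra_sigma_sets) auto
    then interpret S: sigma_algebra "space M" "generated_events M f" .
    show ?thesis by (auto simp: Int_stable_def)
  qed
  have sw: "src \<circ> State_noise = (\<lambda>k. {w k -` E \<inter> space M | E. E \<in> sets borel})"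
    and sv: "src \<circ> (\<lambda>(k, i). Receiver_noise k i) = (\<lambda>p. {(case p of (k, i) \<Rightarrow> v k i) -` E \<inter> space M | E. E \<in> sets borel})"
    and sc: "src \<circ> Control_channel = (\<lambda>k. {Hc k -` E \<inter> space M | E. E \<in> sets borel})"
    and sa: "src \<circ> Attack_channel = (\<lambda>k. {Ha k -` E \<inter> space M | E. E \<in> sets borel})"
    by (auto simp: src_def fun_eq_iff)
  have "indep_sets src (range State_noise)"
    by (rule indep_sets_image)
       (use game_facts(2) sw in \<open>auto simp: iid_def indep_vars_def2 inj_def comp_def\<close>)
  moreover have "indep_sets src (range (\<lambda>(k, i). Receiver_noise k i))"
    by (rule indep_sets_image)
       (use game_facts(4) sv in \<open>auto simp: iid_def indep_vars_def2 inj_def comp_def\<close>)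
  moreover have "indep_sets src (range Control_channel)"
    by (rule indep_sets_image)
       (use game_facts(6) sc in \<open>auto simp: iid_def indep_vars_def2 inj_def comp_def\<close>)
  moreover have "indep_sets src (range Attack_channel)"
    by (rule indep_sets_image)
       (use game_facts(7) sa in \<open>auto simp: iid_def indep_vars_def2 inj_def comp_def\<close>)
  moreover have "{s :: 'c source. kind s = 0} = range State_noise"
      "{s :: 'c source. kind s = 1} = range (\<lambda>(k, i). Receiver_noise k i)"
    "{s :: 'c source. kind s = 2} = range Control_channel" "{s :: 'c source. kind s = 3} = range Attack_channel"
  proof -
    have "kind s = 0 \<longleftrightarrow> s \<in> range State_noise" "kind s = 1 \<longleftrightarrow> s \<in> range (\<lambda>(k, i). Receiver_noise k i)"
      "kind s = 2 \<longleftrightarrow> s \<in> range Control_channel" "kind s = 3 \<longleftrightarrow> s \<in> range Attack_channel" for s :: "'c source"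
      by (cases s; force)+
    then show "{s :: 'c source. kind s = 0} = range State_noise"
      "{s :: 'c source. kind s = 1} = range (\<lambda>(k, i). Receiver_noise k i)"
      "{s :: 'c source. kind s = 2} = range Control_channel" "{s :: 'c source. kind s = 3} = range Attack_channel"
      by auto
  qed
  ultimately have E: "indep_sets src {s. kind s = j}" if "j \<in> {..<4}" for j
    using that by (auto simp: lessThan_nat_numeral lessThan_Suc)
  have "indep_sets src UNIV"
  proof (rule indep_sets_nested[OF game_facts(9) _ E])
    fix s :: "'c source"
    show "src s \<subseteq> ?F (kind s)"
      by (cases s) (force simp: src_def generated_events_def intro!: sigma_sets.Basic)+
    show "kind s \<in> {..<4}" by (cases s) auto
  next
    fix j :: nat assume "j \<in> {..<4}"
    then show "Int_stable (?F j)"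
      using gen[of w] gen[of "\<lambda>(k, i). v k i"] gen[of Hc] gen[of Ha]
      by (auto simp: lessThan_nat_numeral lessThan_Suc)
  qed auto
  moreover have "Int_stable (src s)" for s
  proof -
    have stable: "Int_stable {f -` E \<inter> space M | E. E \<in> sets borel}" for f :: "'w \<Rightarrow> 'y::topological_space"
      unfolding Int_stable_def
    proof clarify
      fix E E' :: "'y set" assume "E \<in> sets borel" "E' \<in> sets borel"
      then show "\<exists>G. f -` E \<inter> space M \<inter> (f -` E' \<inter> space M) = f -` G \<inter> space M \<and> G \<in> sets borel"
        by (intro exI[of _ "E \<inter> E'"]) auto
    qed
    show ?thesis by (cases s) (simp_all add: src_def stable)
  qed
  ultimately show "sources M src" by unfold_locales
qed

lemma hist_basic:
  "State_noise k \<in> I \<Longrightarrow> w k \<in> borel_measurable (hist I)"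
  "Receiver_noise k i \<in> I \<Longrightarrow> v k i \<in> borel_measurable (hist I)"
  "Control_channel k \<in> I \<Longrightarrow> Hc k \<in> borel_measurable (hist I)"
  "Attack_channel k \<in> I \<Longrightarrow> Ha k \<in> borel_measurable (hist I)"
  by (rule measurableI; force simp: sets_hist src_def intro!: sigma_sets.Basic)+

end

lemma zero_mean_cov_facts:
  fixes X :: "'w \<Rightarrow> real^'n"
  assumes "zero_mean_cov M X C" and m: "X \<in> borel_measurable M"
  shows "sq_integrable M X" "integrable M (\<lambda>\<omega>. X \<omega> $ i)" "(\<integral>\<omega>. X \<omega> $ i \<partial>M) = 0"
    "(\<integral>\<omega>. wnorm2 Z (X \<omega>) \<partial>M) = (\<Sum>a\<in>UNIV. \<Sum>b\<in>UNIV. Z $ a $ b * C $ a $ b)"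
proof -
  have i: "integrable M (\<lambda>\<omega>. X \<omega> $ a * X \<omega> $ b)" "(\<integral>\<omega>. X \<omega> $ a * X \<omega> $ b \<partial>M) = C $ a $ b" for a b
    using assms(1) by (auto simp: zero_mean_cov_def)
  show "integrable M (\<lambda>\<omega>. X \<omega> $ i)" "(\<integral>\<omega>. X \<omega> $ i \<partial>M) = 0"
    using assms(1) by (auto simp: zero_mean_cov_def)
  have n: "(norm (X \<omega>))\<^sup>2 = (\<Sum>a\<in>UNIV. X \<omega> $ a * X \<omega> $ a)" for \<omega>
    by (simp add: power2_norm_eq_inner inner_vec_def)
  show "sq_integrable M X"
    unfolding sq_integrable_def n using i m by simp
  have wn: "wnorm2 Z (X \<omega>) = (\<Sum>a\<in>UNIV. \<Sum>b\<in>UNIV. Z $ a $ b * (X \<omega> $ a * X \<omega> $ b))" for \<omega>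
    by (simp add: wnorm2_def inner_vec_def matrix_vector_mult_def sum_distrib_left algebra_simps)
  show "(\<integral>\<omega>. wnorm2 Z (X \<omega>) \<partial>M) = (\<Sum>a\<in>UNIV. \<Sum>b\<in>UNIV. Z $ a $ b * C $ a $ b)"
    unfolding wn using i by simp
qed

lemma input_matrix_measurable [measurable]:
  assumes [measurable]: "f \<in> borel_measurable M"
  shows "(\<lambda>\<omega>. input_matrix B (f \<omega>)) \<in> borel_measurable M"
  unfolding input_matrix_def hconcat_def
  by (rule measurable_matI) (simp add: matrix_matrix_mult_def)

context game_noise
begin

definition disturbance :: "('c \<Rightarrow> real^'r^'s) \<Rightarrow> nat \<Rightarrow> 'w \<Rightarrow> real^'s" where
  "disturbance B k \<omega> = (\<Sum>i\<in>UNIV. B i *v v k i \<omega>) + w k \<omega>"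

text \<open>The expected Z-form of the disturbance; for symmetric Z it is the sum of tr (B_i^T Z B_i
  V) over the receivers plus tr (Z W). It is linear in Z, so it passes to limits of
  matrices.\<close>

definition noise_cost :: "('c \<Rightarrow> real^'r^'s) \<Rightarrow> real^'s^'s \<Rightarrow> real" where
  "noise_cost B Z = (\<Sum>i\<in>UNIV. \<Sum>a\<in>UNIV. \<Sum>b\<in>UNIV. (transpose (B i) ** (Z ** B i)) $ a $ b * V $ a $ b)
     + (\<Sum>a\<in>UNIV. \<Sum>b\<in>UNIV. Z $ a $ b * W $ a $ b)"

lemma noise_measurable: "w k \<in> borel_measurable M" "v k i \<in> borel_measurable M"
  "Hc k \<in> borel_measurable M" "Ha k \<in> borel_measurable M"
  using hist_measurable hist_basic by (metis UNIV_I)+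

lemmas w_facts = zero_mean_cov_facts[OF game_facts(3) noise_measurable(1)]
lemmas v_facts = zero_mean_cov_facts[OF game_facts(5) noise_measurable(2)]

lemma disturbance_measurable: "disturbance B k \<in> borel_measurable (hist (disturbances k))"
proof -
  have [measurable]: "w k \<in> borel_measurable (hist (disturbances k))" "v k i \<in> borel_measurable (hist (disturbances k))" for i
    by (auto intro!: hist_basic simp: disturbances_def)
  show ?thesis unfolding disturbance_def[abs_def] by measurable
qed

lemma Bv_centered: "integrable M (\<lambda>\<omega>. (Z *v v k i \<omega>) $ a)" "(\<integral>\<omega>. (Z *v v k i \<omega>) $ a \<partial>M) = 0"
  for Z :: "real^'r^'n"
  unfolding matrix_vector_mult_def using v_facts(2,3) by (auto intro!: Bochner_Integration.integrable_sum)

lemma disturbance_sq: "sq_integrable M (disturbance B k)"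
  unfolding disturbance_def[abs_def]
  by (intro sq_integrable_add sq_integrable_sum sq_integrable_matrix_mult w_facts v_facts) auto

lemma disturbance_centered:
  "integrable M (\<lambda>\<omega>. (Z *v disturbance B k \<omega>) $ a)" "(\<integral>\<omega>. (Z *v disturbance B k \<omega>) $ a \<partial>M) = 0"
proof -
  have 1: "integrable M (\<lambda>\<omega>. disturbance B k \<omega> $ b)" "(\<integral>\<omega>. disturbance B k \<omega> $ b \<partial>M) = 0" for b
    unfolding disturbance_def by (simp_all add: Bv_centered w_facts(2,3))
  show "integrable M (\<lambda>\<omega>. (Z *v disturbance B k \<omega>) $ a)" "(\<integral>\<omega>. (Z *v disturbance B k \<omega>) $ a \<partial>M) = 0"
    unfolding matrix_vector_mult_def using 1 by (auto intro!: Bochner_Integration.integrable_sum)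
qed

text \<open>The receivers are added one at a time: a new noise term is centred and independent of
  the partial sum, so its cross term vanishes.\<close>

lemma disturbance_cost:
  assumes sym: "transpose Z = Z"
  shows "(\<integral>\<omega>. wnorm2 Z (disturbance B k \<omega>) \<partial>M) = noise_cost B Z"
proof -
  define y where "y S \<omega> = (\<Sum>i\<in>S. B i *v v k i \<omega>) + w k \<omega>" for S \<omega>
  have ysq: "sq_integrable M (y S)" for S
    unfolding y_def[abs_def]
    by (intro sq_integrable_add sq_integrable_sum sq_integrable_matrix_mult w_facts v_facts) auto
  have ymeas: "y S \<in> borel_measurable (hist (insert (State_noise k) (Receiver_noise k ` S)))" for S
  proof -
    have [measurable]: "w k \<in> borel_measurable (hist (insert (State_noise k) (Receiver_noise k ` S)))" by (intro hist_basic) auto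
    show ?thesis unfolding y_def[abs_def]
      by (intro borel_measurable_add borel_measurable_sum measurable_matrix_vector_mult hist_basic) auto
  qed
  have "finite S \<Longrightarrow> (\<integral>\<omega>. wnorm2 Z (y S \<omega>) \<partial>M)
      = (\<Sum>i\<in>S. \<Sum>a\<in>UNIV. \<Sum>b\<in>UNIV. (transpose (B i) ** (Z ** B i)) $ a $ b * V $ a $ b)
     + (\<Sum>a\<in>UNIV. \<Sum>b\<in>UNIV. Z $ a $ b * W $ a $ b)" for S
  proof (induction S rule: finite_induct)
    case empty
    show ?case by (simp add: y_def w_facts)
  next
    case (insert i S)
    have yi: "y (insert i S) \<omega> = y S \<omega> + B i *v v k i \<omega>" for \<omega>
      using insert by (simp add: y_def algebra_simps)
    have wv: "wnorm2 Z (B i *v v k i \<omega>) = wnorm2 (transpose (B i) ** (Z ** B i)) (v k i \<omega>)" for \<omega>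
      unfolding wnorm2_def matrix_vector_mul_assoc[symmetric] inner_transpose_mult ..
    have disj: "insert (State_noise k) (Receiver_noise k ` S) \<inter> {Receiver_noise k i} = {}"
      using insert by auto
    have em: "(\<lambda>\<omega>. (Z ** B i) *v v k i \<omega>) \<in> borel_measurable (hist {Receiver_noise k i})"
      by (intro measurable_matrix_vector_mult hist_basic) auto
    note c = indep_centered[OF disj ymeas[of S] sq_integrable_component[OF ysq] em Bv_centered]
    have "(\<integral>\<omega>. wnorm2 Z (y (insert i S) \<omega>) \<partial>M) = (\<integral>\<omega>. wnorm2 Z (y S \<omega>) \<partial>M) + (\<integral>\<omega>. wnorm2 (transpose (B i) ** (Z ** B i)) (v k i \<omega>) \<partial>M)"
      unfolding yi wnorm2_add[OF sym] wv matrix_vector_mul_assoc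
      using c sq_integrable_wnorm2[OF ysq] sq_integrable_wnorm2[OF v_facts(1)] by simp
    then show ?case using insert by (simp add: v_facts)
  qed
  from this[of UNIV] show ?thesis by (simp add: y_def disturbance_def noise_cost_def)
qed

end

section \<open>The pathwise recursion of the closed loop\<close>

lemma information_cong: "(\<And>n. n \<le> k \<Longrightarrow> x n = y n) \<Longrightarrow> information x bc k = information y bc k"
  by (auto simp: information_def fun_eq_iff)

text \<open>Each update of \<open>traj\<close> changes only the newest time, so earlier entries are
  final. This is what lets the information inside the recursion be read off
  \<open>state\<close>.\<close>

lemma traj_eq_state: "n \<le> k \<Longrightarrow> traj A bc ba d x0 \<mu>c \<mu>a k n = state A bc ba d x0 \<mu>c \<mu>a n"
proof (induction k)
  case (Suc k)
  then show ?case
    by (cases "n = Suc k") (auto simp: state_def Let_def simp del: traj.simps(2) simp: traj.simps(2)[of _ _ _ _ _ _ _ k])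
qed (simp add: state_def)

lemma state_Suc:
  fixes A bc ba d x0 \<mu>c \<mu>a
  defines "x \<equiv> state A bc ba d x0 \<mu>c \<mu>a"
  shows "x (Suc k) = A *v x k + bc k *v actions \<mu>c k (information x bc k)
    + ba k *v actions \<mu>a k (information x bc k) + d k"
proof -
  have "information (traj A bc ba d x0 \<mu>c \<mu>a k) bc k = information x bc k"
    unfolding x_def by (intro information_cong traj_eq_state)
  then show ?thesis
    by (simp add: x_def state_def[of _ _ _ _ _ _ _ "Suc k"] Let_def state_def[of _ _ _ _ _ _ _ k])
qed

lemma state_0: "state A bc ba d x0 \<mu>c \<mu>a 0 = x0"
  by (simp add: state_def)

lemma measurable_actions:
  fixes \<mu> :: "'j::finite \<Rightarrow> ('s::finite, 'm::finite, 't::finite) policy"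
  assumes \<mu>: "\<mu> \<in> profiles" and I: "I \<in> K \<rightarrow>\<^sub>M Pi\<^sub>M {..k} (\<lambda>_. borel)"
  shows "(\<lambda>\<omega>. actions \<mu> k (I \<omega>)) \<in> borel_measurable K"
proof (rule measurable_vecI)
  fix p :: "'j \<times> 't"
  have "(\<lambda>\<omega>. \<mu> (fst p) k (I \<omega>)) \<in> borel_measurable K"
    using \<mu> unfolding profiles_def policies_def by (intro measurable_compose[OF I]) auto
  then show "(\<lambda>\<omega>. actions \<mu> k (I \<omega>) $ p) \<in> borel_measurable K"
    unfolding actions_def stack_def by simp
qed

section \<open>Averaging one step of the game\<close>

locale lq_game = game_noise M W V N w v Hc Ha +
  ric: bounded_riccati N "input_matrix B" A "block_diag Rc" "block_diag Ra"
    "distr M borel (\<lambda>\<omega>. input_matrix B (Hc 0 \<omega>))" Q \<rho> \<sigma> \<epsilon> C z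
  for M :: "'w measure" and W :: "real^'s^'s" and V :: "real^'r^'r" and N :: "(real^'ta^'r^'c^'l) measure"
    and w :: "nat \<Rightarrow> 'w \<Rightarrow> real^'s" and v :: "nat \<Rightarrow> 'c::finite \<Rightarrow> 'w \<Rightarrow> real^'r"
    and Hc :: "nat \<Rightarrow> 'w \<Rightarrow> real^'tc^'r^'c^'c" and Ha :: "nat \<Rightarrow> 'w \<Rightarrow> real^'ta^'r^'c^'l"
    and A :: "real^'s^'s" and B :: "'c \<Rightarrow> real^'r^'s" and Q :: "real^'s^'s"
    and Rc :: "'c \<Rightarrow> real^'tc^'tc" and Ra :: "'l \<Rightarrow> real^'ta^'ta" and \<rho> \<sigma> \<epsilon> C z :: real +
  fixes x0 :: "real^'s"
begin

definition "Bc k \<omega> = input_matrix B (Hc k \<omega>)"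
definition "Ba k \<omega> = input_matrix B (Ha k \<omega>)"
definition "D = disturbance B"

definition X where
  "X \<mu>c \<mu>a k \<omega> = state A (\<lambda>n. Bc n \<omega>) (\<lambda>n. Ba n \<omega>) (\<lambda>n. D n \<omega>) x0 \<mu>c \<mu>a k"
definition info where
  "info \<mu>c \<mu>a k \<omega> = information (\<lambda>n. X \<mu>c \<mu>a n \<omega>) (\<lambda>n. Bc n \<omega>) k"
definition U where "U \<mu>c \<mu>a k \<omega> = actions \<mu>c k (info \<mu>c \<mu>a k \<omega>)"
definition Y where "Y \<mu>c \<mu>a k \<omega> = actions \<mu>a k (info \<mu>c \<mu>a k \<omega>)"

definition cost where
  "cost \<mu>c \<mu>a k \<omega> = wnorm2 Q (X \<mu>c \<mu>a (Suc k) \<omega>) + wnorm2 (block_diag Rc) (U \<mu>c \<mu>a k \<omega>)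
     - wnorm2 (block_diag Ra) (Y \<mu>c \<mu>a k \<omega>)"

definition total where
  "total \<mu>c \<mu>a = running_total (\<lambda>k. ext_expectation M (cost \<mu>c \<mu>a k))"

abbreviation "J \<equiv> average_cost M A B Q Rc Ra x0 w v Hc Ha"

lemma J_eq: "J \<mu>c \<mu>a = limsup (\<lambda>K. total \<mu>c \<mu>a K / ereal (real K))"
  unfolding average_cost_def total_def cost_def stage_cost_def Let_def U_def Y_def info_def X_def Bc_def Ba_def D_def
    disturbance_def by (rule refl)

lemma X_0: "X \<mu>c \<mu>a 0 \<omega> = x0"
  by (simp add: X_def state_0)

lemma X_Suc: "X \<mu>c \<mu>a (Suc k) \<omega>
  = (A *v X \<mu>c \<mu>a k \<omega> + Bc k \<omega> *v U \<mu>c \<mu>a k \<omega>) + Ba k \<omega> *v Y \<mu>c \<mu>a k \<omega> + D k \<omega>"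
  unfolding X_def U_def Y_def info_def by (rule state_Suc)

lemma hist_Bc: "Control_channel k \<in> I \<Longrightarrow> Bc k \<in> borel_measurable (hist I)"
  and hist_Ba: "Attack_channel k \<in> I \<Longrightarrow> Ba k \<in> borel_measurable (hist I)"
  unfolding Bc_def[abs_def] Ba_def[abs_def] using hist_basic(3,4) by (auto intro!: input_matrix_measurable)

lemma hist_D: "D k \<in> borel_measurable (hist (disturbances k))"
  unfolding D_def by (rule disturbance_measurable)

lemma borel_measurable_info:
  assumes "\<And>n. n \<le> k \<Longrightarrow> X \<mu>c \<mu>a n \<in> borel_measurable (hist (past n))"
  shows "info \<mu>c \<mu>a k \<in> hist (present k) \<rightarrow>\<^sub>M Pi\<^sub>M {..k} (\<lambda>_. borel)"
  unfolding info_def[abs_def] information_def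
proof (rule measurable_restrict)
  fix n assume n: "n \<in> {..k}"
  then have sub: "past n \<subseteq> present k" by (auto simp: past_def present_def)
  have "X \<mu>c \<mu>a n \<in> borel_measurable (hist (present k))"
    using assms n sub by (auto intro: hist_mono)
  moreover have "Bc n \<in> borel_measurable (hist (present k))"
    using n by (intro hist_Bc source_sets) auto
  ultimately show "(\<lambda>\<omega>. (X \<mu>c \<mu>a n \<omega>, Bc n \<omega>)) \<in> borel_measurable (hist (present k))"
    by (rule borel_measurable_Pair)
qed

lemma hist_step:
  assumes "p \<in> borel_measurable (hist (present k))" "a \<in> borel_measurable (hist (present k))"
  shows "(\<lambda>\<omega>. p \<omega> + Ba k \<omega> *v a \<omega> + D k \<omega>) \<in> borel_measurable (hist (past (Suc k)))"
  by (intro borel_measurable_add measurable_matrix_vector_mult hist_mono[OF hist_D source_sets(3)]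
      hist_Ba[OF source_sets(4)] hist_mono[OF assms(1) source_sets(2)] hist_mono[OF assms(2) source_sets(2)])

lemma hist_X:
  assumes \<mu>: "\<mu>c \<in> profiles" "\<mu>a \<in> profiles"
  shows "X \<mu>c \<mu>a k \<in> borel_measurable (hist (past k))"
\<comment> \<open>The actions depend on all earlier states through the information, so the induction
  hypothesis is needed at every earlier time.\<close>
proof (induction k rule: less_induct)
  case (less k)
  show ?case
  proof (cases k)
    case 0
    then show ?thesis by (simp add: X_0[abs_def])
  next
    case (Suc n)
    have info: "info \<mu>c \<mu>a n \<in> hist (present n) \<rightarrow>\<^sub>M Pi\<^sub>M {..n} (\<lambda>_. borel)"
      using less Suc by (intro borel_measurable_info) auto
    have "U \<mu>c \<mu>a n \<in> borel_measurable (hist (present n))" "Y \<mu>c \<mu>a n \<in> borel_measurable (hist (present n))"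
      unfolding U_def[abs_def] Y_def[abs_def] by (intro measurable_actions \<mu> info)+
    moreover have "X \<mu>c \<mu>a n \<in> borel_measurable (hist (present n))"
      using less Suc by (intro hist_mono[OF _ source_sets(1)]) auto
    moreover have "Bc n \<in> borel_measurable (hist (present n))"
      by (intro hist_Bc source_sets) simp
    ultimately show ?thesis
      unfolding Suc X_Suc[abs_def] by (intro hist_step borel_measurable_add measurable_matrix_vector_mult) auto
  qed
qed

lemma hist_present:
  assumes \<mu>: "\<mu>c \<in> profiles" "\<mu>a \<in> profiles"
  shows "X \<mu>c \<mu>a k \<in> borel_measurable (hist (present k))" "Bc k \<in> borel_measurable (hist (present k))"
    "U \<mu>c \<mu>a k \<in> borel_measurable (hist (present k))" "Y \<mu>c \<mu>a k \<in> borel_measurable (hist (present k))"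
proof -
  have info: "info \<mu>c \<mu>a k \<in> hist (present k) \<rightarrow>\<^sub>M Pi\<^sub>M {..k} (\<lambda>_. borel)"
    by (intro borel_measurable_info hist_X \<mu>)
  show "U \<mu>c \<mu>a k \<in> borel_measurable (hist (present k))" "Y \<mu>c \<mu>a k \<in> borel_measurable (hist (present k))"
    unfolding U_def[abs_def] Y_def[abs_def] by (intro measurable_actions \<mu> info)+
  show "X \<mu>c \<mu>a k \<in> borel_measurable (hist (present k))" by (rule hist_mono[OF hist_X[OF \<mu>] source_sets(1)])
  show "Bc k \<in> borel_measurable (hist (present k))"
    by (intro hist_Bc source_sets) simp
qed

lemmas measurable_M = hist_present[THEN hist_measurable]

lemma N_eq: "N = distr M borel (Ha k)"
  using game_facts(8) by simp

lemma Ba_integral: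
  fixes f :: "real^('l \<times> 'ta)^'s \<Rightarrow> 'b::{banach,second_countable_topology}"
  assumes [measurable]: "f \<in> borel_measurable borel" and i: "integrable N (\<lambda>h. f (input_matrix B h))"
  shows "integrable M (\<lambda>\<omega>. f (Ba k \<omega>))" "(\<integral>\<omega>. f (Ba k \<omega>) \<partial>M) = (\<integral>h. f (input_matrix B h) \<partial>N)"
proof -
  have m: "Ha k \<in> borel_measurable M" by (rule noise_measurable)
  have g: "(\<lambda>h. f (input_matrix B h)) \<in> borel_measurable borel" by measurable
  show "integrable M (\<lambda>\<omega>. f (Ba k \<omega>))"
    using i unfolding N_eq[of k] integrable_distr_eq[OF m g] by (simp add: Ba_def)
  show "(\<integral>\<omega>. f (Ba k \<omega>) \<partial>M) = (\<integral>h. f (input_matrix B h) \<partial>N)"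
    unfolding N_eq[of k] integral_distr[OF m g] by (simp add: Ba_def)
qed

text \<open>\<open>p\<close> is the next state before attack and noise. Both \<open>p\<close> and
  \<open>a\<close> are determined by the present, so the attack channel may be integrated out under
  its law \<open>N\<close>, and the centred independent disturbance only adds
  \<open>noise_cost\<close>.\<close>

lemma one_step:
  assumes p: "p \<in> borel_measurable (hist (present k))" "sq_integrable M p"
    and a: "a \<in> borel_measurable (hist (present k))" "sq_integrable M a"
  shows "sq_integrable M (\<lambda>\<omega>. Ba k \<omega> *v a \<omega>)"
    and "sq_integrable M (\<lambda>\<omega>. p \<omega> + Ba k \<omega> *v a \<omega> + D k \<omega>)"
    and "transpose Z = Z \<Longrightarrow> integrable M (\<lambda>\<omega>. \<integral>h. wnorm2 Z (p \<omega> + input_matrix B h *v a \<omega>) \<partial>N)"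
    and "transpose Z = Z \<Longrightarrow> (\<integral>\<omega>. wnorm2 Z (p \<omega> + Ba k \<omega> *v a \<omega> + D k \<omega>) \<partial>M)
       = (\<integral>\<omega>. (\<integral>h. wnorm2 Z (p \<omega> + input_matrix B h *v a \<omega>) \<partial>N) \<partial>M) + noise_cost B Z"
proof -
  define q where "q \<omega> = Ba k \<omega> *v a \<omega>" for \<omega>
  have disj: "{Attack_channel k} \<inter> present k = {}" using source_sets(5) by auto
  have BaM: "Ba k \<in> borel_measurable (hist {Attack_channel k})" by (intro hist_Ba) simp
  have gram: "wnorm2 K (q \<omega>) = a \<omega> \<bullet> ((transpose (Ba k \<omega>) ** (K ** Ba k \<omega>)) *v a \<omega>)" for K \<omega>
    unfolding q_def wnorm2_def matrix_vector_mul_assoc[symmetric] inner_transpose_mult ..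
  have gm: "(\<lambda>\<omega>. transpose (Ba k \<omega>) ** (K ** Ba k \<omega>)) \<in> borel_measurable (hist {Attack_channel k})" for K
    using BaM by measurable
  have gi: "integrable M (\<lambda>\<omega>. transpose (Ba k \<omega>) ** (K ** Ba k \<omega>))"
    and ge: "(\<integral>\<omega>. transpose (Ba k \<omega>) ** (K ** Ba k \<omega>) \<partial>M) = ric.second K" for K
    using Ba_integral[of "\<lambda>b. transpose b ** (K ** b)" k] ric.integrable_second[of K]
    by (simp_all add: ric.second_def)
  note q2 = indep_matrix_form[OF disj gm gi a a, folded gram, unfolded ge, folded wnorm2_def]
  have qm: "q \<in> borel_measurable (hist (past (Suc k)))"
    unfolding q_def[abs_def]
    by (intro measurable_matrix_vector_mult hist_Ba[OF source_sets(4)] hist_mono[OF a(1) source_sets(2)])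
  \<comment> \<open>With the identity as weight the Gram form is |q|^2, so its integrability is the
    claim.\<close>
  have qsq: "sq_integrable M q"
    using q2(1)[of "mat 1"] hist_measurable[OF qm]
    by (simp add: sq_integrable_def wnorm2_def power2_norm_eq_inner)
  then show "sq_integrable M (\<lambda>\<omega>. Ba k \<omega> *v a \<omega>)" by (simp add: q_def[abs_def])
  have Dsq: "sq_integrable M (D k)" unfolding D_def by (rule disturbance_sq)
  have rsq: "sq_integrable M (\<lambda>\<omega>. p \<omega> + q \<omega>)" by (intro sq_integrable_add p qsq)
  from sq_integrable_add[OF rsq Dsq]
  show "sq_integrable M (\<lambda>\<omega>. p \<omega> + Ba k \<omega> *v a \<omega> + D k \<omega>)" by (simp add: q_def)
  assume sym: "transpose Z = Z"
  have inner: "(\<integral>h. wnorm2 Z (p \<omega> + input_matrix B h *v a \<omega>) \<partial>N)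
    = wnorm2 Z (p \<omega>) + 2 * ((Z *v p \<omega>) \<bullet> (ric.mean *v a \<omega>)) + wnorm2 (ric.second Z) (a \<omega>)" for \<omega>
  proof -
    have "p \<omega> \<bullet> (Z *v (ric.mean *v a \<omega>)) = (Z *v p \<omega>) \<bullet> (ric.mean *v a \<omega>)"
      by (simp only: inner_matrix_adjoint sym)
    then show ?thesis unfolding ric.integral_expand(2)[OF sym] by simp
  qed
  have Zp: "(\<lambda>\<omega>. Z *v p \<omega>) \<in> borel_measurable (hist (present k))" "sq_integrable M (\<lambda>\<omega>. Z *v p \<omega>)"
    using p sq_integrable_matrix_mult by (auto intro: measurable_matrix_vector_mult)
  have Bi: "integrable M (Ba k)" and Be: "(\<integral>\<omega>. Ba k \<omega> \<partial>M) = ric.mean"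
    using Ba_integral[of "\<lambda>b. b" k] ric.integrable_F by (simp_all add: ric.mean_def)
  note pq = indep_matrix_form[OF disj BaM Bi Zp a, unfolded Be, folded q_def]
  have ma: "sq_integrable M (\<lambda>\<omega>. ric.mean *v a \<omega>)" by (rule sq_integrable_matrix_mult[OF a(2)])
  have im: "integrable M (\<lambda>\<omega>. (Z *v p \<omega>) \<bullet> (ric.mean *v a \<omega>))"
    unfolding inner_vec_def using sq_integrable_prod[OF Zp(2) ma] by simp
  show "integrable M (\<lambda>\<omega>. \<integral>h. wnorm2 Z (p \<omega> + input_matrix B h *v a \<omega>) \<partial>N)"
    unfolding inner using sq_integrable_wnorm2[OF p(2)] sq_integrable_wnorm2[OF a(2)] im by simp
  have disjD: "insert (Attack_channel k) (present k) \<inter> disturbances k = {}"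
    using source_sets(6,7) by fastforce
  have rm: "(\<lambda>\<omega>. p \<omega> + q \<omega>) \<in> borel_measurable (hist (insert (Attack_channel k) (present k)))"
    unfolding q_def
    by (intro borel_measurable_add measurable_matrix_vector_mult hist_Ba hist_mono[OF p(1)] hist_mono[OF a(1)]) auto
  have Dm: "(\<lambda>\<omega>. Z *v D k \<omega>) \<in> borel_measurable (hist (disturbances k))"
    using hist_D by (intro measurable_matrix_vector_mult) auto
  note rD = indep_centered[OF disjD rm sq_integrable_component[OF rsq] Dm, unfolded D_def, OF disturbance_centered, folded D_def]
  have split: "wnorm2 Z (p \<omega> + Ba k \<omega> *v a \<omega> + D k \<omega>)
    = wnorm2 Z (p \<omega>) + 2 * ((Z *v p \<omega>) \<bullet> q \<omega>) + wnorm2 Z (q \<omega>) + 2 * ((p \<omega> + q \<omega>) \<bullet> (Z *v D k \<omega>)) + wnorm2 Z (D k \<omega>)" for \<omega>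
  proof -
    have "p \<omega> \<bullet> (Z *v q \<omega>) = (Z *v p \<omega>) \<bullet> q \<omega>" by (simp only: inner_matrix_adjoint sym)
    then show ?thesis unfolding q_def[symmetric] wnorm2_add[OF sym] by simp
  qed
  show "(\<integral>\<omega>. wnorm2 Z (p \<omega> + Ba k \<omega> *v a \<omega> + D k \<omega>) \<partial>M)
       = (\<integral>\<omega>. (\<integral>h. wnorm2 Z (p \<omega> + input_matrix B h *v a \<omega>) \<partial>N) \<partial>M) + noise_cost B Z"
    unfolding split inner
    using sq_integrable_wnorm2[OF p(2)] sq_integrable_wnorm2[OF a(2)] sq_integrable_wnorm2[OF qsq]
      sq_integrable_wnorm2[OF Dsq] im pq q2 rD disturbance_cost[OF sym, of B k, folded D_def]
    by simp
qed

lemma noise_cost_nonneg: "transpose Z = Z \<Longrightarrow> (\<And>x. 0 \<le> wnorm2 Z x) \<Longrightarrow> 0 \<le> noise_cost B Z"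
  using disturbance_cost[of Z B 0] by (metis Bochner_Integration.integral_nonneg)

text \<open>With \<open>Z = Q\<close> the left side is the expected stage cost; with a Riccati
  matrix it is that cost plus the weight Z - Q of the next state, the form that telescopes.
  \<open>a\<close> need not be the attack actually played, so truncations of it may be
  inserted.\<close>

lemma cost_average:
  assumes p: "p \<in> borel_measurable (hist (present k))" "sq_integrable M p"
    and u: "u \<in> borel_measurable (hist (present k))" "sq_integrable M u"
    and x: "\<And>\<omega>. p \<omega> = A *v x \<omega> + Bc k \<omega> *v u \<omega>"
    and a: "a \<in> borel_measurable (hist (present k))" "sq_integrable M a"
    and sym: "transpose Z = Z"
  shows "integrable M (\<lambda>\<omega>. wnorm2 Z (p \<omega> + Ba k \<omega> *v a \<omega> + D k \<omega>) + wnorm2 (block_diag Rc) (u \<omega>) - wnorm2 (block_diag Ra) (a \<omega>))"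
    and "integrable M (\<lambda>\<omega>. ric.payoff Z (Bc k \<omega>) (x \<omega>) (u \<omega>) (a \<omega>))"
    and "(\<integral>\<omega>. wnorm2 Z (p \<omega> + Ba k \<omega> *v a \<omega> + D k \<omega>) + wnorm2 (block_diag Rc) (u \<omega>) - wnorm2 (block_diag Ra) (a \<omega>) \<partial>M)
       = (\<integral>\<omega>. ric.payoff Z (Bc k \<omega>) (x \<omega>) (u \<omega>) (a \<omega>) \<partial>M) + noise_cost B Z"
proof -
  note s = one_step[OF p a]
  note i = sq_integrable_wnorm2[OF s(2), of Z] sq_integrable_wnorm2[OF u(2), of "block_diag Rc"]
    sq_integrable_wnorm2[OF a(2), of "block_diag Ra"]
  show "integrable M (\<lambda>\<omega>. wnorm2 Z (p \<omega> + Ba k \<omega> *v a \<omega> + D k \<omega>) + wnorm2 (block_diag Rc) (u \<omega>) - wnorm2 (block_diag Ra) (a \<omega>))"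
    using i by simp
  show "integrable M (\<lambda>\<omega>. ric.payoff Z (Bc k \<omega>) (x \<omega>) (u \<omega>) (a \<omega>))"
    unfolding ric.payoff_def x[symmetric] using s(3)[OF sym] i by simp
  show "(\<integral>\<omega>. wnorm2 Z (p \<omega> + Ba k \<omega> *v a \<omega> + D k \<omega>) + wnorm2 (block_diag Rc) (u \<omega>) - wnorm2 (block_diag Ra) (a \<omega>) \<partial>M)
       = (\<integral>\<omega>. ric.payoff Z (Bc k \<omega>) (x \<omega>) (u \<omega>) (a \<omega>) \<partial>M) + noise_cost B Z"
    unfolding ric.payoff_def x[symmetric] using s(3,4)[OF sym] i by simp
qed

end

section \<open>The upper bound\<close>

context lq_game
begin

text \<open>The state before time k is independent of the control matrix at k, whose law does not
  depend on k. So \<open>G\<close> may be averaged separately, which turns the stage value into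
  \<open>P\<close>.\<close>

lemma value_average:
  assumes Z: "ric.admissible Z" and x: "x \<in> borel_measurable (hist (past k))" "sq_integrable M x"
  shows "integrable M (\<lambda>\<omega>. wnorm2 (ric.G Z (Bc k \<omega>)) (x \<omega>))"
    and "(\<integral>\<omega>. wnorm2 (ric.G Z (Bc k \<omega>)) (x \<omega>) \<partial>M) = (\<integral>\<omega>. wnorm2 (ric.P Z) (x \<omega>) \<partial>M)"
proof -
  have m: "Bc n \<in> borel_measurable M" for n
    using hist_measurable[OF hist_Bc[of n UNIV]] by simp
  have law: "distr M borel (Bc k) = distr M borel (\<lambda>\<omega>. input_matrix B (Hc 0 \<omega>))"
  proof -
    have i: "input_matrix B \<in> borel_measurable borel" by measurable
    have "distr M borel (Bc n) = distr (distr M borel (Hc n)) borel (input_matrix B)" for n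
      by (subst distr_distr[OF i noise_measurable(3)]) (simp add: Bc_def[abs_def] comp_def)
    moreover have "distr M borel (Hc k) = distr M borel (Hc 0)" using game_facts(6) by (auto simp: iid_def)
    ultimately have "distr M borel (Bc k) = distr M borel (Bc 0)" by simp
    then show ?thesis unfolding Bc_def[abs_def] .
  qed
  have G: "ric.G Z \<in> borel_measurable borel" by (rule ric.measurable_G[OF Z])
  have gi: "integrable M (\<lambda>\<omega>. ric.G Z (Bc k \<omega>))"
    using ric.integrable_G[OF Z] unfolding law[symmetric] integrable_distr_eq[OF m G] .
  have ge: "(\<integral>\<omega>. ric.G Z (Bc k \<omega>) \<partial>M) = (\<integral>b. ric.G Z b \<partial>distr M borel (\<lambda>\<omega>. input_matrix B (Hc 0 \<omega>)))"
    unfolding law[symmetric] integral_distr[OF m G] ..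
  have gm: "(\<lambda>\<omega>. ric.G Z (Bc k \<omega>)) \<in> borel_measurable (hist {Control_channel k})"
    by (rule measurable_compose[OF hist_Bc G]) simp
  have disj: "{Control_channel k} \<inter> past k = {}" using source_sets(8) by auto
  note q = indep_matrix_form[OF disj gm gi x x]
  show "integrable M (\<lambda>\<omega>. wnorm2 (ric.G Z (Bc k \<omega>)) (x \<omega>))" using q(1) by (simp add: wnorm2_def)
  show "(\<integral>\<omega>. wnorm2 (ric.G Z (Bc k \<omega>)) (x \<omega>) \<partial>M) = (\<integral>\<omega>. wnorm2 (ric.P Z) (x \<omega>) \<partial>M)"
    unfolding ric.wnorm2_P_mean using q(2)[unfolded ge] by (simp add: wnorm2_def)
qed

end

text \<open>All agents have the same information, so a gain for the stacked action is realised by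
  letting agent \<open>j\<close> play its own block of rows.\<close>

definition feedback :: "(nat \<Rightarrow> real^'m^'s \<Rightarrow> real^'s^('j::finite \<times> 't)) \<Rightarrow> 'j \<Rightarrow> ('s::finite, 'm::finite, 't::finite) policy" where
  "feedback K j k I = (\<chi> t. (K k (snd (I k)) *v fst (I k)) $ (j, t))"

lemma feedback_profile:
  fixes K :: "nat \<Rightarrow> real^'m::finite^'s::finite \<Rightarrow> real^'s^('j::finite \<times> 't::finite)"
  assumes K: "\<And>k. K k \<in> borel_measurable borel"
  shows "feedback K \<in> profiles"
  unfolding profiles_def policies_def
proof (intro CollectI allI)
  fix j and k :: nat
  have c: "(\<lambda>I. I k) \<in> Pi\<^sub>M {..k} (\<lambda>_. borel :: ((real^'s) \<times> (real^'m^'s)) measure) \<rightarrow>\<^sub>M borel"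
    by (rule measurable_component_singleton) simp
  have fs: "(fst :: (real^'s) \<times> (real^'m^'s) \<Rightarrow> _) \<in> borel_measurable borel" "(snd :: (real^'s) \<times> (real^'m^'s) \<Rightarrow> _) \<in> borel_measurable borel"
    by (intro borel_measurable_continuous_onI continuous_intros)+
  have "(\<lambda>I. K k (snd (I k)) *v fst (I k)) \<in> borel_measurable (Pi\<^sub>M {..k} (\<lambda>_. borel))"
    by (intro measurable_matrix_vector_mult measurable_compose[OF measurable_compose[OF c fs(2)] K] measurable_compose[OF c fs(1)])
  then show "feedback K j k \<in> borel_measurable (Pi\<^sub>M {..k} (\<lambda>_. borel))"
    unfolding feedback_def[abs_def] by (intro measurable_vecI) simp
qed

lemma actions_feedback: "actions (feedback K) k I = K k (snd (I k)) *v fst (I k)"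
  by (simp add: actions_def stack_def feedback_def vec_eq_iff)

lemma information_self: "information x bc k k = (x k, bc k)"
  by (simp add: information_def)

text \<open>Truncating to 0 outside growing balls makes the squared norms increase to that of
  \<open>y\<close>; a common bound on their integrals suffices by monotone convergence.\<close>

lemma sq_integrable_monotone_truncation:
  fixes y :: "'w \<Rightarrow> real^'n"
  assumes y: "y \<in> borel_measurable M"
    and i: "\<And>n. sq_integrable M (\<lambda>\<omega>. if norm (y \<omega>) \<le> real n then y \<omega> else 0)"
    and b: "\<And>n. (\<integral>\<omega>. (norm (if norm (y \<omega>) \<le> real n then y \<omega> else 0))\<^sup>2 \<partial>M) \<le> c"
  shows "sq_integrable M y"
  unfolding sq_integrable_def
proof
  define f where "f n \<omega> = (norm (if norm (y \<omega>) \<le> real n then y \<omega> else 0))\<^sup>2" for n \<omega>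
  have int: "integrable M (f n)" for n using i[of n] by (simp add: sq_integrable_def f_def[abs_def])
  have mono: "f n \<omega> \<le> f m \<omega>" if "n \<le> m" for n m \<omega> using that by (auto simp: f_def)
  have "incseq (\<lambda>n. \<integral>\<omega>. f n \<omega> \<partial>M)"
    by (intro monoI integral_mono int mono)
  then obtain L where L: "(\<lambda>n. \<integral>\<omega>. f n \<omega> \<partial>M) \<longlonglongrightarrow> L"
    using incseq_convergent b unfolding f_def by blast
  show "integrable M (\<lambda>\<omega>. (norm (y \<omega>))\<^sup>2)"
  proof (rule integrable_monotone_convergence[OF int _ _ L])
    show "AE \<omega> in M. mono (\<lambda>n. f n \<omega>)" using mono by (intro AE_I2 monoI)
    show "AE \<omega> in M. (\<lambda>n. f n \<omega>) \<longlonglongrightarrow> (norm (y \<omega>))\<^sup>2"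
    proof (intro AE_I2)
      fix \<omega>
      obtain n where "norm (y \<omega>) \<le> real n" using real_arch_simple by blast
      then have "\<forall>\<^sub>F m in sequentially. f m \<omega> = (norm (y \<omega>))\<^sup>2"
        by (intro eventually_sequentiallyI[of n]) (auto simp: f_def)
      then show "(\<lambda>n. f n \<omega>) \<longlonglongrightarrow> (norm (y \<omega>))\<^sup>2" by (rule tendsto_eventually)
    qed
  qed (use y in measurable)
qed (fact y)

context lq_game
begin

definition ctrl where "ctrl Z = feedback (\<lambda>_. ric.Kc Z)"
definition att where "att m = feedback (\<lambda>k. ric.Ka (ric.iter (m k)))"

lemma U_ctrl: "U (ctrl Z) \<mu>a k \<omega> = ric.Kc Z (Bc k \<omega>) *v X (ctrl Z) \<mu>a k \<omega>"
  unfolding U_def ctrl_def actions_feedback info_def information_self by simp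

lemma Y_att: "Y \<mu>c (att m) k \<omega> = ric.Ka (ric.iter (m k)) (Bc k \<omega>) *v X \<mu>c (att m) k \<omega>"
  unfolding Y_def att_def actions_feedback info_def information_self by simp

lemma ctrl_profile: "ric.admissible Z \<Longrightarrow> ctrl Z \<in> profiles"
  unfolding ctrl_def by (intro feedback_profile ric.measurable_Kc)

lemma att_profile: "att m \<in> profiles"
  unfolding att_def by (intro feedback_profile ric.measurable_Ka ric.iter_admissible)

lemma cost_measurable:
  assumes "\<mu>c \<in> profiles" "\<mu>a \<in> profiles"
  shows "cost \<mu>c \<mu>a k \<in> borel_measurable M"
proof -
  have [measurable]: "X \<mu>c \<mu>a (Suc k) \<in> borel_measurable M" "U \<mu>c \<mu>a k \<in> borel_measurable M" "Y \<mu>c \<mu>a k \<in> borel_measurable M"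
    using measurable_M[OF assms] by auto
  show ?thesis unfolding cost_def[abs_def] by measurable
qed

text \<open>An attack that is not square integrable makes the expected stage cost \<open>-\<infinity>\<close>: this is seen by
  truncating it and using the coercivity of the payoff in the attack.\<close>

lemma upper_step:
  fixes Z \<mu>a
  defines "x \<equiv> X (ctrl Z) \<mu>a" and "c \<equiv> \<lambda>k. ext_expectation M (cost (ctrl Z) \<mu>a k)"
  assumes Z: "ric.admissible Z" and super: "\<And>x. wnorm2 (ric.P Z) x \<le> wnorm2 (Z - Q) x"
    and QZ: "\<And>x. wnorm2 Q x \<le> wnorm2 Z x"
    and \<mu>a: "\<mu>a \<in> profiles" and xk: "sq_integrable M (x k)"
  shows "c k = - \<infinity> \<or> (sq_integrable M (x (Suc k)) \<and>
    (\<exists>r. c k = ereal r \<and> r + (\<integral>\<omega>. wnorm2 (Z - Q) (x (Suc k) \<omega>) \<partial>M)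
       \<le> (\<integral>\<omega>. wnorm2 (Z - Q) (x k \<omega>) \<partial>M) + noise_cost B Z))"
proof (cases "(\<integral>\<^sup>+\<omega>. ennreal (- cost (ctrl Z) \<mu>a k \<omega>) \<partial>M) = \<infinity>")
  \<comment> \<open>An infinite negative part is charged as -infinity whatever the positive part
    is.\<close>
  case True
  then show ?thesis by (simp add: c_def ext_expectation_def)
next
  case False
  define f u y p where "f = cost (ctrl Z) \<mu>a k" and "u = U (ctrl Z) \<mu>a k" and "y = Y (ctrl Z) \<mu>a k"
    and "p = (\<lambda>\<omega>. A *v x k \<omega> + Bc k \<omega> *v u \<omega>)"
  note prof = ctrl_profile[OF Z] \<mu>a
  note h = hist_present[OF prof, of k, folded x_def u_def y_def]
  note m = measurable_M[OF prof, of k, folded x_def u_def y_def]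
  have symZ: "transpose Z = Z" by (rule ric.admissible_sym[OF Z])
  have u: "u \<omega> = ric.Kc Z (Bc k \<omega>) *v x k \<omega>" for \<omega> unfolding u_def x_def by (rule U_ctrl)
  obtain d where d: "\<And>b x. (norm (ric.Kc Z b *v x))\<^sup>2 \<le> d * (norm x)\<^sup>2"
    "\<And>b x. (norm (b *v (ric.Kc Z b *v x)))\<^sup>2 \<le> d * (norm x)\<^sup>2"
    using ric.gains_bounded[OF Z] by metis
  have usq: "sq_integrable M u"
    by (rule sq_integrable_bound[OF xk m(3), of d]) (simp add: u d)
  have "sq_integrable M (\<lambda>\<omega>. Bc k \<omega> *v u \<omega>)"
    by (rule sq_integrable_bound[OF xk measurable_matrix_vector_mult[OF m(2,3)], of d]) (simp add: u d)
  then have psq: "sq_integrable M p"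
    unfolding p_def by (intro sq_integrable_add sq_integrable_matrix_mult xk)
  have ph: "p \<in> borel_measurable (hist (present k))"
    unfolding p_def by (intro borel_measurable_add measurable_matrix_vector_mult h) auto
  have px: "p \<omega> = A *v x k \<omega> + Bc k \<omega> *v u \<omega>" for \<omega> by (simp add: p_def)
  have xs: "x (Suc k) \<omega> = p \<omega> + Ba k \<omega> *v y \<omega> + D k \<omega>" for \<omega>
    unfolding x_def p_def y_def u_def by (rule X_Suc)
  have f: "f \<omega> = wnorm2 Q (p \<omega> + Ba k \<omega> *v y \<omega> + D k \<omega>) + wnorm2 (block_diag Rc) (u \<omega>) - wnorm2 (block_diag Ra) (y \<omega>)" for \<omega>
    unfolding f_def cost_def x_def[symmetric] u_def[symmetric] y_def[symmetric] xs ..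
  have fm: "f \<in> borel_measurable M" unfolding f_def by (rule cost_measurable[OF prof])
  \<comment> \<open>The negative part of the actual cost is an integrable minorant that serves all
    truncated attacks at once.\<close>
  define neg where "neg \<omega> = max 0 (- f \<omega>)" for \<omega>
  have negi: "integrable M neg"
  proof (rule integrableI_nonneg)
    show "neg \<in> borel_measurable M" unfolding neg_def[abs_def] using fm by measurable
    have "(\<integral>\<^sup>+\<omega>. ennreal (neg \<omega>) \<partial>M) = (\<integral>\<^sup>+\<omega>. ennreal (- f \<omega>) \<partial>M)"
      by (intro nn_integral_cong) (auto simp: neg_def max_def ennreal_neg)
    then show "(\<integral>\<^sup>+\<omega>. ennreal (neg \<omega>) \<partial>M) < \<infinity>" using False by (simp add: f_def less_top)
  qed (simp add: neg_def)
  obtain e g where eg: "0 \<le> e" "0 < g"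
    "\<And>b x a. ric.payoff Z b x (ric.Kc Z b *v x) a \<le> e * (norm x)\<^sup>2 - g * (norm a)\<^sup>2"
    using ric.payoff_attack_coercive[OF Z] by metis
  have xi: "integrable M (\<lambda>\<omega>. (norm (x k \<omega>))\<^sup>2)" using xk by (simp add: sq_integrable_def)
  have ysq: "sq_integrable M y"
  proof (rule sq_integrable_monotone_truncation)
    show "y \<in> borel_measurable M" by (rule m)
    fix n
    define a where "a \<omega> = (if norm (y \<omega>) \<le> real n then y \<omega> else 0)" for \<omega>
    have ah: "a \<in> borel_measurable (hist (present k))"
      unfolding a_def[abs_def] using h(4) by measurable
    show asq: "sq_integrable M a" unfolding a_def[symmetric, abs_def]
      by (rule sq_integrable_bounded[OF hist_measurable[OF ah], of "real n"]) (simp add: a_def)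
    note ca = cost_average[OF ph psq h(3) usq px ah asq ric.Q_sym]
    have "- (\<integral>\<omega>. neg \<omega> \<partial>M) = (\<integral>\<omega>. - neg \<omega> \<partial>M)" by simp
    also have "\<dots> \<le> (\<integral>\<omega>. wnorm2 Q (p \<omega> + Ba k \<omega> *v a \<omega> + D k \<omega>) + wnorm2 (block_diag Rc) (u \<omega>) - wnorm2 (block_diag Ra) (a \<omega>) \<partial>M)"
    proof (rule integral_mono)
      fix \<omega>
      \<comment> \<open>Where the attack is kept, the truncated cost is the actual one; where it is
        cut to 0, only nonnegative terms remain.\<close>
      show "- neg \<omega> \<le> wnorm2 Q (p \<omega> + Ba k \<omega> *v a \<omega> + D k \<omega>) + wnorm2 (block_diag Rc) (u \<omega>) - wnorm2 (block_diag Ra) (a \<omega>)"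
      proof (cases "norm (y \<omega>) \<le> real n")
        case True
        then show ?thesis using f[of \<omega>] by (simp add: a_def neg_def)
      next
        case False
        have "0 \<le> wnorm2 Q (p \<omega> + D k \<omega>)" "0 \<le> wnorm2 (block_diag Rc) (u \<omega>)" "- neg \<omega> \<le> 0"
          using ric.Q ric.R by (auto intro: wnorm2_nonneg simp: neg_def)
        then show ?thesis using False by (simp add: a_def)
      qed
    qed (use negi ca(1) in auto)
    also have "\<dots> = (\<integral>\<omega>. ric.payoff Q (Bc k \<omega>) (x k \<omega>) (u \<omega>) (a \<omega>) \<partial>M) + noise_cost B Q" by (rule ca(3))
    \<comment> \<open>The control in play is the one for \<open>Z\<close>, so coercivity is
      available for the payoff with weight \<open>Z\<close>; this payoff dominates the one with
      weight \<open>Q\<close>.\<close>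
    also have "(\<integral>\<omega>. ric.payoff Q (Bc k \<omega>) (x k \<omega>) (u \<omega>) (a \<omega>) \<partial>M) \<le> (\<integral>\<omega>. e * (norm (x k \<omega>))\<^sup>2 - g * (norm (a \<omega>))\<^sup>2 \<partial>M)"
      using order_trans[OF ric.payoff_mono[OF ric.Q_sym symZ QZ] eg(3)] xi asq ca(2)
      by (intro integral_mono) (auto simp: u sq_integrable_def)
    also have "\<dots> = e * (\<integral>\<omega>. (norm (x k \<omega>))\<^sup>2 \<partial>M) - g * (\<integral>\<omega>. (norm (a \<omega>))\<^sup>2 \<partial>M)"
      using xi asq by (simp add: sq_integrable_def)
    finally have "g * (\<integral>\<omega>. (norm (a \<omega>))\<^sup>2 \<partial>M) \<le> e * (\<integral>\<omega>. (norm (x k \<omega>))\<^sup>2 \<partial>M) + noise_cost B Q + (\<integral>\<omega>. neg \<omega> \<partial>M)"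
      by simp
    then show "(\<integral>\<omega>. (norm (if norm (y \<omega>) \<le> real n then y \<omega> else 0))\<^sup>2 \<partial>M)
      \<le> (e * (\<integral>\<omega>. (norm (x k \<omega>))\<^sup>2 \<partial>M) + noise_cost B Q + (\<integral>\<omega>. neg \<omega> \<partial>M)) / g"
      using eg(2) by (simp add: a_def[symmetric] field_simps)
  qed
  note cQ = cost_average[OF ph psq h(3) usq px h(4) ysq ric.Q_sym]
  note cZ = cost_average[OF ph psq h(3) usq px h(4) ysq symZ]
  have xsq: "sq_integrable M (x (Suc k))"
    unfolding xs[abs_def] by (rule one_step(2)[OF ph psq h(4) ysq])
  have fi: "integrable M f" unfolding f[abs_def] by (rule cQ(1))
  note va = value_average[OF Z hist_X[OF prof, folded x_def] xk]
  \<comment> \<open>Charging Z - Q to the next state on top of the stage cost turns its weight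
    \<open>Q\<close> into \<open>Z\<close>, for which \<open>u\<close> is the saddle
    control.\<close>
  have "(\<integral>\<omega>. f \<omega> \<partial>M) + (\<integral>\<omega>. wnorm2 (Z - Q) (x (Suc k) \<omega>) \<partial>M) = (\<integral>\<omega>. f \<omega> + wnorm2 (Z - Q) (x (Suc k) \<omega>) \<partial>M)"
    using fi sq_integrable_wnorm2[OF xsq] by simp
  also have "\<dots> = (\<integral>\<omega>. ric.payoff Z (Bc k \<omega>) (x k \<omega>) (u \<omega>) (y \<omega>) \<partial>M) + noise_cost B Z"
    unfolding cZ(3)[symmetric] by (intro Bochner_Integration.integral_cong) (simp_all add: f xs wnorm2_diff_matrix)
  also have "(\<integral>\<omega>. ric.payoff Z (Bc k \<omega>) (x k \<omega>) (u \<omega>) (y \<omega>) \<partial>M) \<le> (\<integral>\<omega>. wnorm2 (ric.G Z (Bc k \<omega>)) (x k \<omega>) \<partial>M)"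
    by (rule integral_mono[OF cZ(2) va(1)]) (simp add: u ric.saddle_attack[OF Z])
  also have "\<dots> = (\<integral>\<omega>. wnorm2 (ric.P Z) (x k \<omega>) \<partial>M)" by (rule va(2))
  also have "\<dots> \<le> (\<integral>\<omega>. wnorm2 (Z - Q) (x k \<omega>) \<partial>M)"
    by (intro integral_mono sq_integrable_wnorm2[OF xk] super)
  finally show ?thesis
    using xsq ext_expectation_integrable[OF fi] by (auto simp: c_def f_def)
qed

lemma x0_sq: "sq_integrable M (X \<mu>c \<mu>a 0)"
  unfolding X_0[abs_def] by (rule sq_integrable_bounded) auto

text \<open>The potential is the expected Z - Q form of the state. Once the total is -infinity it
  stays so; until then every state is square integrable and the one-step inequality can be
  added.\<close>

lemma total_upper:
  fixes Z \<mu>a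
  assumes Z: "ric.admissible Z" and super: "\<And>x. wnorm2 (ric.P Z) x \<le> wnorm2 (Z - Q) x"
    and QZ: "\<And>x. wnorm2 Q x \<le> wnorm2 Z x" and \<mu>a: "\<mu>a \<in> profiles"
  shows "total (ctrl Z) \<mu>a K = - \<infinity> \<or> (sq_integrable M (X (ctrl Z) \<mu>a K) \<and>
    (\<exists>r. total (ctrl Z) \<mu>a K = ereal r \<and> r + (\<integral>\<omega>. wnorm2 (Z - Q) (X (ctrl Z) \<mu>a K \<omega>) \<partial>M)
       \<le> wnorm2 (Z - Q) x0 + real K * noise_cost B Z))"
proof (induction K)
  case 0
  have "sq_integrable M (\<lambda>_. x0)" by (rule sq_integrable_bounded) auto
  then show ?case using x0_sq[of "ctrl Z" \<mu>a] by (simp add: total_def X_0 prob_space)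
next
  case (Suc K)
  show ?case
  proof (cases "total (ctrl Z) \<mu>a K = - \<infinity>")
    case True
    then show ?thesis by (simp add: total_def)
  next
    case False
    with Suc obtain r where xK: "sq_integrable M (X (ctrl Z) \<mu>a K)" and r: "total (ctrl Z) \<mu>a K = ereal r"
      "r + (\<integral>\<omega>. wnorm2 (Z - Q) (X (ctrl Z) \<mu>a K \<omega>) \<partial>M) \<le> wnorm2 (Z - Q) x0 + real K * noise_cost B Z" by blast
    from upper_step[OF Z super QZ \<mu>a xK] show ?thesis
    proof (elim disjE conjE exE)
      assume "ext_expectation M (cost (ctrl Z) \<mu>a K) = - \<infinity>"
      then show ?thesis using r by (simp add: total_def)
    next
      fix s assume s: "ext_expectation M (cost (ctrl Z) \<mu>a K) = ereal s"
        "s + (\<integral>\<omega>. wnorm2 (Z - Q) (X (ctrl Z) \<mu>a (Suc K) \<omega>) \<partial>M)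
         \<le> (\<integral>\<omega>. wnorm2 (Z - Q) (X (ctrl Z) \<mu>a K \<omega>) \<partial>M) + noise_cost B Z"
        and "sq_integrable M (X (ctrl Z) \<mu>a (Suc K))"
      moreover have "total (ctrl Z) \<mu>a (Suc K) = ereal (r + s)" using r s by (simp add: total_def)
      moreover have "(r + s) + (\<integral>\<omega>. wnorm2 (Z - Q) (X (ctrl Z) \<mu>a (Suc K) \<omega>) \<partial>M)
         \<le> wnorm2 (Z - Q) x0 + real (Suc K) * noise_cost B Z"
        using r(2) s(2) by (simp add: algebra_simps)
      ultimately show ?thesis by blast
    qed
  qed
qed

text \<open>The terminal potential is nonnegative and is dropped; the initial one is a constant that
  the division by K removes.\<close>

lemma J_upper:
  fixes Z \<mu>a
  assumes Z: "ric.admissible Z" and super: "\<And>x. wnorm2 (ric.P Z) x \<le> wnorm2 (Z - Q) x"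
    and QZ: "\<And>x. wnorm2 Q x \<le> wnorm2 Z x" and \<mu>a: "\<mu>a \<in> profiles"
  shows "J (ctrl Z) \<mu>a \<le> ereal (noise_cost B Z)"
proof -
  define t V0 where "t = noise_cost B Z" and "V0 = wnorm2 (Z - Q) x0"
  have le: "total (ctrl Z) \<mu>a K / ereal (real K) \<le> ereal (V0 / real K + t)" if K: "K > 0" for K
    using total_upper[OF Z super QZ \<mu>a, of K]
  proof (elim disjE conjE exE)
    assume "total (ctrl Z) \<mu>a K = - \<infinity>" then show ?thesis using K by simp
  next
    fix r assume r: "total (ctrl Z) \<mu>a K = ereal r" "r + (\<integral>\<omega>. wnorm2 (Z - Q) (X (ctrl Z) \<mu>a K \<omega>) \<partial>M)
       \<le> wnorm2 (Z - Q) x0 + real K * noise_cost B Z"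
    have "0 \<le> (\<integral>\<omega>. wnorm2 (Z - Q) (X (ctrl Z) \<mu>a K \<omega>) \<partial>M)"
      using QZ by (simp add: wnorm2_diff_matrix)
    then have "r \<le> V0 + real K * t" using r by (simp add: t_def V0_def)
    then show ?thesis using K r by (simp add: field_simps)
  qed
  have "(\<lambda>K. V0 / real K + t) \<longlonglongrightarrow> 0 + t"
    by (intro tendsto_intros lim_const_over_n)
  then have lim: "(\<lambda>K. ereal (V0 / real K + t)) \<longlonglongrightarrow> ereal t" by simp
  have "J (ctrl Z) \<mu>a \<le> limsup (\<lambda>K. ereal (V0 / real K + t))"
    unfolding J_eq by (intro Limsup_mono eventually_sequentiallyI[of 1] le) simp
  also have "\<dots> = ereal t" by (rule lim_imp_Limsup[OF _ lim]) simp
  finally show ?thesis by (simp add: t_def)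
qed

end

section \<open>The lower bound and the value\<close>

context lq_game
begin

text \<open>The attack is linear in the state with bounded gain, so its cost is integrable and the
  expected stage cost is either finite or +infinity. If finite, positivity of \<open>Q\<close> and
  \<open>Rc\<close> puts the next state and the control into L2, and the saddle inequality for the
  control applies.\<close>

lemma lower_step:
  fixes m \<mu>c k
  defines "x \<equiv> X \<mu>c (att m)" and "c \<equiv> ext_expectation M (cost \<mu>c (att m) k)" and "Z \<equiv> ric.iter (m k)"
  assumes \<mu>c: "\<mu>c \<in> profiles" and xk: "sq_integrable M (x k)"
  shows "c = \<infinity> \<or> (sq_integrable M (x (Suc k)) \<and>
    (\<exists>r. c = ereal r \<and> (\<integral>\<omega>. wnorm2 (ric.P Z) (x k \<omega>) \<partial>M) + noise_cost B Z
       \<le> r + (\<integral>\<omega>. wnorm2 (Z - Q) (x (Suc k) \<omega>) \<partial>M)))"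
proof -
  define f u y p where "f = cost \<mu>c (att m) k" and "u = U \<mu>c (att m) k" and "y = Y \<mu>c (att m) k"
    and "p = (\<lambda>\<omega>. A *v x k \<omega> + Bc k \<omega> *v u \<omega>)"
  note prof = \<mu>c att_profile[of m]
  note h = hist_present[OF prof, of k, folded x_def u_def y_def]
  note ms = measurable_M[OF prof, of k, folded x_def u_def y_def]
  have Z: "ric.admissible Z" unfolding Z_def by (rule ric.iter_admissible)
  have symZ: "transpose Z = Z" by (rule ric.admissible_sym[OF Z])
  have y: "y \<omega> = ric.Ka Z (Bc k \<omega>) *v x k \<omega>" for \<omega> unfolding y_def x_def Z_def by (rule Y_att)
  obtain d where d: "\<And>b x. (norm (ric.Ka Z b *v x))\<^sup>2 \<le> d * (norm x)\<^sup>2"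
    using ric.gains_bounded[OF Z] by metis
  have ysq: "sq_integrable M y"
    by (rule sq_integrable_bound[OF xk ms(4), of d]) (simp add: y d)
  have ph: "p \<in> borel_measurable (hist (present k))"
    unfolding p_def by (intro borel_measurable_add measurable_matrix_vector_mult h) auto
  have px: "p \<omega> = A *v x k \<omega> + Bc k \<omega> *v u \<omega>" for \<omega> by (simp add: p_def)
  have xs: "x (Suc k) \<omega> = p \<omega> + Ba k \<omega> *v y \<omega> + D k \<omega>" for \<omega>
    unfolding x_def p_def y_def u_def by (rule X_Suc)
  have f: "f \<omega> = wnorm2 Q (x (Suc k) \<omega>) + wnorm2 (block_diag Rc) (u \<omega>) - wnorm2 (block_diag Ra) (y \<omega>)" for \<omega>
    unfolding f_def cost_def x_def u_def y_def ..
  have fm: "f \<in> borel_measurable M" unfolding f_def by (rule cost_measurable[OF prof])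
  have Rai: "integrable M (\<lambda>\<omega>. wnorm2 (block_diag Ra) (y \<omega>))" by (rule sq_integrable_wnorm2[OF ysq])
  have nonneg: "0 \<le> wnorm2 Q v" "0 \<le> wnorm2 (block_diag Rc) v'" for v v'
    using ric.Q ric.R by (auto intro: wnorm2_nonneg)
  have "- f \<omega> \<le> wnorm2 (block_diag Ra) (y \<omega>)" for \<omega>
    using nonneg(1)[of "x (Suc k) \<omega>"] nonneg(2)[of "u \<omega>"] by (simp add: f)
  then have "(\<integral>\<^sup>+\<omega>. ennreal (- f \<omega>) \<partial>M) \<le> (\<integral>\<^sup>+\<omega>. ennreal (wnorm2 (block_diag Ra) (y \<omega>)) \<partial>M)"
    by (intro nn_integral_mono ennreal_leI)
  also have "\<dots> < \<infinity>" using Rai by (simp add: real_integrable_def less_top)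
  finally have neg: "(\<integral>\<^sup>+\<omega>. ennreal (- f \<omega>) \<partial>M) < \<infinity>" .
  show ?thesis
  proof (cases "(\<integral>\<^sup>+\<omega>. ennreal (f \<omega>) \<partial>M) = \<infinity>")
    case True
    obtain b where "0 \<le> b" "(\<integral>\<^sup>+\<omega>. ennreal (- f \<omega>) \<partial>M) = ennreal b"
      using neg by (cases "\<integral>\<^sup>+\<omega>. ennreal (- f \<omega>) \<partial>M") auto
    then have "c = \<infinity>"
      unfolding c_def f_def[symmetric] ext_expectation_def True by (simp add: enn2ereal_ennreal)
    then show ?thesis by simp
  next
    case False
    with neg fm have fi: "integrable M f" by (simp add: real_integrable_def)
    have si: "integrable M (\<lambda>\<omega>. f \<omega> + wnorm2 (block_diag Ra) (y \<omega>))" using fi Rai by simp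
    obtain q r where q: "0 < q" "\<And>v. q * (norm v)\<^sup>2 \<le> wnorm2 Q v"
      and r: "0 < r" "\<And>v. r * (norm v)\<^sup>2 \<le> wnorm2 (block_diag Rc) v"
      using pos_def_lower_bound ric.Q ric.R by metis
    have xsm: "x (Suc k) \<in> borel_measurable M"
      unfolding x_def by (rule measurable_M(1)[OF prof])
    have xsq: "sq_integrable M (x (Suc k))"
      unfolding sq_integrable_def
    proof
      show "integrable M (\<lambda>\<omega>. (norm (x (Suc k) \<omega>))\<^sup>2)"
      proof (rule Bochner_Integration.integrable_bound)
        show "integrable M (\<lambda>\<omega>. (f \<omega> + wnorm2 (block_diag Ra) (y \<omega>)) / q)" using si by simp
        have "(norm (x (Suc k) \<omega>))\<^sup>2 \<le> (f \<omega> + wnorm2 (block_diag Ra) (y \<omega>)) / q" for \<omega>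
          using q(1) q(2)[of "x (Suc k) \<omega>"] nonneg(2)[of "u \<omega>"] f[of \<omega>] by (simp add: field_simps)
        then show "AE \<omega> in M. norm ((norm (x (Suc k) \<omega>))\<^sup>2) \<le> norm ((f \<omega> + wnorm2 (block_diag Ra) (y \<omega>)) / q)"
          by (intro AE_I2) (smt (verit) real_norm_def zero_le_power2)
      qed (use xsm in measurable)
    qed (rule xsm)
    have usq: "sq_integrable M u"
      unfolding sq_integrable_def
    proof
      show "integrable M (\<lambda>\<omega>. (norm (u \<omega>))\<^sup>2)"
      proof (rule Bochner_Integration.integrable_bound)
        show "integrable M (\<lambda>\<omega>. (f \<omega> + wnorm2 (block_diag Ra) (y \<omega>)) / r)" using si by simp
        have "(norm (u \<omega>))\<^sup>2 \<le> (f \<omega> + wnorm2 (block_diag Ra) (y \<omega>)) / r" for \<omega>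
          using r(1) r(2)[of "u \<omega>"] nonneg(1)[of "x (Suc k) \<omega>"] f[of \<omega>] by (simp add: field_simps)
        then show "AE \<omega> in M. norm ((norm (u \<omega>))\<^sup>2) \<le> norm ((f \<omega> + wnorm2 (block_diag Ra) (y \<omega>)) / r)"
          by (intro AE_I2) (smt (verit) real_norm_def zero_le_power2)
      qed (use ms(3) in measurable)
    qed (rule ms(3))
    \<comment> \<open>\<open>Bc\<close> is unbounded, so square integrability of \<open>u\<close>
      does not pass to \<open>p\<close> directly; \<open>p\<close> is recovered from the next state
      by subtracting attack and noise. For the attack term \<open>one_step\<close> is used with the
      zero vector in place of \<open>p\<close>.\<close>
    have zsq: "sq_integrable M (\<lambda>_. 0 :: real^'s)" by (rule sq_integrable_bounded) auto
    have "sq_integrable M (\<lambda>\<omega>. x (Suc k) \<omega> + - (Ba k \<omega> *v y \<omega>) + - D k \<omega>)"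
      by (intro sq_integrable_add sq_integrable_minus xsq one_step(1)[OF _ zsq h(4) ysq] disturbance_sq[of B k, folded D_def]) simp
    then have psq: "sq_integrable M p" by (simp add: xs)
    note cZ = cost_average[OF ph psq h(3) usq px h(4) ysq symZ]
    note va = value_average[OF Z hist_X[OF prof, folded x_def] xk]
    have "(\<integral>\<omega>. wnorm2 (ric.P Z) (x k \<omega>) \<partial>M) = (\<integral>\<omega>. wnorm2 (ric.G Z (Bc k \<omega>)) (x k \<omega>) \<partial>M)"
      by (rule va(2)[symmetric])
    also have "\<dots> \<le> (\<integral>\<omega>. ric.payoff Z (Bc k \<omega>) (x k \<omega>) (u \<omega>) (y \<omega>) \<partial>M)"
      by (rule integral_mono[OF va(1) cZ(2)]) (simp add: y ric.saddle_control[OF Z])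
    also have "\<dots> + noise_cost B Z = (\<integral>\<omega>. f \<omega> + wnorm2 (Z - Q) (x (Suc k) \<omega>) \<partial>M)"
      unfolding cZ(3)[symmetric] by (intro Bochner_Integration.integral_cong) (simp_all add: f xs wnorm2_diff_matrix)
    also have "\<dots> = (\<integral>\<omega>. f \<omega> \<partial>M) + (\<integral>\<omega>. wnorm2 (Z - Q) (x (Suc k) \<omega>) \<partial>M)"
      using fi sq_integrable_wnorm2[OF xsq] by simp
    finally have "(\<integral>\<omega>. wnorm2 (ric.P Z) (x k \<omega>) \<partial>M) + noise_cost B Z
      \<le> (\<integral>\<omega>. f \<omega> \<partial>M) + (\<integral>\<omega>. wnorm2 (Z - Q) (x (Suc k) \<omega>) \<partial>M)" by simp
    then show ?thesis
      using xsq ext_expectation_integrable[OF fi] by (auto simp: c_def f_def)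
  qed
qed

lemma wnorm2_P_iter: "wnorm2 (ric.P (ric.iter n)) x = wnorm2 (ric.iter (Suc n) - Q) x"
  by (simp add: ric.iter_simps ric.wnorm2_step wnorm2_diff_matrix)

text \<open>Within a block of length \<open>T\<close>, \<open>block_horizon T k\<close> counts the steps after step \<open>k\<close>, and
  \<open>block_togo T k\<close> those from step \<open>k\<close> on; at a block boundary the latter is \<open>0\<close> rather than \<open>T\<close>,
  since the terminal value of the block that ends there is zero.\<close>

definition block_horizon where "block_horizon T k = T - Suc (k mod T)"
definition block_togo where "block_togo T k = (if k mod T = 0 then 0 else T - k mod T)"

lemma block_togo_Suc:
  assumes "0 < T"
  shows "block_togo T (Suc k) = block_horizon T k"
proof (cases "Suc (k mod T) = T")
  case True
  then have "Suc k mod T = 0" by (simp add: mod_Suc)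
  with True show ?thesis by (simp add: block_togo_def block_horizon_def)
next
  case False
  then have "Suc k mod T = Suc (k mod T)" by (simp add: mod_Suc)
  then show ?thesis by (simp add: block_togo_def block_horizon_def)
qed

lemma block_togo_le:
  assumes "0 < T"
  shows "block_togo T k = Suc (block_horizon T k) \<or> block_togo T k = 0"
  using mod_less_divisor[OF assms, of k] by (auto simp: block_togo_def block_horizon_def)

text \<open>The potential is the value still to be played for in the current block. A total of
  +infinity is absorbing and harmless to the attacker; otherwise each step earns at least the noise
  cost of its remaining horizon.\<close>

lemma total_lower:
  fixes T \<mu>c
  defines "a \<equiv> att (block_horizon T)"
  assumes T: "0 < T" and \<mu>c: "\<mu>c \<in> profiles"
  shows "total \<mu>c a K = \<infinity> \<or> (sq_integrable M (X \<mu>c a K) \<and>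
    (\<exists>r. total \<mu>c a K = ereal r \<and> (\<Sum>k<K. noise_cost B (ric.iter (block_horizon T k)))
       \<le> r + (\<integral>\<omega>. wnorm2 (ric.iter (block_togo T K) - Q) (X \<mu>c a K \<omega>) \<partial>M)))"
proof (induction K)
  case 0
  show ?case using x0_sq[of \<mu>c a] by (simp add: total_def block_togo_def ric.iter_simps wnorm2_def)
next
  case (Suc K)
  show ?case
  proof (cases "total \<mu>c a K = \<infinity>")
    case True
    then show ?thesis by (simp add: total_def)
  next
    case False
    with Suc obtain r where xK: "sq_integrable M (X \<mu>c a K)" and r: "total \<mu>c a K = ereal r"
      "(\<Sum>k<K. noise_cost B (ric.iter (block_horizon T k)))
       \<le> r + (\<integral>\<omega>. wnorm2 (ric.iter (block_togo T K) - Q) (X \<mu>c a K \<omega>) \<partial>M)" by blast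
    let ?n = "block_horizon T K"
    \<comment> \<open>Inside a block the two weights agree. At a boundary the left one is zero and
      the right one is the value of the new block, which is nonnegative from any state.\<close>
    have togo: "(\<integral>\<omega>. wnorm2 (ric.iter (block_togo T K) - Q) (X \<mu>c a K \<omega>) \<partial>M)
       \<le> (\<integral>\<omega>. wnorm2 (ric.P (ric.iter ?n)) (X \<mu>c a K \<omega>) \<partial>M)"
    proof (rule integral_mono[OF sq_integrable_wnorm2[OF xK] sq_integrable_wnorm2[OF xK]])
      fix \<omega>
      show "wnorm2 (ric.iter (block_togo T K) - Q) (X \<mu>c a K \<omega>) \<le> wnorm2 (ric.P (ric.iter ?n)) (X \<mu>c a K \<omega>)"
        using block_togo_le[OF T, of K]
      proof
        assume "block_togo T K = 0"
        then show ?thesis using ric.P_nonneg[OF ric.iter_admissible] by (simp add: ric.iter_simps wnorm2_def)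
      qed (simp add: wnorm2_P_iter)
    qed
    from lower_step[OF \<mu>c xK[unfolded a_def], folded a_def] show ?thesis
    proof (elim disjE conjE exE)
      assume "ext_expectation M (cost \<mu>c a K) = \<infinity>"
      then show ?thesis using r by (simp add: total_def)
    next
      fix s assume s: "ext_expectation M (cost \<mu>c a K) = ereal s"
        "(\<integral>\<omega>. wnorm2 (ric.P (ric.iter ?n)) (X \<mu>c a K \<omega>) \<partial>M) + noise_cost B (ric.iter ?n)
         \<le> s + (\<integral>\<omega>. wnorm2 (ric.iter ?n - Q) (X \<mu>c a (Suc K) \<omega>) \<partial>M)"
        and "sq_integrable M (X \<mu>c a (Suc K))"
      moreover have "total \<mu>c a (Suc K) = ereal (r + s)" using r s by (simp add: total_def)
      moreover have "(\<Sum>k<Suc K. noise_cost B (ric.iter (block_horizon T k)))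
         \<le> (r + s) + (\<integral>\<omega>. wnorm2 (ric.iter (block_togo T (Suc K)) - Q) (X \<mu>c a (Suc K) \<omega>) \<partial>M)"
        unfolding block_togo_Suc[OF T] using r(2) s(2) togo by simp
      ultimately show ?thesis by blast
    qed
  qed
qed

lemma sum_block_horizon:
  fixes f :: "nat \<Rightarrow> real"
  shows "(\<Sum>k<j * T. f (block_horizon T k)) = real j * (\<Sum>i<T. f i)"
proof -
  have "(\<Sum>k\<in>{m * T..<m * T + T}. f (block_horizon T k)) = (\<Sum>i<T. f i)" for m
  proof -
    have "(\<Sum>k\<in>{m * T..<m * T + T}. f (block_horizon T k)) = (\<Sum>i<T. f (block_horizon T (m * T + i)))"
      using sum.shift_bounds_nat_ivl[of "\<lambda>k. f (block_horizon T k)" 0 "m * T" T]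
      by (simp add: atLeast0LessThan add.commute)
    also have "\<dots> = (\<Sum>i<T. f (T - Suc i))"
      by (intro sum.cong refl) (simp add: block_horizon_def)
    finally show ?thesis by (simp add: sum.nat_diff_reindex)
  qed
  then show ?thesis unfolding sum.nat_group[symmetric] by simp
qed

text \<open>\<open>J\<close> is a limit superior, so a bound along the multiples of \<open>T\<close>
  suffices; there the potential is zero and each completed block has run once through the horizons T
  - 1, ..., 0.\<close>

lemma J_lower:
  assumes T: "0 < T" and \<mu>c: "\<mu>c \<in> profiles"
  shows "ereal ((\<Sum>i<T. noise_cost B (ric.iter i)) / real T) \<le> J \<mu>c (att (block_horizon T))"
proof -
  define S where "S = (\<Sum>i<T. noise_cost B (ric.iter i))"
  define g where "g K = total \<mu>c (att (block_horizon T)) K / ereal (real K)" for K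
  have le: "ereal (S / real T) \<le> g (j * T)" if j: "j > 0" for j
    using total_lower[OF T \<mu>c, of "j * T"]
  proof (elim disjE conjE exE)
    assume "total \<mu>c (att (block_horizon T)) (j * T) = \<infinity>"
    then show ?thesis using j T by (simp add: g_def)
  next
    fix r assume r: "total \<mu>c (att (block_horizon T)) (j * T) = ereal r"
      "(\<Sum>k<j * T. noise_cost B (ric.iter (block_horizon T k)))
       \<le> r + (\<integral>\<omega>. wnorm2 (ric.iter (block_togo T (j * T)) - Q) (X \<mu>c (att (block_horizon T)) (j * T) \<omega>) \<partial>M)"
    have "real j * S \<le> r"
      using r(2) unfolding sum_block_horizon[of "\<lambda>i. noise_cost B (ric.iter i)"] S_def[symmetric]
      by (simp add: block_togo_def ric.iter_simps wnorm2_def)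
    then show ?thesis using r(1) j T by (simp add: g_def field_simps)
  qed
  have "ereal (S / real T) \<le> limsup (g \<circ> (\<lambda>j. j * T))"
    by (intro le_Limsup eventually_sequentiallyI[of 1]) (simp_all add: le)
  also have "\<dots> \<le> limsup g"
    using T by (intro limsup_subseq_mono) (simp add: strict_mono_def)
  finally show ?thesis unfolding J_eq g_def S_def .
qed

lemma game_value: "\<exists>val. has_game_value J val"
proof -
  obtain Z where lim: "ric.iter \<longlonglongrightarrow> Z" and Z: "ric.admissible Z"
    and super: "\<And>x. wnorm2 (ric.P Z) x \<le> wnorm2 (Z - Q) x" and ge: "\<And>n x. wnorm2 (ric.iter n) x \<le> wnorm2 Z x"
    using ric.riccati_limit by blast
  define t s where "t = noise_cost B Z" and "s i = noise_cost B (ric.iter i)" for i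
  have QZ: "wnorm2 Q x \<le> wnorm2 Z x" for x using ge[of 0 x] by (simp add: ric.iter_simps)
  have s0: "0 \<le> s i" for i
    unfolding s_def using ric.iter_bounds[of i] by (intro noise_cost_nonneg ric.iter_sym wnorm2_nonneg) auto
  \<comment> \<open>\<open>noise_cost\<close> is a finite linear combination of the matrix entries
    and follows their limits.\<close>
  have slim: "s \<longlonglongrightarrow> t"
    unfolding s_def t_def noise_cost_def matrix_matrix_mult_def
    by (auto intro!: tendsto_intros tendsto_vec_nth lim)
  define lower upper where "lower = (SUP \<mu>a\<in>profiles. INF \<mu>c\<in>profiles. J \<mu>c \<mu>a)"
    and "upper = (INF \<mu>c\<in>profiles. SUP \<mu>a\<in>profiles. J \<mu>c \<mu>a)"
  have up: "upper \<le> ereal t"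
    unfolding upper_def t_def
    by (intro INF_lower2[OF ctrl_profile[OF Z]] SUP_least J_upper Z super QZ)
  have minimax: "lower \<le> upper"
    unfolding lower_def upper_def
    by (intro SUP_least INF_greatest) (meson INF_lower2 SUP_upper order_trans order_refl)
  have low: "ereal ((\<Sum>i<T. s i) / real T) \<le> lower" if "0 < T" for T
    unfolding lower_def s_def
    by (intro SUP_upper2[OF att_profile[of "block_horizon T"]] INF_greatest J_lower that)
  have "ereal (t - e) \<le> lower" if e: "0 < e" for e
  proof -
    have "\<forall>\<^sub>F n in sequentially. t - e < s n" using slim e by (intro order_tendstoD(1)) auto
    then obtain n where n: "\<And>i. n \<le> i \<Longrightarrow> t - e < s i" by (auto simp: eventually_sequentially)
    have bound: "ereal ((t - e) - (t - e) * real n / real T) \<le> lower" if T: "Suc n \<le> T" for T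
    proof -
      \<comment> \<open>A one-sided Cesaro argument: the first \<open>n\<close> terms are
        nonnegative and are discarded, and their share of the average tends to zero as
        \<open>T\<close> grows.\<close>
      have "(t - e) * (real T - real n) = (\<Sum>i\<in>{n..<T}. t - e)" using T by (simp add: of_nat_diff)
      also have "\<dots> \<le> (\<Sum>i\<in>{n..<T}. s i)" by (intro sum_mono) (use n in \<open>auto intro: less_imp_le\<close>)
      also have "\<dots> \<le> (\<Sum>i<T. s i)" by (intro sum_mono2) (auto simp: s0)
      finally have "(t - e) * (real T - real n) / real T \<le> (\<Sum>i<T. s i) / real T"
        by (rule divide_right_mono) simp
      moreover have "(t - e) * (real T - real n) / real T = (t - e) - (t - e) * real n / real T"
        using T by (simp add: right_diff_distrib diff_divide_distrib)
      ultimately have "ereal ((t - e) - (t - e) * real n / real T) \<le> ereal ((\<Sum>i<T. s i) / real T)" by simp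
      also have "\<dots> \<le> lower" using T by (intro low) simp
      finally show ?thesis .
    qed
    have "(\<lambda>T. (t - e) - (t - e) * real n / real T) \<longlonglongrightarrow> (t - e) - 0"
      by (intro tendsto_intros lim_const_over_n)
    then have "(\<lambda>T. ereal ((t - e) - (t - e) * real n / real T)) \<longlonglongrightarrow> ereal (t - e)" by simp
    then show ?thesis by (rule LIMSEQ_le_const2) (use bound in blast)
  qed
  then have "ereal t \<le> lower + ereal e" if "0 < e" for e
    using add_right_mono[of "ereal (t - e)" lower "ereal e"] that by simp
  then have "ereal t \<le> lower" by (rule ereal_le_epsilon2)
  with up minimax have "lower = ereal t" "upper = ereal t" by auto
  then show ?thesis unfolding has_game_value_def lower_def upper_def by blast
qed

end

section \<open>From the hypotheses of the game to the abstract Riccati setting\<close>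

lemma pos_def_block_diag:
  fixes R :: "'j::finite \<Rightarrow> real^'t::finite^'t"
  assumes R: "\<And>j. pos_def (R j)"
  shows "pos_def (block_diag R)"
  unfolding pos_def_def
proof (intro conjI allI impI)
  have "R j $ s $ t = R j $ t $ s" for j s t
    using R[of j] by (simp add: pos_def_def transpose_def vec_eq_iff)
  then show "transpose (block_diag R) = block_diag R"
    by (auto simp: block_diag_def transpose_def vec_eq_iff)
next
  fix a :: "real^('j \<times> 't)" assume "a \<noteq> 0"
  define b where "b j = (\<chi> t. a $ (j, t))" for j
  have split: "(\<Sum>p\<in>UNIV. f p) = (\<Sum>j\<in>UNIV. \<Sum>t\<in>UNIV. f (j, t))" for f :: "'j \<times> 't \<Rightarrow> real"
    unfolding UNIV_Times_UNIV[symmetric] sum.cartesian_product by simp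
  have collapse: "(\<Sum>i\<in>UNIV. \<Sum>s\<in>UNIV. block_diag R $ (j, t) $ (i, s) * a $ (i, s)) = (\<Sum>s\<in>UNIV. R j $ t $ s * a $ (j, s))" for j t
  proof -
    have "(\<Sum>s\<in>UNIV. block_diag R $ (j, t) $ (i, s) * a $ (i, s))
      = (if j = i then \<Sum>s\<in>UNIV. R j $ t $ s * a $ (j, s) else 0)" for i
      by (simp add: block_diag_def)
    then show ?thesis by simp
  qed
  have "a \<bullet> (block_diag R *v a) = (\<Sum>p\<in>UNIV. a $ p * (\<Sum>q\<in>UNIV. block_diag R $ p $ q * a $ q))"
    by (simp add: inner_vec_def matrix_vector_mult_def)
  also have "\<dots> = (\<Sum>j\<in>UNIV. \<Sum>t\<in>UNIV. a $ (j, t) * (\<Sum>s\<in>UNIV. R j $ t $ s * a $ (j, s)))"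
    by (simp only: split collapse)
  also have "\<dots> = (\<Sum>j\<in>UNIV. wnorm2 (R j) (b j))"
    by (simp add: wnorm2_def inner_vec_def matrix_vector_mult_def b_def)
  finally have eq: "a \<bullet> (block_diag R *v a) = (\<Sum>j\<in>UNIV. wnorm2 (R j) (b j))" .
  obtain j t where "a $ (j, t) \<noteq> 0"
    using \<open>a \<noteq> 0\<close> by (auto simp: vec_eq_iff)
  then have "b j \<noteq> 0" by (auto simp: b_def vec_eq_iff)
  then have "0 < wnorm2 (R j) (b j)" using R[of j] by (simp add: pos_def_def wnorm2_def)
  then show "0 < a \<bullet> (block_diag R *v a)"
    unfolding eq by (intro sum_pos2[of _ j]) (auto intro: wnorm2_nonneg R)
qed

lemma wnorm2_mat: "wnorm2 (mat c) a = c * (norm a)\<^sup>2"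
proof -
  have "mat c *v a = c *\<^sub>R a"
    by (simp add: mat_def matrix_vector_mult_def vec_eq_iff if_distrib[of "\<lambda>x. x * _"] cong: if_cong)
  then show ?thesis by (simp add: wnorm2_def power2_norm_eq_inner)
qed

text \<open>Closedness supplies the Borel set that is needed to carry an almost sure property of the
  control matrix over to its law.\<close>

lemma closed_lower_bound: "closed {b :: real^'m^'s. \<forall>y. c * (norm y)\<^sup>2 \<le> (norm (transpose b *v y))\<^sup>2}"
proof -
  have "continuous_on UNIV (\<lambda>b :: real^'m^'s. transpose b *v y)" for y
  proof -
    have "linear (\<lambda>b :: real^'m^'s. transpose b *v y)"
      by (auto simp: linear_iff transpose_def matrix_vector_mult_def vec_eq_iff algebra_simps sum.distrib sum_distrib_left simp del: transpose_matrix_vector)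
    then show ?thesis by (rule linear_continuous_on[OF linear_conv_bounded_linear[THEN iffD1]])
  qed
  then show ?thesis
    by (intro closed_Collect_all closed_Collect_le continuous_intros)
qed

text \<open>Non-measurable sets have measure \<open>0\<close>, so no measurability of the rank is needed.\<close>

lemma (in prob_space) AE_zero_or_full_rank:
  fixes b :: "'a \<Rightarrow> real^'m^'s"
  assumes b: "b \<in> borel_measurable M"
    and full: "prob {\<omega> \<in> space M. rank (b \<omega>) = CARD('s)} = \<delta>"
    and zero: "prob {\<omega> \<in> space M. b \<omega> = 0} = 1 - \<delta>"
  shows "AE \<omega> in M. b \<omega> \<noteq> 0 \<longrightarrow> rank (b \<omega>) = CARD('s)"
proof -
  let ?R = "{\<omega> \<in> space M. rank (b \<omega>) = CARD('s)}" and ?Z = "{\<omega> \<in> space M. b \<omega> = 0}"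
  have Z: "?Z \<in> events" using b by measurable
  show ?thesis
  proof (cases "?R \<in> events")
    case True
    have disj: "?R \<inter> ?Z = {}" by auto
    have "prob (?R \<union> ?Z) = 1"
      using finite_measure_Union[OF True Z disj] full zero by simp
    then have "AE \<omega> in M. \<omega> \<in> ?R \<union> ?Z" using True Z by (intro AE_prob_1)
    then show ?thesis by eventually_elim auto
  next
    case False
    \<comment> \<open>Here \<delta> is the measure of a non-event, hence 0, so the zero matrix has
      probability one.\<close>
    then have "prob ?Z = 1" using full zero by (simp add: measure_notin_sets)
    then have "AE \<omega> in M. \<omega> \<in> ?Z" by (rule AE_prob_1)
    then show ?thesis by eventually_elim auto
  qed
qed

theorem corollary2:
  fixes A :: "real^'s^'s"
    and B :: "'c::finite \<Rightarrow> real^'r^'s"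
    and Q :: "real^'s^'s"
    and Rc :: "'c \<Rightarrow> real^'tc^'tc"
    and N :: "(real^'ta^'r^'c^'l) measure"
    and \<sigma> :: real
  assumes "transpose A = A"
    and "CARD('tc) * CARD('c) \<ge> CARD('s)"
    and "CARD('ta) * CARD('l) \<ge> CARD('s)"
    and "pos_def Q"
    and "\<forall>j. pos_def (Rc j)"
    and "integrable N (\<lambda>h. (norm (input_matrix B h))\<^sup>2)"
    and "\<sigma> > 0"
  shows "\<exists>\<gamma>1 > 0. \<forall>(M :: 'w measure) x0 W V w v Hc Ha \<delta> (Ra :: 'l \<Rightarrow> real^'ta^'ta).
           game_randomness M W V N w v Hc Ha \<longrightarrow>
           (\<forall>l. pos_def (Ra l)) \<longrightarrow>
           iid M (\<lambda>k \<omega>. input_matrix B (Hc k \<omega>)) \<longrightarrow>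
           (\<forall>k. measure M {\<omega> \<in> space M. rank (input_matrix B (Hc k \<omega>)) = CARD('s)} = \<delta>) \<longrightarrow>
           (\<forall>k. measure M {\<omega> \<in> space M. input_matrix B (Hc k \<omega>) = 0} = 1 - \<delta>) \<longrightarrow>
           (\<forall>k. AE \<omega> in M. \<forall>s \<in> singular_values (input_matrix B (Hc k \<omega>)). s \<noteq> 0 \<longrightarrow> \<sigma> \<le> s) \<longrightarrow>
           (spectral_radius A \<noteq> 0 \<longrightarrow> \<delta> > 1 - inverse ((spectral_radius A)\<^sup>2)) \<longrightarrow>
           block_diag Ra \<succ>\<^sub>L mat (\<gamma>1 * inverse ((1 - (1 - \<delta>) * (spectral_radius A)\<^sup>2)\<^sup>2)) \<longrightarrow>
           (\<exists>val. has_game_value (average_cost M A B Q Rc Ra x0 w v Hc Ha) val)"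
proof -
  define \<rho> power C where "\<rho> = spectral_radius A" and "power = (\<integral>h. (norm (input_matrix B h))\<^sup>2 \<partial>N)"
    and "C = norm Q + norm (block_diag Rc) / \<sigma>\<^sup>2 * \<rho>\<^sup>2 + 1"
  have "0 \<le> C" "0 \<le> power" by (auto simp: C_def power_def)
  then have \<gamma>: "0 < 6 * C * power + 1" by (simp add: add_nonneg_pos)
  show ?thesis
  \<comment> \<open>The constant is built from A, B, Q, Rc, \<sigma> and the law \<open>N\<close>
    only, and is fixed before \<delta> and Ra; the summand 1 keeps it positive when
    \<open>power\<close> is 0.\<close>
  proof (rule exI[of _ "6 * C * power + 1"], intro conjI \<gamma> allI impI)
    fix M :: "'w measure" and x0 :: "real^'s" and W :: "real^'s^'s" and V :: "real^'r^'r" and \<delta> :: real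
      and w :: "nat \<Rightarrow> 'w \<Rightarrow> real^'s" and v :: "nat \<Rightarrow> 'c \<Rightarrow> 'w \<Rightarrow> real^'r"
      and Hc :: "nat \<Rightarrow> 'w \<Rightarrow> real^'tc^'r^'c^'c" and Ha :: "nat \<Rightarrow> 'w \<Rightarrow> real^'ta^'r^'c^'l"
      and Ra :: "'l \<Rightarrow> real^'ta^'ta"
    assume game: "game_randomness M W V N w v Hc Ha" and Ra: "\<forall>l. pos_def (Ra l)"
      and full: "\<forall>k. measure M {\<omega> \<in> space M. rank (input_matrix B (Hc k \<omega>)) = CARD('s)} = \<delta>"
      and zero: "\<forall>k. measure M {\<omega> \<in> space M. input_matrix B (Hc k \<omega>) = 0} = 1 - \<delta>"
      and sv: "\<forall>k. AE \<omega> in M. \<forall>s \<in> singular_values (input_matrix B (Hc k \<omega>)). s \<noteq> 0 \<longrightarrow> \<sigma> \<le> s"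
      and \<delta>: "spectral_radius A \<noteq> 0 \<longrightarrow> \<delta> > 1 - inverse ((spectral_radius A)\<^sup>2)"
      and Ra_large: "block_diag Ra \<succ>\<^sub>L mat ((6 * C * power + 1) * inverse ((1 - (1 - \<delta>) * (spectral_radius A)\<^sup>2)\<^sup>2))"
    interpret game_noise M W V N w v Hc Ha by unfold_locales (rule game)
    define \<epsilon> where "\<epsilon> = 1 - (1 - \<delta>) * \<rho>\<^sup>2"
    define z where "z = 2 * C / \<epsilon>"
    let ?b = "\<lambda>\<omega>. input_matrix B (Hc 0 \<omega>)"
    let ?law = "distr M borel ?b"
    have bm: "?b \<in> borel_measurable M" using noise_measurable(3)[of 0] by measurable
    have N: "prob_space N" using prob_space_distr[OF noise_measurable(4)[of 0]] game_facts(8)[of 0] by simp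
    have sN: "sets N = sets borel" using sets_distr[of M borel "Ha 0"] game_facts(8)[of 0] by simp
    have \<delta>1: "\<delta> \<le> 1" unfolding full[rule_format, of 0, symmetric] by (rule prob_le_1)
    have \<epsilon>: "0 < \<epsilon>" "\<epsilon> \<le> 1"
    proof -
      show "\<epsilon> \<le> 1" using \<delta>1 by (simp add: \<epsilon>_def)
      show "0 < \<epsilon>"
      \<comment> \<open>For a zero spectral radius the condition on \<delta> is vacuous and
        \<epsilon> is 1.\<close>
      proof (cases "\<rho> = 0")
        case False
        then have "(1 - \<delta>) * \<rho>\<^sup>2 < inverse (\<rho>\<^sup>2) * \<rho>\<^sup>2"
          using \<delta> by (intro mult_strict_right_mono) (auto simp: \<rho>_def)
        then show ?thesis using False by (simp add: \<epsilon>_def)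
      qed (simp add: \<epsilon>_def)
    qed
    have law0: "measure ?law {0} = 1 - \<delta>"
      using zero bm by (simp add: measure_distr vimage_def Int_def conj_commute)
    have lower: "AE b in ?law. b \<noteq> 0 \<longrightarrow> (\<forall>y. \<sigma>\<^sup>2 * (norm y)\<^sup>2 \<le> (norm (transpose b *v y))\<^sup>2)"
    proof (subst AE_distr_iff[OF bm])
      have "{b :: real^('c \<times> 'tc)^'s. b \<noteq> 0 \<longrightarrow> (\<forall>y. \<sigma>\<^sup>2 * (norm y)\<^sup>2 \<le> (norm (transpose b *v y))\<^sup>2)}
        = {0} \<union> {b. \<forall>y. \<sigma>\<^sup>2 * (norm y)\<^sup>2 \<le> (norm (transpose b *v y))\<^sup>2}" by auto
      also have "\<dots> \<in> sets borel"
        by (intro sets.Un borel_closed closed_lower_bound closed_singleton)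
      finally show "{b \<in> space borel. b \<noteq> 0 \<longrightarrow> (\<forall>y. \<sigma>\<^sup>2 * (norm y)\<^sup>2 \<le> (norm (transpose (b :: real^('c \<times> 'tc)^'s) *v y))\<^sup>2)} \<in> sets borel"
        by (simp del: transpose_matrix_vector)
      have rank: "AE \<omega> in M. ?b \<omega> \<noteq> 0 \<longrightarrow> rank (?b \<omega>) = CARD('s)"
        by (rule AE_zero_or_full_rank[OF bm]) (use full zero in auto)
      show "AE \<omega> in M. ?b \<omega> \<noteq> 0 \<longrightarrow> (\<forall>y. \<sigma>\<^sup>2 * (norm y)\<^sup>2 \<le> (norm (transpose (?b \<omega>) *v y))\<^sup>2)"
        using rank sv[rule_format, of 0]
        by eventually_elim (use full_rank_lower_bound[OF _ \<open>\<sigma> > 0\<close>] in blast)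
    qed
    interpret NF: random_input N "input_matrix B"
    proof (rule random_input.intro[OF N], unfold_locales)
      show "input_matrix B \<in> borel_measurable N"
        unfolding measurable_cong_sets[OF sN refl] by measurable
    qed (rule assms(6))
    interpret law: prob_space ?law by (rule prob_space_distr[OF bm])
    have power: "NF.power = power" by (simp add: NF.power_def power_def)
    interpret lq_game M W V N w v Hc Ha A B Q Rc Ra \<rho> \<sigma> \<epsilon> C z x0
    proof unfold_locales
      show "pos_def (block_diag Rc)" "pos_def (block_diag Ra)"
        using assms(5) Ra by (auto intro: pos_def_block_diag)
      show "(norm (A *v x))\<^sup>2 \<le> \<rho>\<^sup>2 * (norm x)\<^sup>2" for x
        unfolding \<rho>_def by (rule norm_le_spectral_radius[OF assms(1)])
      show "measure ?law {0} * \<rho>\<^sup>2 = 1 - \<epsilon>" by (simp add: law0 \<epsilon>_def)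
      show "AE b in ?law. b \<noteq> 0 \<longrightarrow> (\<forall>y. \<sigma>\<^sup>2 * (norm y)\<^sup>2 \<le> (norm (transpose b *v y))\<^sup>2)" by (rule lower)
      show "(6 * C * NF.power + 1) / \<epsilon>\<^sup>2 * (norm a)\<^sup>2 < wnorm2 (block_diag Ra) a" if "a \<noteq> 0" for a
      proof -
        have "0 < wnorm2 (block_diag Ra - mat ((6 * C * power + 1) * inverse (\<epsilon>\<^sup>2))) a"
          using Ra_large that unfolding loewner_greater_def pos_def_def wnorm2_def \<epsilon>_def \<rho>_def by blast
        then show ?thesis by (simp add: wnorm2_diff_matrix wnorm2_mat power divide_inverse)
      qed
    qed (use assms(4,7) \<epsilon> in \<open>auto simp: C_def z_def\<close>)
    show "\<exists>val. has_game_value (average_cost M A B Q Rc Ra x0 w v Hc Ha) val"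
      by (rule game_value)
  qed
qed

end
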